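(* Let $N\ge1$ and consider the differential calculus of the fuzzy sphere spectral triple $(A_N,H_N,D_N)$ described in the context, with $\mathcal{E}=\Omega^1(A_N)$. Then: (1) the multiplication map $\mathcal{Z}(\mathcal{E})\otimes_{\mathcal{Z}(A_N)}A_N\to\mathcal{E}$ is an isomorphism; (2) there is a right $A_N$-submodule $\mathcal{F}\subseteq\mathcal{E}\otimes_{A_N}\mathcal{E}$ with $\mathcal{E}\otimes_{A_N}\mathcal{E}=\ker(\wedge)\oplus\mathcal{F}$ and $\wedge|_{\mathcal{F}}:\mathcal{F}\to\Omega^2(A_N)$ a right $A_N$-module isomorphism; (3) for the associated $\sigma=2P_{\rm sym}-1$, $\sigma(\omega\otimes_{A_N}\eta)=\eta\otimes_{A_N}\omega$ for all $\omega,\eta\in\mathcal{Z}(\mathcal{E})$. Consequently, for every pseudo-Riemannian bilinear metric $g$ on $\mathcal{E}$ there exists a unique connection on $\mathcal{E}$ which is torsionless and compatible with $g$ on $\mathcal{Z}(\mathcal{E})$.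
   Context: Fuzzy sphere spectral triple: $J_1,J_2,J_3$ basis of $su(2)$ with $[J_k,J_l]=\sum_m\epsilon_{klm}J_m$; $\rho_{n/2}$ the $(n+1)$-dimensional irreducible unitary representation; $K_N=\oplus_{n=0}^N\mathbb{C}^{n+1}$, $X_k=\oplus_{n=0}^N\rho_{n/2}(J_k)$, $A_N=B(K_N)$, $H_N=K_N\otimes\mathbb{C}^2$ with $a\mapsto a\otimes1$, $\sigma_k=\sqrt{-1}\tau_k$ ($\tau_k$ Pauli matrices), $D_N=\sum_kX_k\otimes\sigma_k$, $B(H_N)=A_N\otimes M_2(\mathbb{C})$. Its differential calculus: $\Omega^1(A_N)=\{\sum a_j[D_N,b_j]\}$, $da=[D_N,a]$; $\Omega^2(A_N)=\mathcal{S}/J^2$ where $\mathcal{S}$ is the span of products $a_0[D_N,a_1][D_N,a_2]$ and $J^2=\{\sum_j[D_N,a_j][D_N,b_j]:\sum_ja_j[D_N,b_j]=0\}$; $\wedge:\mathcal{E}\otimes_{A_N}\mathcal{E}\to\Omega^2(A_N)$ is operator multiplication followed by the quotient map, and $d$ on one-forms is $d(\sum a_j[D_N,b_j])=[\sum_j[D_N,a_j][D_N,b_j]]$. $\mathcal{Z}(\mathcal{M})=\{m:am=ma\ \forall a\}$. $P_{\rm sym}$ is the idempotent with image $\ker\wedge$ and kernel $\mathcal{F}$. A connection is a $\mathbb{C}$-linear $\nabla:\mathcal{E}\to\mathcal{E}\otimes_{A_N}\mathcal{E}$ with $\nabla(\omega a)=\nabla(\omega)a+\omega\otimes da$; torsionless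 means $\wedge\circ\nabla+d=0$. A pseudo-Riemannian bilinear metric is an $A_N$-bimodule map $g:\mathcal{E}\otimes_{A_N}\mathcal{E}\to A_N$ with $g\circ\sigma=g$ and $e\mapsto g(e\otimes-)$ a right module isomorphism $\mathcal{E}\to\mathrm{Hom}_{A_N}(\mathcal{E},A_N)$. Compatibility on $\mathcal{Z}(\mathcal{E})$: $(g\otimes\mathrm{id})\{\sigma_{23}(\nabla(\omega)\otimes\eta)+\omega\otimes\nabla(\eta)\}=d(g(\omega\otimes\eta))$ for all $\omega,\eta\in\mathcal{Z}(\mathcal{E})$, with $\sigma_{23}=\mathrm{id}\otimes\sigma$ and $(g\otimes\mathrm{id})(x\otimes y\otimes z)=g(x\otimes y)z$. *)

theory Defs
  imports Complex_Main "HOL-Library.Function_Algebras"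
begin

text \<open>A matrix is represented by its entry function; an n x n matrix is one
whose entries vanish outside the index range 0..n-1.  Matrix product is
mmul n (NOT the pointwise product of functions).\<close>

type_synonym cmat = "nat \<Rightarrow> nat \<Rightarrow> complex"

definition mats :: "nat \<Rightarrow> cmat set" where
  "mats n = {A. \<forall>i j. (n \<le> i \<or> n \<le> j) \<longrightarrow> A i j = 0}"

definition mmul :: "nat \<Rightarrow> cmat \<Rightarrow> cmat \<Rightarrow> cmat" where
  "mmul n A B = (\<lambda>i j. \<Sum>k<n. A i k * B k j)"

definition smul :: "complex \<Rightarrow> cmat \<Rightarrow> cmat" where
  "smul c A = (\<lambda>i j. c * A i j)"

definition commu :: "nat \<Rightarrow> cmat \<Rightarrow> cmat \<Rightarrow> cmat" where
  "commu n A B = mmul n A B - mmul n B A"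

definition sqc :: "nat \<Rightarrow> nat \<Rightarrow> complex" where
  "sqc n a = complex_of_real (sqrt (real (a * (n + 1 - a))))"

text \<open>rho n k = rho_{n/2}(J_k), k = 1,2,3, in the standard basis (spin matrices
 S_k with J_k = -i S_k); these satisfy [J_k,J_l] = eps_klm J_m and are
 anti-Hermitian, giving the (n+1)-dimensional irreducible unitary representation.\<close>

definition rho :: "nat \<Rightarrow> nat \<Rightarrow> cmat" where
  "rho n k = (\<lambda>r c. if r \<le> n \<and> c \<le> n then
     (if k = 1 then - (\<i> / 2) * ((if r + 1 = c then sqc n c else 0) + (if c + 1 = r then sqc n r else 0))
      else if k = 2 then - (1 / 2) * ((if r + 1 = c then sqc n c else 0) - (if c + 1 = r then sqc n r else 0))
      else if k = 3 then - \<i> * complex_of_real (real n / 2 - real r) * (if r = c then 1 else 0)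
      else 0)
   else 0)"

definition off :: "nat \<Rightarrow> nat" where
  "off n = n * (n + 1) div 2"

text \<open>dim K_N = 1 + 2 + ... + (N+1).\<close>
definition dimK :: "nat \<Rightarrow> nat" where
  "dimK N = off (N + 1)"

definition Xop :: "nat \<Rightarrow> nat \<Rightarrow> cmat" where
  "Xop N k = (\<lambda>i j. \<Sum>n\<le>N. if off n \<le> i \<and> i < off (n + 1) \<and> off n \<le> j \<and> j < off (n + 1)
                       then rho n k (i - off n) (j - off n) else 0)"

text \<open>sigma_k = sqrt(-1) tau_k, tau_k the Pauli matrices.\<close>
definition sig :: "nat \<Rightarrow> nat \<Rightarrow> nat \<Rightarrow> complex" where
  "sig k s t = \<i> * (if s < 2 \<and> t < 2 then
      (if k = 1 then (if s \<noteq> t then 1 else 0)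
       else if k = 2 then (if s = 0 \<and> t = 1 then - \<i> else if s = 1 \<and> t = 0 then \<i> else 0)
       else if k = 3 then (if s = t then (if s = 0 then 1 else -1) else 0)
       else 0) else 0)"

text \<open>H_N = K_N (x) C^2 with basis index 2*i + s (i index in K_N, s in {0,1}).\<close>
definition dimH :: "nat \<Rightarrow> nat" where
  "dimH N = 2 * dimK N"

definition Dop :: "nat \<Rightarrow> cmat" where
  "Dop N = (\<lambda>p q. \<Sum>k\<in>{1,2,3::nat}. Xop N k (p div 2) (q div 2) * sig k (p mod 2) (q mod 2))"

text \<open>Representation a |-> a (x) 1 of A_N on H_N.\<close>
definition iota :: "cmat \<Rightarrow> cmat" where
  "iota a = (\<lambda>p q. if p mod 2 = q mod 2 then a (p div 2) (q div 2) else 0)"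

definition AN :: "nat \<Rightarrow> cmat set" where
  "AN N = mats (dimK N)"

definition dA :: "nat \<Rightarrow> cmat \<Rightarrow> cmat" where
  "dA N a = commu (dimH N) (Dop N) (iota a)"

definition Omega1 :: "nat \<Rightarrow> cmat set" where
  "Omega1 N = {sum_list (map (\<lambda>(a, b). mmul (dimH N) (iota a) (dA N b)) ps) | ps.
                 set ps \<subseteq> AN N \<times> AN N}"

text \<open>The span S of the products a0 [D,a1] [D,a2] (scalars are absorbed in a0).\<close>
definition SS :: "nat \<Rightarrow> cmat set" where
  "SS N = {sum_list (map (\<lambda>(a0, a1, a2). mmul (dimH N) (mmul (dimH N) (iota a0) (dA N a1)) (dA N a2)) ts)
           | ts. set ts \<subseteq> AN N \<times> AN N \<times> AN N}"

definition J2 :: "nat \<Rightarrow> cmat set" where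
  "J2 N = {sum_list (map (\<lambda>(a, b). mmul (dimH N) (dA N a) (dA N b)) ps) | ps.
             set ps \<subseteq> AN N \<times> AN N \<and>
             sum_list (map (\<lambda>(a, b). mmul (dimH N) (iota a) (dA N b)) ps) = 0}"

text \<open>Omega^2 = SS N / J2 N; its elements are represented by elements of SS N,
 two representatives being equal iff their difference lies in J2 N.\<close>

definition ZA :: "nat \<Rightarrow> cmat set" where
  "ZA N = {z \<in> AN N. \<forall>a \<in> AN N. mmul (dimK N) z a = mmul (dimK N) a z}"

definition ZE :: "nat \<Rightarrow> cmat set" where
  "ZE N = {w \<in> Omega1 N. \<forall>a \<in> AN N. mmul (dimH N) (iota a) w = mmul (dimH N) w (iota a)}"

text \<open>Formal finite linear combinations of pairs (free vector space); the tensor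
 product M1 (x)_R M2 is the quotient of the finitely supported combinations of
 pairs in M1 x M2 by the span of the bilinearity and balancing relations.\<close>

type_synonym ftens = "cmat \<times> cmat \<Rightarrow> complex"

definition tg :: "cmat \<Rightarrow> cmat \<Rightarrow> ftens" where
  "tg x y = (\<lambda>p. if p = (x, y) then 1 else 0)"

definition fsc :: "complex \<Rightarrow> ftens \<Rightarrow> ftens" where
  "fsc c f = (\<lambda>p. c * f p)"

definition cspan :: "ftens set \<Rightarrow> ftens set" where
  "cspan S = {sum_list (map (\<lambda>(c, v). fsc c v) cs) | cs. set (map snd cs) \<subseteq> S}"

definition free :: "cmat set \<Rightarrow> cmat set \<Rightarrow> ftens set" where
  "free M1 M2 = {f. finite {p. f p \<noteq> 0} \<and> {p. f p \<noteq> 0} \<subseteq> M1 \<times> M2}"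

definition trel :: "cmat set \<Rightarrow> cmat set \<Rightarrow> cmat set \<Rightarrow> (cmat \<Rightarrow> cmat \<Rightarrow> cmat)
                      \<Rightarrow> (cmat \<Rightarrow> cmat \<Rightarrow> cmat) \<Rightarrow> ftens set" where
  "trel M1 M2 R ract lact =
     {tg (x + x') y - tg x y - tg x' y | x x' y. x \<in> M1 \<and> x' \<in> M1 \<and> y \<in> M2}
   \<union> {tg x (y + y') - tg x y - tg x y' | x y y'. x \<in> M1 \<and> y \<in> M2 \<and> y' \<in> M2}
   \<union> {tg (smul c x) y - fsc c (tg x y) | c x y. x \<in> M1 \<and> y \<in> M2}
   \<union> {tg x (smul c y) - fsc c (tg x y) | c x y. x \<in> M1 \<and> y \<in> M2}
   \<union> {tg (ract x r) y - tg x (lact r y) | x r y. x \<in> M1 \<and> r \<in> R \<and> y \<in> M2}"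

definition teq :: "cmat set \<Rightarrow> cmat set \<Rightarrow> cmat set \<Rightarrow> (cmat \<Rightarrow> cmat \<Rightarrow> cmat)
                      \<Rightarrow> (cmat \<Rightarrow> cmat \<Rightarrow> cmat) \<Rightarrow> ftens \<Rightarrow> ftens \<Rightarrow> bool" where
  "teq M1 M2 R ract lact f g \<longleftrightarrow> f - g \<in> cspan (trel M1 M2 R ract lact)"

definition tsumM :: "ftens \<Rightarrow> (cmat \<Rightarrow> cmat \<Rightarrow> cmat) \<Rightarrow> cmat" where
  "tsumM f h = (\<Sum>p\<in>{p. f p \<noteq> 0}. smul (f p) (h (fst p) (snd p)))"

definition tsumT :: "ftens \<Rightarrow> (cmat \<Rightarrow> cmat \<Rightarrow> ftens) \<Rightarrow> ftens" where
  "tsumT f h = (\<Sum>p\<in>{p. f p \<noteq> 0}. fsc (f p) (h (fst p) (snd p)))"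

definition EE :: "nat \<Rightarrow> ftens set" where
  "EE N = free (Omega1 N) (Omega1 N)"

definition teqE :: "nat \<Rightarrow> ftens \<Rightarrow> ftens \<Rightarrow> bool" where
  "teqE N = teq (Omega1 N) (Omega1 N) (AN N)
              (\<lambda>x a. mmul (dimH N) x (iota a)) (\<lambda>a y. mmul (dimH N) (iota a) y)"

text \<open>Operator multiplication E (x)_A E -> B(H_N); the wedge is this followed by
 the quotient map onto SS N / J2 N.\<close>
definition multE :: "nat \<Rightarrow> ftens \<Rightarrow> cmat" where
  "multE N t = tsumM t (\<lambda>x y. mmul (dimH N) x y)"

definition rmulT :: "nat \<Rightarrow> ftens \<Rightarrow> cmat \<Rightarrow> ftens" where
  "rmulT N t a = tsumT t (\<lambda>x y. tg x (mmul (dimH N) y (iota a)))"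

definition kerw :: "nat \<Rightarrow> ftens set" where
  "kerw N = {t \<in> EE N. multE N t \<in> J2 N}"

text \<open>F (given as the saturated set of representatives of its elements) is a right
 A_N-submodule complementing ker(wedge), and wedge restricted to F is a right module
 isomorphism onto Omega^2.\<close>
definition good_F :: "nat \<Rightarrow> ftens set \<Rightarrow> bool" where
  "good_F N F \<longleftrightarrow>
     F \<subseteq> EE N \<and>
     (\<forall>t \<in> F. \<forall>u \<in> EE N. teqE N t u \<longrightarrow> u \<in> F) \<and>
     0 \<in> F \<and>
     (\<forall>t \<in> F. \<forall>u \<in> F. t + u \<in> F) \<and>
     (\<forall>c. \<forall>t \<in> F. fsc c t \<in> F) \<and>
     (\<forall>t \<in> F. \<forall>a \<in> AN N. rmulT N t a \<in> F) \<and>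
     (\<forall>t \<in> EE N. \<exists>k \<in> kerw N. \<exists>f \<in> F. teqE N t (k + f)) \<and>
     (\<forall>t. t \<in> kerw N \<and> t \<in> F \<longrightarrow> teqE N t 0) \<and>
     (\<forall>f \<in> F. \<forall>a \<in> AN N. multE N (rmulT N f a) = mmul (dimH N) (multE N f) (iota a)) \<and>
     (\<forall>f \<in> F. multE N f \<in> J2 N \<longrightarrow> teqE N f 0) \<and>
     (\<forall>s \<in> SS N. \<exists>f \<in> F. multE N f - s \<in> J2 N)"

text \<open>sigma = 2 P_sym - 1: if t = k + f with k in ker(wedge), f in F, then
 sigma(t) = 2k - t = k - f.\<close>
definition is_sigma :: "nat \<Rightarrow> ftens set \<Rightarrow> ftens \<Rightarrow> ftens \<Rightarrow> bool" where
  "is_sigma N F t u \<longleftrightarrow> (\<exists>k \<in> kerw N. \<exists>f \<in> F. teqE N t (k + f) \<and> teqE N u (k - f))"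

definition sigmaF :: "nat \<Rightarrow> ftens set \<Rightarrow> ftens \<Rightarrow> ftens" where
  "sigmaF N F t = (SOME u. u \<in> EE N \<and> is_sigma N F t u)"

definition part1 :: "nat \<Rightarrow> bool" where
  "part1 N \<longleftrightarrow>
     (let tq = teq (ZE N) (AN N) (ZA N) (\<lambda>x z. mmul (dimH N) x (iota z)) (\<lambda>z a. mmul (dimK N) z a);
          mZ = (\<lambda>t. tsumM t (\<lambda>x a. mmul (dimH N) x (iota a)))
      in (\<forall>t \<in> free (ZE N) (AN N). mZ t \<in> Omega1 N) \<and>
         (\<forall>w \<in> Omega1 N. \<exists>t \<in> free (ZE N) (AN N). mZ t = w) \<and>
         (\<forall>t \<in> free (ZE N) (AN N). mZ t = 0 \<longrightarrow> tq t 0))"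

definition gT :: "(cmat \<Rightarrow> cmat \<Rightarrow> cmat) \<Rightarrow> ftens \<Rightarrow> cmat" where
  "gT g t = tsumM t g"

definition rhom :: "nat \<Rightarrow> (cmat \<Rightarrow> cmat) \<Rightarrow> bool" where
  "rhom N phi \<longleftrightarrow>
     (\<forall>y \<in> Omega1 N. phi y \<in> AN N) \<and>
     (\<forall>y \<in> Omega1 N. \<forall>y' \<in> Omega1 N. phi (y + y') = phi y + phi y') \<and>
     (\<forall>c. \<forall>y \<in> Omega1 N. phi (smul c y) = smul c (phi y)) \<and>
     (\<forall>y \<in> Omega1 N. \<forall>a \<in> AN N. phi (mmul (dimH N) y (iota a)) = mmul (dimK N) (phi y) a)"

text \<open>A pseudo-Riemannian bilinear metric, given by its values g x y = g(x (x) y)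
 on pairs (an A_N-balanced bilinear bimodule map, hence a bimodule map on E (x)_A E).\<close>
definition is_metric :: "nat \<Rightarrow> ftens set \<Rightarrow> (cmat \<Rightarrow> cmat \<Rightarrow> cmat) \<Rightarrow> bool" where
  "is_metric N F g \<longleftrightarrow>
     (\<forall>x \<in> Omega1 N. \<forall>y \<in> Omega1 N. g x y \<in> AN N) \<and>
     (\<forall>x \<in> Omega1 N. \<forall>x' \<in> Omega1 N. \<forall>y \<in> Omega1 N. g (x + x') y = g x y + g x' y) \<and>
     (\<forall>x \<in> Omega1 N. \<forall>y \<in> Omega1 N. \<forall>y' \<in> Omega1 N. g x (y + y') = g x y + g x y') \<and>
     (\<forall>c. \<forall>x \<in> Omega1 N. \<forall>y \<in> Omega1 N. g (smul c x) y = smul c (g x y) \<and> g x (smul c y) = smul c (g x y)) \<and>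
     (\<forall>x \<in> Omega1 N. \<forall>y \<in> Omega1 N. \<forall>a \<in> AN N.
        g (mmul (dimH N) x (iota a)) y = g x (mmul (dimH N) (iota a) y)) \<and>
     (\<forall>x \<in> Omega1 N. \<forall>y \<in> Omega1 N. \<forall>a \<in> AN N.
        g (mmul (dimH N) (iota a) x) y = mmul (dimK N) a (g x y) \<and>
        g x (mmul (dimH N) y (iota a)) = mmul (dimK N) (g x y) a) \<and>
     (\<forall>t \<in> EE N. gT g (sigmaF N F t) = gT g t) \<and>
     (\<forall>e \<in> Omega1 N. (\<forall>y \<in> Omega1 N. g e y = 0) \<longrightarrow> e = 0) \<and>
     (\<forall>phi. rhom N phi \<longrightarrow> (\<exists>e \<in> Omega1 N. \<forall>y \<in> Omega1 N. phi y = g e y))"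

definition is_connection :: "nat \<Rightarrow> (cmat \<Rightarrow> ftens) \<Rightarrow> bool" where
  "is_connection N nb \<longleftrightarrow>
     (\<forall>w \<in> Omega1 N. nb w \<in> EE N) \<and>
     (\<forall>w \<in> Omega1 N. \<forall>w' \<in> Omega1 N. teqE N (nb (w + w')) (nb w + nb w')) \<and>
     (\<forall>c. \<forall>w \<in> Omega1 N. teqE N (nb (smul c w)) (fsc c (nb w))) \<and>
     (\<forall>w \<in> Omega1 N. \<forall>a \<in> AN N.
        teqE N (nb (mmul (dimH N) w (iota a))) (rmulT N (nb w) a + tg w (dA N a)))"

text \<open>wedge o nabla + d = 0, with d(sum a_j [D,b_j]) = [sum [D,a_j][D,b_j]].\<close>
definition torsionless :: "nat \<Rightarrow> (cmat \<Rightarrow> ftens) \<Rightarrow> bool" where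
  "torsionless N nb \<longleftrightarrow>
     (\<forall>ps. set ps \<subseteq> AN N \<times> AN N \<longrightarrow>
        multE N (nb (sum_list (map (\<lambda>(a, b). mmul (dimH N) (iota a) (dA N b)) ps)))
        + sum_list (map (\<lambda>(a, b). mmul (dimH N) (dA N a) (dA N b)) ps) \<in> J2 N)"

definition gid :: "nat \<Rightarrow> (cmat \<Rightarrow> cmat \<Rightarrow> cmat) \<Rightarrow> cmat \<Rightarrow> ftens \<Rightarrow> cmat" where
  "gid N g x t = tsumM t (\<lambda>y z. mmul (dimH N) (iota (g x y)) z)"

definition compatible :: "nat \<Rightarrow> ftens set \<Rightarrow> (cmat \<Rightarrow> cmat \<Rightarrow> cmat) \<Rightarrow> (cmat \<Rightarrow> ftens) \<Rightarrow> bool" where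
  "compatible N F g nb \<longleftrightarrow>
     (\<forall>w \<in> ZE N. \<forall>y \<in> ZE N.
        tsumM (nb w) (\<lambda>x1 x2. gid N g x1 (sigmaF N F (tg x2 y))) + gid N g w (nb y)
        = dA N (g w y))"

definition LC_conn :: "nat \<Rightarrow> ftens set \<Rightarrow> (cmat \<Rightarrow> cmat \<Rightarrow> cmat) \<Rightarrow> (cmat \<Rightarrow> ftens) \<Rightarrow> bool" where
  "LC_conn N F g nb \<longleftrightarrow> is_connection N nb \<and> torsionless N nb \<and> compatible N F g nb"

end

theory Submission
  imports Defs
begin

text \<open>In the frame \<open>1 \<otimes> \<sigma>\<^sub>k\<close> of central elements the one-forms are the free bimodule \<open>A\<^sub>N\<^sup>3\<close>:
  maps from the spin 0 to the spin 1/2 summand, on which the \<open>X\<^sub>k\<close> act as Pauli matrices, already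
  generate all of it.  The same maps show that \<open>J\<^sup>2\<close> is all of \<open>A\<^sub>N \<otimes> 1\<close>; it is no larger because
  the antisymmetric part of \<open>\<Sum> [D, a] [D, b]\<close> only depends on \<open>\<Sum> a [D, b]\<close>, by the commutation
  relations.  Hence the kernel of the wedge product consists of the tensors with symmetric
  coordinates, and the antisymmetric ones form the complement.  A metric is a constant symmetric
  invertible 3 x 3 matrix, being torsionless and compatible is a linear system for the coordinates of
  the connection on the frame, and the Koszul trick solves it uniquely.\<close>

subsection \<open>Matrices as entry functions\<close>

text \<open>The spin 0 summand matters because every \<open>Xop N k\<close> vanishes there: the
  commutator with a matrix unit from index 0 into the spin 1/2 summand is a one-sided product.
  Further matrix units then isolate single entries of a Pauli matrix, and trace orthogonality
  separates the three directions. Traces of the \<open>Xop N k\<close> and of their products drive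
  the computation of \<open>J2 N\<close> in the same way. The other recurrent principle is that the
  centre of the full matrix algebra consists of scalars, so central one-forms are constant
  combinations of the frame. Derivatives therefore drop out of the compatibility condition, while
  the derivative terms of a connection are forced by the Leibniz rule. The obstacle is that tensors
  are formal combinations modulo relations: equality modulo relations has to be decided by
  coordinates. One argument, moving left coordinates across the tensor sign, does this for both
  balanced products. The unknown connection coefficients are matrices, but their system has scalar
  coefficients, so uniqueness is proved entry by entry.\<close>

lemma sum_fun2_apply: "(\<Sum>x\<in>S. f x) i j = (\<Sum>x\<in>S. f x i j)"
  for f :: "'a \<Rightarrow> 'b \<Rightarrow> 'c \<Rightarrow> 'd::comm_monoid_add"
  by (induction S rule: infinite_finite_induct) auto

lemma mmul_add_left: "mmul n (A + B) C = mmul n A C + mmul n B C"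
  by (simp add: mmul_def fun_eq_iff algebra_simps sum.distrib)

lemma mmul_add_right: "mmul n A (B + C) = mmul n A B + mmul n A C"
  by (simp add: mmul_def fun_eq_iff algebra_simps sum.distrib)

lemma mmul_diff_left: "mmul n (A - B) C = mmul n A C - mmul n B C"
  by (simp add: mmul_def fun_eq_iff algebra_simps sum_subtractf)

lemma mmul_diff_right: "mmul n A (B - C) = mmul n A B - mmul n A C"
  by (simp add: mmul_def fun_eq_iff algebra_simps sum_subtractf)

lemma mmul_minus_left: "mmul n (- A) C = - mmul n A C"
  by (simp add: mmul_def fun_eq_iff sum_negf)

lemma mmul_minus_right: "mmul n A (- C) = - mmul n A C"
  by (simp add: mmul_def fun_eq_iff sum_negf)

lemma mmul_smul_left: "mmul n (smul c A) C = smul c (mmul n A C)"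
  by (simp add: mmul_def smul_def fun_eq_iff sum_distrib_left algebra_simps)

lemma mmul_smul_right: "mmul n A (smul c C) = smul c (mmul n A C)"
  by (simp add: mmul_def smul_def fun_eq_iff sum_distrib_left algebra_simps)

lemma mmul_zero_left [simp]: "mmul n 0 C = 0"
  by (simp add: mmul_def fun_eq_iff)

lemma mmul_zero_right [simp]: "mmul n C 0 = 0"
  by (simp add: mmul_def fun_eq_iff)

lemma mmul_sum_left: "mmul n (\<Sum>x\<in>S. f x) C = (\<Sum>x\<in>S. mmul n (f x) C)"
  by (rule sum_comp_morphism[of "\<lambda>A. mmul n A C", unfolded o_def, symmetric]) (simp_all add: mmul_add_left)

lemma mmul_sum_right: "mmul n C (\<Sum>x\<in>S. f x) = (\<Sum>x\<in>S. mmul n C (f x))"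
  by (rule sum_comp_morphism[of "mmul n C", unfolded o_def, symmetric]) (simp_all add: mmul_add_right)

lemma mmul_assoc: "mmul n (mmul n A B) C = mmul n A (mmul n B C)"
proof -
  have "(\<Sum>k<n. (\<Sum>l<n. A i l * B l k) * C k j) = (\<Sum>l<n. A i l * (\<Sum>k<n. B l k * C k j))" for i j
    by (simp add: sum_distrib_left sum_distrib_right mult.assoc) (rule sum.swap)
  then show ?thesis by (simp add: mmul_def)
qed

lemmas mmul_distribs = mmul_add_left mmul_add_right mmul_diff_left mmul_diff_right
  mmul_minus_left mmul_minus_right mmul_smul_left mmul_smul_right

lemma smul_add: "smul c (A + B) = smul c A + smul c B"
  by (simp add: smul_def fun_eq_iff algebra_simps)

lemma smul_diff: "smul c (A - B) = smul c A - smul c B"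
  by (simp add: smul_def fun_eq_iff algebra_simps)

lemma smul_add_coeff: "smul (c + e) A = smul c A + smul e A"
  by (simp add: smul_def fun_eq_iff algebra_simps)

lemma smul_smul: "smul c (smul e A) = smul (c * e) A"
  by (simp add: smul_def fun_eq_iff)

lemma smul_zero [simp]: "smul 0 A = 0" "smul c 0 = 0"
  by (simp_all add: smul_def fun_eq_iff)

lemma smul_one [simp]: "smul 1 A = A"
  by (simp add: smul_def)

lemma smul_minus_one: "smul (-1) A = - A"
  by (simp add: smul_def fun_eq_iff)

lemma smul_sum: "smul c (\<Sum>x\<in>S. f x) = (\<Sum>x\<in>S. smul c (f x))"
  by (rule sum_comp_morphism[of "smul c", unfolded o_def, symmetric]) (simp_all add: smul_add)

lemma smul_sum_coeff: "smul (\<Sum>x\<in>S. c x) A = (\<Sum>x\<in>S. smul (c x) A)"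
  by (simp add: smul_def fun_eq_iff sum_fun2_apply sum_distrib_right)

lemma mats_add: "A \<in> mats n \<Longrightarrow> B \<in> mats n \<Longrightarrow> A + B \<in> mats n"
  by (simp add: mats_def)

lemma mats_diff: "A \<in> mats n \<Longrightarrow> B \<in> mats n \<Longrightarrow> A - B \<in> mats n"
  by (simp add: mats_def)

lemma mats_minus: "A \<in> mats n \<Longrightarrow> - A \<in> mats n"
  by (simp add: mats_def)

lemma mats_zero: "0 \<in> mats n"
  by (simp add: mats_def)

lemma mats_smul: "A \<in> mats n \<Longrightarrow> smul c A \<in> mats n"
  by (simp add: mats_def smul_def)

lemma mats_mmul: "A \<in> mats n \<Longrightarrow> B \<in> mats n \<Longrightarrow> mmul n A B \<in> mats n"
  by (auto simp add: mats_def mmul_def)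

lemma mats_commu: "A \<in> mats n \<Longrightarrow> B \<in> mats n \<Longrightarrow> commu n A B \<in> mats n"
  by (simp add: commu_def mats_diff mats_mmul)

lemma mats_sum: "(\<And>x. x \<in> S \<Longrightarrow> f x \<in> mats n) \<Longrightarrow> (\<Sum>x\<in>S. f x) \<in> mats n"
  unfolding mats_def by (auto simp: sum_fun2_apply intro!: sum.neutral)

lemmas mats_intros = mats_add mats_diff mats_minus mats_zero mats_smul mats_mmul mats_commu mats_sum

section \<open>Matrix units and the centre of a full matrix algebra\<close>

definition idm :: "nat \<Rightarrow> cmat" where
  "idm n = (\<lambda>i j. if i = j \<and> i < n then 1 else 0)"

definition munit :: "nat \<Rightarrow> nat \<Rightarrow> cmat" where
  "munit a b = (\<lambda>i j. if i = a \<and> j = b then 1 else 0)"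

lemma idm_mats: "idm n \<in> mats n"
  by (simp add: idm_def mats_def)

lemma munit_mats: "a < n \<Longrightarrow> b < n \<Longrightarrow> munit a b \<in> mats n"
  by (auto simp add: munit_def mats_def)

lemma idm_mmul: "A \<in> mats n \<Longrightarrow> mmul n (idm n) A = A"
proof (intro ext)
  fix i j assume A: "A \<in> mats n"
  have "mmul n (idm n) A i j = (\<Sum>k<n. if k = i then A k j else 0)"
    unfolding mmul_def idm_def by (intro sum.cong) auto
  then show "mmul n (idm n) A i j = A i j"
    using A by (auto simp: mats_def)
qed

lemma mmul_idm: "A \<in> mats n \<Longrightarrow> mmul n A (idm n) = A"
proof (intro ext)
  fix i j assume A: "A \<in> mats n"
  have "mmul n A (idm n) i j = (\<Sum>k<n. if k = j then A i k else 0)"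
    unfolding mmul_def idm_def by (intro sum.cong) auto
  then show "mmul n A (idm n) i j = A i j"
    using A by (auto simp: mats_def)
qed

lemma munit_mmul: "b < n \<Longrightarrow> mmul n (munit a b) A = (\<lambda>i j. if i = a then A b j else 0)"
proof (intro ext)
  fix i j assume b: "b < n"
  have "mmul n (munit a b) A i j = (\<Sum>k<n. if k = b then (if i = a then A k j else 0) else 0)"
    unfolding mmul_def munit_def by (intro sum.cong) auto
  then show "mmul n (munit a b) A i j = (if i = a then A b j else 0)"
    using b by simp
qed

lemma mmul_munit: "a < n \<Longrightarrow> mmul n A (munit a b) = (\<lambda>i j. if j = b then A i a else 0)"
proof (intro ext)
  fix i j assume a: "a < n"
  have "mmul n A (munit a b) i j = (\<Sum>k<n. if k = a then (if j = b then A i k else 0) else 0)"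
    unfolding mmul_def munit_def by (intro sum.cong) auto
  then show "mmul n A (munit a b) i j = (if j = b then A i a else 0)"
    using a by simp
qed

lemma munit_sandwich:
  "b < n \<Longrightarrow> c < n \<Longrightarrow> mmul n (munit a b) (mmul n A (munit c e)) = smul (A b c) (munit a e)"
  by (simp add: munit_mmul mmul_munit) (auto simp: smul_def munit_def fun_eq_iff)

text \<open>The products E_rk E_kr are the diagonal idempotents, whatever \<open>k\<close> is. With
  \<open>k = 0\<close> every matrix becomes a sum of products that factor through the spin 0
  vector.\<close>

lemma munit_resolution:
  assumes "k < n" "A \<in> mats n"
  shows "(\<Sum>r<n. mmul n A (mmul n (munit r k) (munit k r))) = A"
proof -
  have "(\<Sum>r<n. mmul n (munit r k) (munit k r)) = idm n"
  proof (intro ext)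
    fix i j
    have "(\<Sum>r<n. mmul n (munit r k) (munit k r)) i j = (\<Sum>r<n. if r = i then (if i = j then 1 else 0) else 0)"
      using assms(1) unfolding sum_fun2_apply
      by (intro sum.cong refl) (simp add: munit_mmul, simp add: munit_def)
    then show "(\<Sum>r<n. mmul n (munit r k) (munit k r)) i j = idm n i j"
      by (simp add: idm_def)
  qed
  then show ?thesis
    using assms by (simp add: mmul_sum_right[symmetric] mmul_idm)
qed

lemma commu_add: "commu n A (B + C) = commu n A B + commu n A C"
  by (simp add: commu_def mmul_distribs)

lemma commu_minus: "commu n A (- B) = - commu n A B"
  by (simp add: commu_def mmul_distribs)

lemma commu_smul: "commu n A (smul c B) = smul c (commu n A B)"
  by (simp add: commu_def mmul_distribs smul_diff)

lemma commu_zero [simp]: "commu n A 0 = 0"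
  by (simp add: commu_def)

lemma commu_mmul: "commu n A (mmul n B C) = mmul n (commu n A B) C + mmul n B (commu n A C)"
  by (simp add: commu_def mmul_distribs mmul_assoc)

lemma commu_jacobi:
  "commu n A (commu n B C) - commu n B (commu n A C) = commu n (mmul n A B - mmul n B A) C"
  by (simp add: commu_def mmul_distribs mmul_assoc)

lemma scalar_matrix_if_central:
  assumes "z \<in> mats n" "0 < n" "\<And>a. a \<in> mats n \<Longrightarrow> mmul n z a = mmul n a z"
  shows "z = smul (z 0 0) (idm n)"
proof (intro ext)
  fix i j
  have eq: "mmul n z (munit i 0) p q = mmul n (munit i 0) z p q" if "i < n" for p q
    using assms(3)[OF munit_mats[OF that assms(2)]] by simp
  show "z i j = smul (z 0 0) (idm n) i j"
  proof (cases "i < n \<and> j < n")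
    case True
    have "z j i = (if j = i then z 0 0 else 0)"
      using eq[of j 0] True assms(2) by (simp add: munit_mmul mmul_munit)
    moreover have "z i j = (if i = j then z 0 0 else 0)"
    proof -
      have "mmul n z (munit j 0) i 0 = mmul n (munit j 0) z i 0"
        using assms(3)[OF munit_mats[of j n 0]] True assms(2) by simp
      then show ?thesis using True assms(2) by (simp add: munit_mmul mmul_munit)
    qed
    ultimately show ?thesis using True by (simp add: smul_def idm_def)
  next
    case False
    then show ?thesis using assms(1) by (auto simp: mats_def smul_def idm_def)
  qed
qed

subsection \<open>Commutation relations of the angular momenta\<close>

text \<open>Cyclic successor on {1, 2, 3}. The triples \<open>(m, nxt m, nxt (nxt m))\<close> are
  the even permutations, so a relation with structure constants eps becomes one equation for each
  \<open>m\<close>.\<close>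

definition nxt :: "nat \<Rightarrow> nat" where
  "nxt k = (if k = 3 then 1 else k + 1)"

text \<open>The ladder operators S_+ and S_- and, below, the weight operator S_3 in the weight
  basis, where index \<open>r\<close> has weight n/2 - r. Each has at most one nonzero entry per
  row, so products collapse to shifts.\<close>

definition rho_up :: "nat \<Rightarrow> cmat" where
  "rho_up n = (\<lambda>r c. if r \<le> n \<and> c \<le> n \<and> r + 1 = c then sqc n c else 0)"

definition rho_dn :: "nat \<Rightarrow> cmat" where
  "rho_dn n = (\<lambda>r c. if r \<le> n \<and> c \<le> n \<and> c + 1 = r then sqc n r else 0)"

definition rho_wt :: "nat \<Rightarrow> cmat" where
  "rho_wt n = (\<lambda>r c. if r \<le> n \<and> r = c then complex_of_real (real n / 2 - real r) else 0)"

lemma nxt_simps [simp]: "nxt 1 = 2" "nxt (Suc 0) = 2" "nxt 2 = 3" "nxt 3 = 1"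
  by (simp_all add: nxt_def)

lemma rho_ladder:
  "rho n (Suc 0) = smul (- (\<i> / 2)) (rho_up n + rho_dn n)"
  "rho n 2 = smul (- (1 / 2)) (rho_up n - rho_dn n)"
  "rho n 3 = smul (- \<i>) (rho_wt n)"
  by (auto simp: rho_def rho_up_def rho_dn_def rho_wt_def smul_def fun_eq_iff)

lemma rho_up_mmul:
  "mmul (Suc n) (rho_up n) B = (\<lambda>r c. if r < n then sqc n (r + 1) * B (r + 1) c else 0)"
proof (intro ext)
  fix r c
  have "mmul (Suc n) (rho_up n) B r c =
      (\<Sum>k<Suc n. if k = Suc r then (if r < n then sqc n (r + 1) * B (r + 1) c else 0) else 0)"
    unfolding mmul_def rho_up_def by (intro sum.cong) auto
  then show "mmul (Suc n) (rho_up n) B r c = (if r < n then sqc n (r + 1) * B (r + 1) c else 0)"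
    by (simp only: sum.delta finite_lessThan) auto
qed

lemma rho_dn_mmul:
  "mmul (Suc n) (rho_dn n) B = (\<lambda>r c. if 0 < r \<and> r \<le> n then sqc n r * B (r - 1) c else 0)"
proof (intro ext)
  fix r c
  have "mmul (Suc n) (rho_dn n) B r c =
      (\<Sum>k<Suc n. if k = r - 1 then (if 0 < r \<and> r \<le> n then sqc n r * B (r - 1) c else 0) else 0)"
    unfolding mmul_def rho_dn_def by (intro sum.cong) auto
  then show "mmul (Suc n) (rho_dn n) B r c = (if 0 < r \<and> r \<le> n then sqc n r * B (r - 1) c else 0)"
    by (simp only: sum.delta finite_lessThan) auto
qed

lemma rho_wt_mmul:
  "mmul (Suc n) (rho_wt n) B =
    (\<lambda>r c. if r \<le> n then complex_of_real (real n / 2 - real r) * B r c else 0)"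
proof (intro ext)
  fix r c
  have "mmul (Suc n) (rho_wt n) B r c =
      (\<Sum>k<Suc n. if k = r then (if r \<le> n then complex_of_real (real n / 2 - real r) * B r c else 0) else 0)"
    unfolding mmul_def rho_wt_def by (intro sum.cong) auto
  then show "mmul (Suc n) (rho_wt n) B r c =
      (if r \<le> n then complex_of_real (real n / 2 - real r) * B r c else 0)"
    by (simp only: sum.delta finite_lessThan) auto
qed

lemma sqc_square: "a \<le> n + 1 \<Longrightarrow> sqc n a * sqc n a = of_nat a * (of_nat n + 1 - of_nat a)"
  by (simp add: sqc_def of_real_mult[symmetric] of_nat_diff del: of_real_mult) (simp add: algebra_simps)

lemma rho_up_dn: "mmul (Suc n) (rho_up n) (rho_dn n) - mmul (Suc n) (rho_dn n) (rho_up n)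
   = smul 2 (rho_wt n)"
proof (intro ext)
  fix r c
  show "(mmul (Suc n) (rho_up n) (rho_dn n) - mmul (Suc n) (rho_dn n) (rho_up n)) r c
     = smul 2 (rho_wt n) r c"
  proof (cases "r = c \<and> r \<le> n")
    case True
    have sq: "sqc n (r + 1) * sqc n (r + 1) = of_nat (r + 1) * (of_nat n + 1 - of_nat (r + 1))"
      "sqc n r * sqc n r = of_nat r * (of_nat n + 1 - of_nat r)"
      using True by (intro sqc_square; simp)+
    \<comment> \<open>At the ends of the weight string \<open>sqc n 0\<close> and
      \<open>sqc n (n + 1)\<close> vanish, so the formula also covers the truncated rows. The
      difference of squares is n - 2 r.\<close>
    have "(mmul (Suc n) (rho_up n) (rho_dn n) - mmul (Suc n) (rho_dn n) (rho_up n)) r c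
      = sqc n (r + 1) * sqc n (r + 1) - sqc n r * sqc n r"
      using True by (simp add: rho_up_mmul rho_dn_mmul) (auto simp: rho_up_def rho_dn_def sqc_def)
    also have "\<dots> = smul 2 (rho_wt n) r c"
      using True unfolding sq by (simp add: smul_def rho_wt_def algebra_simps)
    finally show ?thesis .
  next
    case False
    then show ?thesis
      by (simp add: rho_up_mmul rho_dn_mmul smul_def) (auto simp: rho_wt_def rho_up_def rho_dn_def)
  qed
qed

lemma rho_wt_up: "mmul (Suc n) (rho_wt n) (rho_up n) - mmul (Suc n) (rho_up n) (rho_wt n) = rho_up n"
  by (simp add: rho_wt_mmul rho_up_mmul fun_eq_iff)
    (auto simp: rho_up_def rho_wt_def algebra_simps)

lemma rho_wt_dn: "mmul (Suc n) (rho_wt n) (rho_dn n) - mmul (Suc n) (rho_dn n) (rho_wt n) = - rho_dn n"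
  by (simp add: rho_wt_mmul rho_dn_mmul fun_eq_iff)
    (auto simp: rho_dn_def rho_wt_def algebra_simps of_nat_diff)

text \<open>After substituting \<open>rho_ladder\<close>, the three cyclic cases are combinations of
  [S_+, S_-] = 2 S_3, [S_3, S_+] = S_+ and [S_3, S_-] = - S_-.\<close>

lemma rho_commutation:
  assumes "m \<in> {1, 2, 3}"
  shows "mmul (Suc n) (rho n (nxt m)) (rho n (nxt (nxt m)))
    - mmul (Suc n) (rho n (nxt (nxt m))) (rho n (nxt m)) = rho n m"
proof -
  have "mmul (Suc n) (rho n 1) (rho n 2) - mmul (Suc n) (rho n 2) (rho n 1)
     = smul (- (\<i> / 2)) (mmul (Suc n) (rho_up n) (rho_dn n) - mmul (Suc n) (rho_dn n) (rho_up n))"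
    by (simp add: rho_ladder mmul_distribs) (simp add: smul_def fun_eq_iff algebra_simps)
  then have 3: "mmul (Suc n) (rho n 1) (rho n 2) - mmul (Suc n) (rho n 2) (rho n 1) = rho n 3"
    by (simp add: rho_up_dn rho_ladder smul_smul)
  have "mmul (Suc n) (rho n 2) (rho n 3) - mmul (Suc n) (rho n 3) (rho n 2)
     = smul (- (\<i> / 2)) ((mmul (Suc n) (rho_wt n) (rho_up n) - mmul (Suc n) (rho_up n) (rho_wt n))
         - (mmul (Suc n) (rho_wt n) (rho_dn n) - mmul (Suc n) (rho_dn n) (rho_wt n)))"
    by (simp add: rho_ladder mmul_distribs) (simp add: smul_def fun_eq_iff algebra_simps)
  then have 1: "mmul (Suc n) (rho n 2) (rho n 3) - mmul (Suc n) (rho n 3) (rho n 2) = rho n 1"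
    by (simp add: rho_wt_up rho_wt_dn rho_ladder)
  have "mmul (Suc n) (rho n 3) (rho n 1) - mmul (Suc n) (rho n 1) (rho n 3)
     = smul (- (1 / 2)) ((mmul (Suc n) (rho_wt n) (rho_up n) - mmul (Suc n) (rho_up n) (rho_wt n))
         + (mmul (Suc n) (rho_wt n) (rho_dn n) - mmul (Suc n) (rho_dn n) (rho_wt n)))"
    by (simp add: rho_ladder mmul_distribs) (simp add: smul_def fun_eq_iff algebra_simps)
  then have 2: "mmul (Suc n) (rho n 3) (rho n 1) - mmul (Suc n) (rho n 1) (rho n 3) = rho n 2"
    by (simp add: rho_wt_up rho_wt_dn rho_ladder)
  show ?thesis using assms 1 2 3 by auto
qed

section \<open>Block diagonal assembly of the representations\<close>

definition block :: "nat \<Rightarrow> cmat \<Rightarrow> cmat" where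
  "block n A = (\<lambda>i j. if off n \<le> i \<and> i < off (n + 1) \<and> off n \<le> j \<and> j < off (n + 1)
     then A (i - off n) (j - off n) else 0)"

lemma Xop_blocks: "Xop N k = (\<Sum>n\<le>N. block n (rho n k))"
  by (simp add: Xop_def block_def fun_eq_iff sum_fun2_apply)

lemma off_Suc: "off (Suc n) = off n + Suc n"
  by (simp add: off_def)

lemma mono_off: "m \<le> n \<Longrightarrow> off m \<le> off n"
  unfolding off_def by (intro div_le_mono mult_mono) auto

lemma block_disjoint:
  assumes "off n \<le> k" "k < off (Suc n)" "off m \<le> k" "k < off (Suc m)"
  shows "n = m"
proof (rule ccontr)
  assume "n \<noteq> m"
  then have "Suc n \<le> m \<or> Suc m \<le> n" by auto
  then show False using mono_off[of "Suc n" m] mono_off[of "Suc m" n] assms by auto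
qed

lemma block_mmul:
  assumes "n \<le> N" "m \<le> N"
  shows "mmul (dimK N) (block n A) (block m B) = (if n = m then block n (mmul (Suc n) A B) else 0)"
proof (intro ext)
  fix i j
  show "mmul (dimK N) (block n A) (block m B) i j = (if n = m then block n (mmul (Suc n) A B) else 0) i j"
  proof (cases "n = m")
    case False
    then have "block n A i k * block m B k j = 0" for k
      using block_disjoint[of n k m] by (auto simp: block_def)
    then show ?thesis using False by (simp add: mmul_def del: mult_eq_0_iff)
  next
    case True
    define P where "P \<longleftrightarrow> off n \<le> i \<and> i < off (n + 1) \<and> off n \<le> j \<and> j < off (n + 1)"
    have "(\<Sum>k<dimK N. block n A i k * block n B k j)
      = (\<Sum>k\<in>{off n..<off (Suc n)}. block n A i k * block n B k j)"
      using mono_off[of "Suc n" "Suc N"] assms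
      by (intro sum.mono_neutral_right) (auto simp: block_def dimK_def)
    also have "\<dots> = (\<Sum>k<Suc n. block n A i (off n + k) * block n B (off n + k) j)"
      by (rule sum.reindex_bij_witness[of _ "\<lambda>k. off n + k" "\<lambda>k. k - off n"]) (auto simp: off_Suc)
    also have "\<dots> = (if P then (\<Sum>k<Suc n. A (i - off n) k * B k (j - off n)) else 0)"
      by (auto simp: block_def P_def off_Suc intro!: sum.neutral sum.cong)
    also have "\<dots> = block n (mmul (Suc n) A B) i j"
      unfolding block_def mmul_def P_def by simp
    finally show ?thesis using True by (simp add: mmul_def)
  qed
qed

lemma Xop_mmul: "mmul (dimK N) (Xop N k) (Xop N l) = (\<Sum>n\<le>N. block n (mmul (Suc n) (rho n k) (rho n l)))"
  by (simp add: Xop_blocks mmul_sum_left mmul_sum_right block_mmul if_distrib cong: if_cong)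

lemma Xop_commutation:
  assumes "m \<in> {1, 2, 3}"
  shows "mmul (dimK N) (Xop N (nxt m)) (Xop N (nxt (nxt m)))
    - mmul (dimK N) (Xop N (nxt (nxt m))) (Xop N (nxt m)) = Xop N m"
proof -
  have "block n (mmul (Suc n) (rho n (nxt m)) (rho n (nxt (nxt m))))
    - block n (mmul (Suc n) (rho n (nxt (nxt m))) (rho n (nxt m))) = block n (rho n m)" for n
    unfolding rho_commutation[OF assms, symmetric] by (simp add: block_def fun_eq_iff)
  then show ?thesis
    by (simp add: Xop_mmul sum_subtractf[symmetric]) (simp add: Xop_blocks)
qed

lemma Xop_mats: "Xop N k \<in> mats (dimK N)"
  unfolding Xop_blocks
proof (rule mats_sum)
  fix n assume "n \<in> {..N}"
  then show "block n (rho n k) \<in> mats (dimK N)"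
    using mono_off[of "Suc n" "Suc N"] by (auto simp: mats_def block_def dimK_def)
qed

lemma Xop_entry:
  assumes "m \<le> N" "off m \<le> i" "i < off (Suc m)"
  shows "Xop N k i j = block m (rho m k) i j"
proof -
  have "block n (rho n k) i j = 0" if "n \<noteq> m" for n
    using block_disjoint[of n i m] that assms(2,3) by (auto simp: block_def)
  then have "(\<Sum>n\<le>N. block n (rho n k) i j) = (\<Sum>n\<in>{m}. block n (rho n k) i j)"
    using assms(1) by (intro sum.mono_neutral_right) auto
  then show ?thesis by (simp add: Xop_blocks sum_fun2_apply)
qed

text \<open>Index 0 carries the trivial representation. This is what makes the commutator of
  \<open>Xop N k\<close> with a matrix unit in column 0 one-sided.\<close>

lemma Xop_row0: "Xop N k 0 j = 0"
  by (subst Xop_entry[of 0]) (auto simp: off_def block_def rho_def)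

text \<open>Here J_k = - i S_k with S_k half a Pauli matrix, and \<open>sig k\<close> is i times
  that Pauli matrix, whence the factor - 1/2.\<close>

lemma rho_spin_half:
  assumes "r < 2" "c < 2" "k \<in> {1, 2, 3}"
  shows "rho 1 k r c = - (1/2) * sig k r c"
proof -
  have "sqc 1 1 = 1" by (simp add: sqc_def)
  moreover have "r = 0 \<or> r = 1" "c = 0 \<or> c = 1" using assms by auto
  ultimately show ?thesis using assms(3)
    by (auto simp: rho_def sig_def)
qed

lemma Xop_spin_half:
  assumes "1 \<le> N" "s < 2" "k \<in> {1, 2, 3}"
  shows "Xop N k (Suc s) j = (if 1 \<le> j \<and> j \<le> 2 then - (1/2) * sig k s (j - 1) else 0)"
proof -
  have off: "off 1 = 1" "off (1 + 1) = 3" "off (Suc 1) = 3" by (simp_all add: off_def)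
  have X: "Xop N k (Suc s) j = block 1 (rho 1 k) (Suc s) j"
    by (rule Xop_entry) (use assms(1,2) off in linarith)+
  show ?thesis
  proof (cases "1 \<le> j \<and> j \<le> 2")
    case True
    then have "j - 1 < 2" "j < 3" by auto
    then show ?thesis
      using rho_spin_half[OF assms(2) \<open>j - 1 < 2\<close> assms(3)] True assms(2)
      unfolding X block_def off by (simp only: if_True if_False diff_Suc_1) simp
  next
    case False
    then have "\<not> (1 \<le> j \<and> j < 3)" by auto
    then show ?thesis using False unfolding X block_def off by (simp only: if_False) auto
  qed
qed

subsection \<open>One-forms in the frame of Pauli matrices\<close>

text \<open>\<open>div 2\<close> and \<open>mod 2\<close> split an index of H_N into its K_N and
  spin parts. Only the values of \<open>c\<close> at 1, 2, 3 count; hence equalities of coefficient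
  families are tested only there.\<close>

definition form :: "(nat \<Rightarrow> cmat) \<Rightarrow> cmat" where
  "form c = (\<lambda>p q. \<Sum>k\<in>{1,2,3::nat}. c k (p div 2) (q div 2) * sig k (p mod 2) (q mod 2))"

text \<open>The trace pairing reads off coefficients because \<open>tr (sig k sig l) = - 2 \<delta>\<close>.\<close>
definition coef :: "nat \<Rightarrow> cmat \<Rightarrow> cmat" where
  "coef k w = (\<lambda>i j. - (1/2) * (\<Sum>s<2. \<Sum>t<2. w (2 * i + s) (2 * j + t) * sig k t s))"

text \<open>The antisymmetric part of a 3 x 3 array written as a vector, as for a cross
  product.\<close>

definition asym :: "(nat \<Rightarrow> nat \<Rightarrow> cmat) \<Rightarrow> nat \<Rightarrow> cmat" where
  "asym T m = T (nxt m) (nxt (nxt m)) - T (nxt (nxt m)) (nxt m)"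

lemma sum_lessThan_2: "(\<Sum>s<(2::nat). f s) = f 0 + f 1" for f :: "nat \<Rightarrow> 'a::comm_monoid_add"
  by (simp add: numeral_2_eq_2)

lemma Dop_form: "Dop N = form (Xop N)"
  by (simp add: Dop_def form_def)

lemma form_cong: "(\<And>k. k \<in> {1,2,3} \<Longrightarrow> c k = e k) \<Longrightarrow> form c = form e"
  unfolding form_def by (intro ext sum.cong) auto

lemma form_add: "form (\<lambda>k. c k + e k) = form c + form e"
  unfolding form_def by (auto simp: fun_eq_iff algebra_simps)

lemma form_diff: "form (\<lambda>k. c k - e k) = form c - form e"
  unfolding form_def by (auto simp: fun_eq_iff algebra_simps)

lemma form_minus: "form (\<lambda>k. - c k) = - form c"
  unfolding form_def by (auto simp: fun_eq_iff algebra_simps)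

lemma form_smul: "form (\<lambda>k. smul z (c k)) = smul z (form c)"
  unfolding form_def smul_def by (auto simp: fun_eq_iff algebra_simps)

lemma form_zero: "form (\<lambda>k. 0) = 0"
  unfolding form_def by (auto simp: fun_eq_iff)

lemma form_eq_zero: "(\<And>k. k \<in> {1,2,3} \<Longrightarrow> c k = 0) \<Longrightarrow> form c = 0"
  using form_cong[of c "\<lambda>k. 0"] form_zero by simp

lemma form_sum: "form (\<lambda>k. \<Sum>x\<in>S. c x k) = (\<Sum>x\<in>S. form (c x))"
  unfolding form_def fun_eq_iff sum_fun2_apply
  by (simp add: sum.distrib sum_distrib_right)

lemma iota_add: "iota (a + b) = iota a + iota b"
  by (auto simp: iota_def fun_eq_iff)

lemma iota_diff: "iota (a - b) = iota a - iota b"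
  by (auto simp: iota_def fun_eq_iff)

lemma iota_minus: "iota (- a) = - iota a"
  by (auto simp: iota_def fun_eq_iff)

lemma iota_smul: "iota (smul c a) = smul c (iota a)"
  by (auto simp: iota_def smul_def fun_eq_iff)

lemma iota_zero: "iota 0 = 0"
  by (auto simp: iota_def fun_eq_iff)

lemma coef_add: "coef k (v + w) = coef k v + coef k w"
  unfolding coef_def by (auto simp: fun_eq_iff algebra_simps sum.distrib)

lemma coef_minus: "coef k (- v) = - coef k v"
  unfolding coef_def by (auto simp: fun_eq_iff sum_negf)

lemma coef_diff: "coef k (v - w) = coef k v - coef k w"
  using coef_add[of k v "- w"] by (simp add: coef_minus)

lemma coef_zero: "coef k 0 = 0"
  unfolding coef_def by (auto simp: fun_eq_iff)

lemma coef_smul: "coef k (smul c v) = smul c (coef k v)"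
  unfolding coef_def smul_def by (auto simp: fun_eq_iff algebra_simps sum_distrib_left)

lemma coef_form: "k \<in> {1,2,3} \<Longrightarrow> coef k (form c) = c k"
  by (auto simp: coef_def form_def sum_lessThan_2 sig_def fun_eq_iff algebra_simps)

text \<open>Pauli matrices are traceless. Since \<open>J2 N\<close> turns out to consist of the
  operators \<open>iota a\<close>, the maps \<open>coef\<close> are well defined on two-forms modulo
  \<open>J2 N\<close>.\<close>

lemma coef_iota: "k \<in> {1,2,3} \<Longrightarrow> coef k (iota a) = 0"
  by (auto simp: coef_def iota_def sum_lessThan_2 sig_def fun_eq_iff)

lemma form_eq_iff: "form c = form e \<longleftrightarrow> (\<forall>k\<in>{1,2,3}. c k = e k)"
  using coef_form[of _ c] coef_form[of _ e] form_cong[of c e] by metis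

lemma sum_double: "(\<Sum>k<2 * d. f k) = (\<Sum>i<d. \<Sum>u<2. f (2 * i + u))"
  for f :: "nat \<Rightarrow> 'a::comm_monoid_add"
  by (induction d) (auto simp: sum_lessThan_2 add.assoc)

lemma mmul_double:
  "mmul (2 * d) v w p q = (\<Sum>i<d. \<Sum>u<2. v p (2 * i + u) * w (2 * i + u) q)"
  by (simp add: mmul_def sum_double)

lemma iota_mmul_iota: "mmul (2 * d) (iota a) (iota b) = iota (mmul d a b)"
proof (intro ext)
  fix p q :: nat
  have "p mod 2 = 0 \<or> p mod 2 = 1" "q mod 2 = 0 \<or> q mod 2 = 1" by auto
  then show "mmul (2 * d) (iota a) (iota b) p q = iota (mmul d a b) p q"
    unfolding mmul_double by (auto simp: iota_def sum_lessThan_2 mmul_def)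
qed

lemma iota_mmul_form: "mmul (2 * d) (iota a) (form c) = form (\<lambda>k. mmul d a (c k))"
proof (intro ext)
  fix p q :: nat
  have "(\<Sum>u<2. iota a p (2 * i + u) * form c (2 * i + u) q)
      = (\<Sum>k\<in>{1,2,3}. a (p div 2) i * c k i (q div 2) * sig k (p mod 2) (q mod 2))" for i
    using mod2_eq_if[of p] by (auto simp: iota_def form_def sum_lessThan_2 algebra_simps)
  then show "mmul (2 * d) (iota a) (form c) p q = form (\<lambda>k. mmul d a (c k)) p q"
    unfolding mmul_double by (simp add: form_def mmul_def sum.distrib sum_distrib_right)
qed

lemma form_mmul_iota: "mmul (2 * d) (form c) (iota a) = form (\<lambda>k. mmul d (c k) a)"
proof (intro ext)
  fix p q :: nat
  have "(\<Sum>u<2. form c p (2 * i + u) * iota a (2 * i + u) q)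
      = (\<Sum>k\<in>{1,2,3}. c k (p div 2) i * a i (q div 2) * sig k (p mod 2) (q mod 2))" for i
    using mod2_eq_if[of q] by (auto simp: iota_def form_def sum_lessThan_2 algebra_simps)
  then show "mmul (2 * d) (form c) (iota a) p q = form (\<lambda>k. mmul d (c k) a) p q"
    unfolding mmul_double by (simp add: form_def mmul_def sum.distrib sum_distrib_right)
qed

text \<open>From sigma_k sigma_l = - delta_kl - eps_klm sigma_m: minus the dot product and minus the
  cross product of the two vectors.\<close>

lemma sig_products:
  fixes c e :: "nat \<Rightarrow> complex"
  assumes "s < 2" "t < 2"
  shows "(\<Sum>u<2. (\<Sum>k\<in>{1,2,3}. c k * sig k s u) * (\<Sum>l\<in>{1,2,3}. e l * sig l u t))
    = (if s = t then - (\<Sum>k\<in>{1,2,3}. c k * e k) else 0)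
      - (\<Sum>m\<in>{1,2,3}. (c (nxt m) * e (nxt (nxt m)) - c (nxt (nxt m)) * e (nxt m)) * sig m s t)"
proof -
  have "s = 0 \<or> s = 1" "t = 0 \<or> t = 1" using assms by auto
  then show ?thesis
    by (elim disjE) (simp_all add: sum_lessThan_2 sig_def algebra_simps)
qed

lemma form_mmul_form: "mmul (2 * d) (form c) (form e)
  = iota (- (\<Sum>k\<in>{1,2,3}. mmul d (c k) (e k))) - form (asym (\<lambda>k l. mmul d (c k) (e l)))"
proof (intro ext)
  fix p q :: nat
  define P Q s t where PQ: "P = p div 2" "Q = q div 2" "s = p mod 2" "t = q mod 2"
  have st: "s < 2" "t < 2" by (auto simp: PQ)
  have "mmul (2 * d) (form c) (form e) p q
     = (\<Sum>i<d. \<Sum>u<2. (\<Sum>k\<in>{1,2,3}. c k P i * sig k s u) * (\<Sum>l\<in>{1,2,3}. e l i Q * sig l u t))"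
    unfolding mmul_double by (intro sum.cong refl) (simp add: form_def PQ)
  also have "\<dots> = (\<Sum>i<d. (if s = t then - (\<Sum>k\<in>{1,2,3}. c k P i * e k i Q) else 0)
      - (\<Sum>m\<in>{1,2,3}. (c (nxt m) P i * e (nxt (nxt m)) i Q - c (nxt (nxt m)) P i * e (nxt m) i Q) * sig m s t))"
    by (intro sum.cong refl sig_products st)
  also have "\<dots> = (if s = t then - (\<Sum>k\<in>{1,2,3}. mmul d (c k) (e k) P Q) else 0)
      - (\<Sum>m\<in>{1,2,3}. asym (\<lambda>k l. mmul d (c k) (e l)) m P Q * sig m s t)"
    by (simp add: sum_subtractf sum.distrib sum_distrib_right[symmetric] sum_negf mmul_def asym_def)
  also have "\<dots> = (iota (- (\<Sum>k\<in>{1,2,3}. mmul d (c k) (e k))) - form (asym (\<lambda>k l. mmul d (c k) (e l)))) p q"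
    by (simp add: iota_def form_def PQ sum_fun2_apply)
  finally show "mmul (2 * d) (form c) (form e) p q
     = (iota (- (\<Sum>k\<in>{1,2,3}. mmul d (c k) (e k))) - form (asym (\<lambda>k l. mmul d (c k) (e l)))) p q" .
qed

section \<open>The differential through inner derivations\<close>

definition der :: "nat \<Rightarrow> nat \<Rightarrow> cmat \<Rightarrow> cmat" where
  "der N k = commu (dimK N) (Xop N k)"

lemma dA_form: "dA N b = form (\<lambda>k. der N k b)"
  by (simp add: dA_def commu_def Dop_form dimH_def iota_mmul_form form_mmul_iota form_diff der_def)

lemma der_AN: "a \<in> AN N \<Longrightarrow> der N k a \<in> AN N"
  by (simp add: der_def AN_def mats_commu Xop_mats)

lemma der_add: "der N k (a + b) = der N k a + der N k b"
  by (simp add: der_def commu_add)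

lemma der_mmul: "der N k (mmul (dimK N) a b) = mmul (dimK N) (der N k a) b + mmul (dimK N) a (der N k b)"
  by (simp add: der_def commu_mmul)

lemma der_minus: "der N k (- b) = - der N k b"
  by (simp add: der_def commu_minus)

lemma der_smul: "der N k (smul c b) = smul c (der N k b)"
  by (simp add: der_def commu_smul)

lemma der_zero [simp]: "der N k 0 = 0"
  by (simp add: der_def)

lemma der_idm: "der N k (idm (dimK N)) = 0"
  by (simp add: der_def commu_def idm_mmul mmul_idm Xop_mats)

text \<open>The Jacobi identity carries [X_k, X_l] = X_m over to the inner derivations: second
  derivatives commute only up to a first derivative.\<close>

lemma der_der:
  "m \<in> {1,2,3} \<Longrightarrow> der N (nxt m) (der N (nxt (nxt m)) a) - der N (nxt (nxt m)) (der N (nxt m) a) = der N m a"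
  by (simp only: der_def commu_jacobi Xop_commutation)

text \<open>A one-form has many presentations by lists of pairs. Naming the sums of a [D, b] and of
  [D, a] [D, b] over one list allows the two to be compared for the same presentation.\<close>

definition one_form :: "nat \<Rightarrow> (cmat \<times> cmat) list \<Rightarrow> cmat" where
  "one_form N ps = sum_list (map (\<lambda>(a, b). mmul (dimH N) (iota a) (dA N b)) ps)"

definition two_form :: "nat \<Rightarrow> (cmat \<times> cmat) list \<Rightarrow> cmat" where
  "two_form N ps = sum_list (map (\<lambda>(a, b). mmul (dimH N) (dA N a) (dA N b)) ps)"

lemma one_form_simps [simp]:
  "one_form N [] = 0"
  "one_form N ((a, b) # ps) = form (\<lambda>k. mmul (dimK N) a (der N k b)) + one_form N ps"
  by (simp_all add: one_form_def dA_form dimH_def iota_mmul_form)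

lemma two_form_simps [simp]:
  "two_form N [] = 0"
  "two_form N ((a, b) # ps) = iota (- (\<Sum>k\<in>{1,2,3}. mmul (dimK N) (der N k a) (der N k b)))
     - form (asym (\<lambda>k l. mmul (dimK N) (der N k a) (der N l b))) + two_form N ps"
  by (simp_all add: two_form_def dA_form dimH_def form_mmul_form)

lemma one_form_append: "one_form N (ps @ qs) = one_form N ps + one_form N qs"
  by (simp add: one_form_def)

lemma two_form_append: "two_form N (ps @ qs) = two_form N ps + two_form N qs"
  by (simp add: two_form_def)

section \<open>The one-forms as a free module of rank three\<close>

lemma Omega1_altdef: "Omega1 N = {one_form N ps | ps. set ps \<subseteq> AN N \<times> AN N}"
  by (simp add: Omega1_def one_form_def)

lemma J2_altdef: "J2 N = {two_form N ps | ps. set ps \<subseteq> AN N \<times> AN N \<and> one_form N ps = 0}"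
  by (simp add: J2_def one_form_def two_form_def)

lemma AN_intros:
  "a \<in> AN N \<Longrightarrow> b \<in> AN N \<Longrightarrow> a + b \<in> AN N"
  "a \<in> AN N \<Longrightarrow> b \<in> AN N \<Longrightarrow> a - b \<in> AN N"
  "a \<in> AN N \<Longrightarrow> - a \<in> AN N"
  "0 \<in> AN N"
  "a \<in> AN N \<Longrightarrow> smul c a \<in> AN N"
  "a \<in> AN N \<Longrightarrow> b \<in> AN N \<Longrightarrow> mmul (dimK N) a b \<in> AN N"
  "idm (dimK N) \<in> AN N"
  "i < dimK N \<Longrightarrow> j < dimK N \<Longrightarrow> munit i j \<in> AN N"
  "(\<And>x. x \<in> S \<Longrightarrow> f x \<in> AN N) \<Longrightarrow> (\<Sum>x\<in>S. f x) \<in> AN N"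
  "a \<in> AN N \<Longrightarrow> der N k a \<in> AN N"
  unfolding AN_def by (simp_all add: mats_intros idm_mats munit_mats der_AN[unfolded AN_def] del: zero_fun_apply)

lemma Omega1_formD:
  assumes "w \<in> Omega1 N"
  obtains c where "w = form c" "\<And>k. c k \<in> AN N"
proof -
  have "\<exists>c. one_form N ps = form c \<and> (\<forall>k. c k \<in> AN N)" if "set ps \<subseteq> AN N \<times> AN N" for ps
    using that
  proof (induction ps)
    case Nil
    show ?case using form_zero AN_intros(4) one_form_simps(1) by metis
  next
    case (Cons ab ps)
    obtain a b where ab: "ab = (a, b)" by force
    from Cons obtain c where c: "one_form N ps = form c" "\<forall>k. c k \<in> AN N" by auto
    have "mmul (dimK N) a (der N k b) + c k \<in> AN N" for k
      using Cons.prems c unfolding ab by (intro AN_intros) auto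
    moreover have "one_form N (ab # ps) = form (\<lambda>k. mmul (dimK N) a (der N k b) + c k)"
      using c unfolding ab form_add by simp
    ultimately show ?case by blast
  qed
  then show ?thesis using assms that unfolding Omega1_altdef by blast
qed

lemma Omega1_add: "v \<in> Omega1 N \<Longrightarrow> w \<in> Omega1 N \<Longrightarrow> v + w \<in> Omega1 N"
  unfolding Omega1_altdef
  by (smt (verit) Un_least mem_Collect_eq one_form_append set_append)

lemma Omega1_zero: "0 \<in> Omega1 N"
  unfolding Omega1_altdef by (rule CollectI, rule exI[of _ "[]"]) simp

lemma Omega1_sum: "(\<And>x. x \<in> S \<Longrightarrow> f x \<in> Omega1 N) \<Longrightarrow> (\<Sum>x\<in>S. f x) \<in> Omega1 N"
  by (induction S rule: infinite_finite_induct)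
    (simp_all add: Omega1_add Omega1_zero del: zero_fun_apply plus_fun_apply)

lemma Omega1_generator:
  "a \<in> AN N \<Longrightarrow> b \<in> AN N \<Longrightarrow> form (\<lambda>k. mmul (dimK N) a (der N k b)) \<in> Omega1 N"
  unfolding Omega1_altdef by (rule CollectI, rule exI[of _ "[(a, b)]"]) simp

text \<open>Leibniz rule: a (db) c = a d(bc) - (ab) dc.\<close>

lemma Omega1_generator_right:
  assumes "a \<in> AN N" "b \<in> AN N" "c \<in> AN N"
  shows "form (\<lambda>k. mmul (dimK N) a (mmul (dimK N) (der N k b) c)) \<in> Omega1 N"
proof -
  have "form (\<lambda>k. mmul (dimK N) a (mmul (dimK N) (der N k b) c))
     = form (\<lambda>k. mmul (dimK N) a (der N k (mmul (dimK N) b c)))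
       + form (\<lambda>k. mmul (dimK N) (- mmul (dimK N) a b) (der N k c))"
    unfolding form_add[symmetric] by (intro form_cong) (simp add: der_mmul mmul_distribs mmul_assoc)
  then show ?thesis
    using assms by (simp add: Omega1_add Omega1_generator AN_intros)
qed

lemma dimK_ge_3: "1 \<le> N \<Longrightarrow> 3 \<le> dimK N"
  using mono_off[of 2 "N + 1"] unfolding dimK_def by (simp add: off_def)

text \<open>\<open>munit q 0\<close> times \<open>Xop N k\<close> contains only row 0 of
  \<open>Xop N k\<close>, which vanishes.\<close>

lemma der_munit_col0:
  assumes "q < dimK N"
  shows "der N k (munit q 0) = mmul (dimK N) (Xop N k) (munit q 0)"
proof -
  have "0 < dimK N" using assms by simp
  then have "mmul (dimK N) (munit q 0) (Xop N k) = 0"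
    by (simp add: munit_mmul Xop_row0 fun_eq_iff)
  then show ?thesis by (simp add: der_def commu_def)
qed

text \<open>Index 0 is the spin 0 summand and indices 1, 2 are the spin 1/2 summand.\<close>

lemma Omega1_frame_unit:
  assumes "1 \<le> N" "a \<in> AN N" "r < dimK N" "m \<in> {1,2,3}"
  shows "form (\<lambda>k. if k = m then mmul (dimK N) a (mmul (dimK N) (munit r 0) (munit 0 r)) else 0) \<in> Omega1 N"
proof -
  let ?d = "dimK N"
  have d: "3 \<le> ?d" using dimK_ge_3 assms(1) by simp
  \<comment> \<open>Each sandwich extracts entry (s, t) of - 1/2 \<open>sig k\<close>. The weights
    \<open>sig m t s\<close> assemble these entries into - 1/2 times the trace of the product of
    \<open>sig m\<close> and \<open>sig k\<close>, which is 1 for k = m and 0 otherwise.\<close>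
  let ?f = "\<lambda>s t k. mmul ?d (smul (sig m t s) (mmul ?d a (munit r (Suc s))))
      (mmul ?d (der N k (munit (Suc t) 0)) (munit 0 r))"
  have mem: "form (?f s t) \<in> Omega1 N" if "s < 2" "t < 2" for s t
    using assms d that by (intro Omega1_generator_right AN_intros) auto
  have f: "?f s t k = smul (- (1/2) * (sig m t s * sig k s t)) (mmul ?d a (mmul ?d (munit r 0) (munit 0 r)))"
    if "s < 2" "t < 2" "k \<in> {1,2,3}" for s t k
  proof -
    have st: "Suc s < ?d" "Suc t < ?d" using that d by auto
    have "?f s t k = smul (sig m t s) (mmul ?d a (mmul ?d (mmul ?d (munit r (Suc s))
         (mmul ?d (Xop N k) (munit (Suc t) 0))) (munit 0 r)))"
      using st by (simp add: der_munit_col0 mmul_distribs mmul_assoc)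
    also have "mmul ?d (munit r (Suc s)) (mmul ?d (Xop N k) (munit (Suc t) 0))
         = smul (Xop N k (Suc s) (Suc t)) (munit r 0)"
      using st by (intro munit_sandwich)
    also have "Xop N k (Suc s) (Suc t) = - (1/2) * sig k s t"
      using that assms(1) by (simp add: Xop_spin_half)
    finally show ?thesis by (simp add: mmul_distribs smul_smul mult_ac)
  qed
  have "form (\<lambda>k. \<Sum>s<2. \<Sum>t<2. ?f s t k) \<in> Omega1 N"
    unfolding form_sum by (intro Omega1_sum mem) auto
  also have "form (\<lambda>k. \<Sum>s<2. \<Sum>t<2. ?f s t k) =
     form (\<lambda>k. smul (\<Sum>s<2. \<Sum>t<2. - (1/2) * (sig m t s * sig k s t))
       (mmul (dimK N) a (mmul (dimK N) (munit r 0) (munit 0 r))))"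
    unfolding smul_sum_coeff by (intro form_cong sum.cong refl f) auto
  also have "\<dots> = form (\<lambda>k. if k = m then mmul (dimK N) a (mmul (dimK N) (munit r 0) (munit 0 r)) else 0)"
    using assms(4) by (intro form_cong) (auto simp: sum_lessThan_2 sig_def)
  finally show ?thesis .
qed

text \<open>Summing the frame units over \<open>r\<close> resolves the identity through index 0.
  Together with \<open>Omega1_formD\<close> this identifies a one-form with three free coefficients
  in A_N.\<close>

lemma Omega1_formI:
  assumes "1 \<le> N" "\<And>k. k \<in> {1,2,3} \<Longrightarrow> c k \<in> AN N"
  shows "form c \<in> Omega1 N"
proof -
  let ?d = "dimK N"
  have "form (\<lambda>k. \<Sum>m\<in>{1,2,3}. \<Sum>r<?d.
      if k = m then mmul ?d (c m) (mmul ?d (munit r 0) (munit 0 r)) else 0) \<in> Omega1 N"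
    unfolding form_sum using assms by (intro Omega1_sum Omega1_frame_unit) auto
  also have "form (\<lambda>k. \<Sum>m\<in>{1,2,3}. \<Sum>r<?d.
      if k = m then mmul ?d (c m) (mmul ?d (munit r 0) (munit 0 r)) else 0) = form c"
  proof (rule form_cong)
    fix k :: nat assume k: "k \<in> {1,2,3}"
    then have "(\<Sum>r<?d. mmul ?d (c k) (mmul ?d (munit r 0) (munit 0 r))) = c k"
      using assms dimK_ge_3[of N] by (intro munit_resolution) (auto simp: AN_def)
    then show "(\<Sum>m\<in>{1,2,3}. \<Sum>r<?d. if k = m then mmul ?d (c m) (mmul ?d (munit r 0) (munit 0 r)) else 0) = c k"
      using k by auto
  qed
  finally show ?thesis .
qed

lemma coef_AN: "w \<in> Omega1 N \<Longrightarrow> k \<in> {1,2,3} \<Longrightarrow> coef k w \<in> AN N"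
  by (metis Omega1_formD coef_form)

lemma form_coef: "w \<in> Omega1 N \<Longrightarrow> form (\<lambda>k. coef k w) = w"
  by (metis Omega1_formD coef_form form_cong)

subsection \<open>Two-forms\<close>

text \<open>Operator multiplication in coordinates: the image of the tensor with coefficient T_kl at
  sigma_k \<otimes> sigma_l. The trace goes to \<open>iota\<close>, the antisymmetric part to the
  Pauli directions, and the traceless symmetric part is lost.\<close>

definition mult2 :: "(nat \<Rightarrow> nat \<Rightarrow> cmat) \<Rightarrow> cmat" where
  "mult2 T = iota (- (\<Sum>k\<in>{1,2,3}. T k k)) - form (asym T)"

lemma nxt_in: "m \<in> {1,2,3} \<Longrightarrow> nxt m \<in> {1,2,3}"
  by (auto simp: nxt_def)

lemma mult2_cong:
  assumes "\<And>k l. k \<in> {1,2,3} \<Longrightarrow> l \<in> {1,2,3} \<Longrightarrow> T k l = U k l"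
  shows "mult2 T = mult2 U"
proof -
  have "form (asym T) = form (asym U)"
    by (rule form_cong) (simp only: asym_def assms nxt_in)
  then show ?thesis by (simp add: mult2_def assms)
qed

lemma mult2_add: "mult2 (\<lambda>k l. T k l + U k l) = mult2 T + mult2 U"
proof -
  have "form (asym (\<lambda>k l. T k l + U k l)) = form (asym T) + form (asym U)"
    unfolding form_add[symmetric] by (rule form_cong) (simp add: asym_def)
  then show ?thesis by (simp add: mult2_def iota_add iota_minus sum.distrib iota_diff)
qed

lemma mult2_smul: "mult2 (\<lambda>k l. smul c (T k l)) = smul c (mult2 T)"
proof -
  have "form (asym (\<lambda>k l. smul c (T k l))) = smul c (form (asym T))"
    unfolding form_smul[symmetric] by (rule form_cong) (simp add: asym_def smul_diff)
  then show ?thesis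
    by (simp add: mult2_def iota_minus smul_sum[symmetric] iota_smul smul_diff iota_diff iota_add smul_add)
      (simp add: smul_def fun_eq_iff)
qed

lemma mult2_zero: "mult2 (\<lambda>k l. 0) = 0"
  using mult2_smul[of 0 "\<lambda>k l. 0"] by simp

lemma mult2_sum: "mult2 (\<lambda>k l. \<Sum>x\<in>S. T x k l) = (\<Sum>x\<in>S. mult2 (T x))"
proof (induction S rule: infinite_finite_induct)
  case (insert x F)
  then show ?case by (simp only: sum.insert mult2_add simp_thms)
qed (simp_all only: sum.infinite sum.empty mult2_zero simp_thms)

lemma coef_mult2: "m \<in> {1,2,3} \<Longrightarrow> coef m (mult2 T) = - asym T m"
  by (simp add: mult2_def coef_diff coef_form coef_iota)

lemma form_mmul_form_mult2:
  "mmul (2 * d) (form c) (form e) = mult2 (\<lambda>k l. mmul d (c k) (e l))"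
  by (simp add: form_mmul_form mult2_def)

lemma two_form_Cons:
  "two_form N ((a, b) # ps) = mult2 (\<lambda>k l. mmul (dimK N) (der N k a) (der N l b)) + two_form N ps"
  by (simp add: mult2_def)

text \<open>The exterior derivative of a one-form on SU(2) in an invariant frame, with
  \<open>der\<close> as the derivatives. The term without derivative is the Maurer-Cartan
  contribution of the structure constants.\<close>

definition dform :: "nat \<Rightarrow> cmat \<Rightarrow> nat \<Rightarrow> cmat" where
  "dform N w m = der N (nxt m) (coef (nxt (nxt m)) w) - der N (nxt (nxt m)) (coef (nxt m) w) - coef m w"

lemma dform_add: "dform N (v + w) m = dform N v m + dform N w m"
  by (simp add: dform_def coef_add der_add)

text \<open>The exterior derivative only depends on the one-form, because the second derivatives of \<open>b\<close>
  enter through a commutator, which is again a first derivative.\<close>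

lemma asym_der_der:
  assumes "m \<in> {1,2,3}"
  shows "asym (\<lambda>k l. mmul (dimK N) (der N k a) (der N l b)) m
    = dform N (form (\<lambda>k. mmul (dimK N) a (der N k b))) m"
proof -
  have "dform N (form (\<lambda>k. mmul (dimK N) a (der N k b))) m
     = asym (\<lambda>k l. mmul (dimK N) (der N k a) (der N l b)) m
       + mmul (dimK N) a (der N (nxt m) (der N (nxt (nxt m)) b) - der N (nxt (nxt m)) (der N (nxt m) b) - der N m b)"
    using assms by (simp only: dform_def coef_form nxt_in asym_def der_mmul mmul_distribs) (simp add: algebra_simps)
  then show ?thesis by (simp only: der_der[OF assms]) simp
qed

text \<open>The scalar part \<open>a\<close> stays unspecified because it depends on the
  presentation \<open>ps\<close>, whereas the Pauli part depends only on the one-form. This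
  ambiguity is what \<open>J2 N\<close> divides out.\<close>

lemma two_form_structure:
  assumes "set ps \<subseteq> AN N \<times> AN N"
  shows "\<exists>a \<in> AN N. two_form N ps = iota a - form (dform N (one_form N ps))"
  using assms
proof (induction ps)
  case Nil
  have "form (dform N 0) = 0"
    by (rule form_eq_zero) (simp only: dform_def coef_zero der_zero diff_self)
  then show ?case using AN_intros(4)[of N] iota_zero by (metis diff_zero one_form_simps(1) two_form_simps(1))
next
  case (Cons ab ps)
  obtain a b where ab: "ab = (a, b)" "a \<in> AN N" "b \<in> AN N" using Cons.prems by force
  have "set ps \<subseteq> AN N \<times> AN N" using Cons.prems by simp
  then obtain z where z: "z \<in> AN N" "two_form N ps = iota z - form (dform N (one_form N ps))"
    using Cons.IH by blast
  let ?z = "- (\<Sum>k\<in>{1,2,3}. mmul (dimK N) (der N k a) (der N k b))"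
  have "form (dform N (one_form N (ab # ps))) =
      form (asym (\<lambda>k l. mmul (dimK N) (der N k a) (der N l b))) + form (dform N (one_form N ps))"
    unfolding form_add[symmetric] ab(1) by (rule form_cong) (simp only: one_form_simps dform_add asym_der_der)
  then have "two_form N (ab # ps) = iota (?z + z) - form (dform N (one_form N (ab # ps)))"
    using z unfolding ab(1) two_form_simps iota_add by simp
  moreover have "?z + z \<in> AN N"
    using z ab by (intro AN_intros)
  ultimately show ?case by blast
qed

section \<open>The subspace \<open>J2 N\<close> and representatives of two-forms\<close>

lemma J2_add: "v \<in> J2 N \<Longrightarrow> w \<in> J2 N \<Longrightarrow> v + w \<in> J2 N"
  unfolding J2_altdef
proof clarify
  fix ps qs assume "set ps \<subseteq> AN N \<times> AN N" "one_form N ps = 0" "set qs \<subseteq> AN N \<times> AN N" "one_form N qs = 0"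
  then show "\<exists>rs. two_form N ps + two_form N qs = two_form N rs \<and> set rs \<subseteq> AN N \<times> AN N \<and> one_form N rs = 0"
    by (intro exI[of _ "ps @ qs"]) (simp add: one_form_append two_form_append)
qed

lemma J2_zero: "0 \<in> J2 N"
  unfolding J2_altdef by (rule CollectI, rule exI[of _ "[]"]) simp

lemma J2_sum: "(\<And>x. x \<in> S \<Longrightarrow> f x \<in> J2 N) \<Longrightarrow> (\<Sum>x\<in>S. f x) \<in> J2 N"
  by (induction S rule: infinite_finite_induct)
    (simp_all add: J2_add J2_zero del: zero_fun_apply plus_fun_apply)

text \<open>The list \<open>ps\<close> presents the sum of \<alpha> (d\<beta>) \<gamma> over the two
  indices of the spin 1/2 summand. As a one-form it is a multiple of the trace of X_k there, which
  is 0. Its two-form is the sum of d\<alpha> d\<beta> \<gamma> - \<alpha> d\<beta> d\<gamma>, where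
  only the terms with the trace of X_k X_l survive; these are proportional to delta_kl and so have
  no Pauli part.\<close>

lemma J2_unit:
  assumes "1 \<le> N" "a \<in> AN N" "r < dimK N"
  shows "iota (mmul (dimK N) a (mmul (dimK N) (munit r 0) (munit 0 r))) \<in> J2 N"
proof -
  let ?d = "dimK N"
  let ?m = "mmul (dimK N)"
  \<comment> \<open>Chosen to cancel the final factor - 3/2, which is minus the sum of 1/2 over the
    three directions.\<close>
  define a' where "a' = smul (-2/3) a"
  define B where "B = ?m a' (?m (munit r 0) (munit 0 r))"
  have d: "3 \<le> ?d" using dimK_ge_3 assms(1) by simp
  define \<alpha> where "\<alpha> q = ?m a' (munit r q)" for q
  define \<gamma> where "\<gamma> = munit 0 r"
  define \<beta> where "\<beta> q = munit q 0" for q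
  \<comment> \<open>Leibniz rule read backwards, for q = 1 and q = 2: \<alpha> (d\<beta>) \<gamma> =
    \<alpha> d(\<beta> \<gamma>) - (\<alpha> \<beta>) d\<gamma>.\<close>
  define ps where "ps = [(\<alpha> 1, ?m (\<beta> 1) \<gamma>), (- ?m (\<alpha> 1) (\<beta> 1), \<gamma>), (\<alpha> 2, ?m (\<beta> 2) \<gamma>), (- ?m (\<alpha> 2) (\<beta> 2), \<gamma>)]"
  have a': "a' \<in> AN N" unfolding a'_def by (intro AN_intros assms)
  have mem: "\<alpha> q \<in> AN N" "\<beta> q \<in> AN N" "\<gamma> \<in> AN N" if "q \<in> {1,2}" for q
    using that d assms(3) a' unfolding \<alpha>_def \<beta>_def \<gamma>_def by (auto intro!: AN_intros)
  have ps: "set ps \<subseteq> AN N \<times> AN N"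
    unfolding ps_def using mem by (auto intro!: AN_intros)
  have sandwich: "?m (\<alpha> q) (?m A (\<beta> q)) = smul (A q q) (?m a' (munit r 0))" if "q \<in> {1,2}" for q A
    using that d by (auto simp: \<alpha>_def \<beta>_def mmul_assoc munit_sandwich mmul_distribs)
  have der\<beta>: "der N k (\<beta> q) = ?m (Xop N k) (\<beta> q)" if "q \<in> {1,2}" for q k
    using that d unfolding \<beta>_def by (intro der_munit_col0) auto
  have tr: "Xop N k 1 1 + Xop N k 2 2 = 0" if "k \<in> {1,2,3}" for k
    using Xop_spin_half[of N 0 k 1] Xop_spin_half[of N 1 k 2] that assms(1) by (auto simp: sig_def numeral_2_eq_2)
  have tr1: "?m (\<alpha> 1) (?m (Xop N k) (\<beta> 1)) + ?m (\<alpha> 2) (?m (Xop N k) (\<beta> 2)) = 0" if "k \<in> {1,2,3}" for k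
    using tr[OF that] sandwich[of 1 "Xop N k"] sandwich[of 2 "Xop N k"]
    by (simp add: smul_add_coeff[symmetric])
  have XX: "?m (Xop N k) (Xop N l) (Suc s) j = - (1/2) * (\<Sum>u<2. sig k s u * Xop N l (Suc u) j)"
    if "s < 2" "k \<in> {1,2,3}" for k l s j
  proof -
    have "?m (Xop N k) (Xop N l) (Suc s) j = (\<Sum>i<?d. if i \<in> {1,2} then - (1/2) * (sig k s (i - 1) * Xop N l i j) else 0)"
      unfolding mmul_def using that assms(1) by (intro sum.cong) (auto simp: Xop_spin_half)
    also have "\<dots> = (\<Sum>i\<in>{1,2}. - (1/2) * (sig k s (i - 1) * Xop N l i j))"
      using d by (intro sum.mono_neutral_cong_right) auto
    finally show ?thesis by (simp add: sum_lessThan_2 algebra_simps numeral_2_eq_2)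
  qed
  \<comment> \<open>On the spin 1/2 summand X_k X_l is 1/4 of the product of \<open>sig k\<close>
    and \<open>sig l\<close>, whose trace is - 2 delta_kl.\<close>
  have tr2: "?m (Xop N k) (Xop N l) 1 1 + ?m (Xop N k) (Xop N l) 2 2 = (if k = l then - (1/2) else 0)"
    if "k \<in> {1,2,3}" "l \<in> {1,2,3}" for k l
  proof -
    have 1: "?m (Xop N k) (Xop N l) (Suc s) (Suc s) = 1/4 * (\<Sum>u<2. sig k s u * sig l u s)" if "s < 2" for s
      using that \<open>k \<in> _\<close> \<open>l \<in> _\<close> assms(1)
      by (simp only: XX sum_lessThan_2) (simp add: Xop_spin_half algebra_simps)
    have "?m (Xop N k) (Xop N l) 1 1 + ?m (Xop N k) (Xop N l) 2 2
       = 1/4 * (\<Sum>u<2. sig k 0 u * sig l u 0) + 1/4 * (\<Sum>u<2. sig k 1 u * sig l u 1)"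
      using 1[of 0] 1[of 1] unfolding numeral_2_eq_2 One_nat_def by (simp only: less_Suc_eq simp_thms)
    then show ?thesis using that by (auto simp: sum_lessThan_2 sig_def)
  qed
  have "one_form N ps = form (\<lambda>k. ?m (?m (\<alpha> 1) (?m (Xop N k) (\<beta> 1)) + ?m (\<alpha> 2) (?m (Xop N k) (\<beta> 2))) \<gamma>)"
    unfolding ps_def one_form_simps add_0_right form_add[symmetric]
    by (rule form_cong) (simp add: der_mmul der\<beta> mmul_distribs mmul_assoc)
  also have "\<dots> = form (\<lambda>k. 0)"
    by (rule form_cong) (simp only: tr1 mmul_zero_left)
  finally have one: "one_form N ps = 0" by (simp only: form_zero)
  \<comment> \<open>All terms of the two-form, regrouped so that the trace identities apply: the
    first and third summands vanish by \<open>tr1\<close>, the middle one is a multiple of delta_kl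
    by \<open>tr2\<close>.\<close>
  define T where "T k l =
        ?m (?m (Xop N k) (?m (\<alpha> 1) (?m (Xop N l) (\<beta> 1)) + ?m (\<alpha> 2) (?m (Xop N l) (\<beta> 2)))) \<gamma>
      - ?m (?m (\<alpha> 1) (?m (?m (Xop N k) (Xop N l)) (\<beta> 1)) + ?m (\<alpha> 2) (?m (?m (Xop N k) (Xop N l)) (\<beta> 2))) \<gamma>
      - ?m (?m (\<alpha> 1) (?m (Xop N k) (\<beta> 1)) + ?m (\<alpha> 2) (?m (Xop N k) (\<beta> 2))) (der N l \<gamma>)" for k l
  have "two_form N ps = mult2 T"
    unfolding ps_def two_form_Cons two_form_simps(1) add_0_right mult2_add[symmetric] T_def
    by (rule mult2_cong) (simp add: der_mmul der_minus der\<beta> mmul_distribs mmul_assoc,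
       simp add: der_def commu_def mmul_distribs mmul_assoc)
  also have "\<dots> = mult2 (\<lambda>k l. if k = l then smul (1/2) B else 0)"
  proof (rule mult2_cong)
    fix k l :: nat assume kl: "k \<in> {1,2,3}" "l \<in> {1,2,3}"
    have "?m (\<alpha> 1) (?m (?m (Xop N k) (Xop N l)) (\<beta> 1)) + ?m (\<alpha> 2) (?m (?m (Xop N k) (Xop N l)) (\<beta> 2))
        = smul (if k = l then - (1/2) else 0) (?m a' (munit r 0))"
      using tr2[OF kl] by (simp only: sandwich insert_iff simp_thms smul_add_coeff[symmetric])
    then have "T k l = - ?m (smul (if k = l then - (1/2) else 0) (?m a' (munit r 0))) \<gamma>"
      unfolding T_def by (simp only: tr1[OF kl(1)] tr1[OF kl(2)] mmul_zero_left mmul_zero_right diff_zero diff_0)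
    also have "\<dots> = (if k = l then smul (1/2) B else 0)"
      by (simp add: mmul_distribs mmul_assoc B_def \<gamma>_def) (simp add: smul_def fun_eq_iff)
    finally show "T k l = (if k = l then smul (1/2) B else 0)" .
  qed
  also have "\<dots> = iota (- smul (3/2) B) - form (\<lambda>k. 0)"
  proof -
    have "form (asym (\<lambda>k l. if k = l then smul (1/2) B else 0)) = form (\<lambda>k. 0)"
      by (rule form_cong) (auto simp: asym_def nxt_def)
    moreover have "(\<Sum>k\<in>{1,2,3::nat}. smul (1/2) B) = smul (3/2) B"
      by (simp del: sum_constant) (simp add: smul_def fun_eq_iff)
    ultimately show ?thesis unfolding mult2_def by simp
  qed
  also have "\<dots> = iota (?m a (?m (munit r 0) (munit 0 r)))"
    unfolding form_zero diff_zero B_def a'_def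
    by (simp add: mmul_distribs smul_smul smul_minus_one[symmetric])
  finally show ?thesis unfolding J2_altdef using one ps by force
qed

text \<open>One inclusion sums \<open>J2_unit\<close> over \<open>r\<close>. For the other, a
  presentation of the zero form leaves only the scalar part in
  \<open>two_form_structure\<close>.\<close>

lemma J2_iff:
  assumes "1 \<le> N"
  shows "J2 N = iota ` AN N"
proof (intro equalityI subsetI)
  fix w assume "w \<in> J2 N"
  then obtain ps where ps: "set ps \<subseteq> AN N \<times> AN N" "one_form N ps = 0" "w = two_form N ps"
    unfolding J2_altdef by blast
  have "form (dform N 0) = 0"
    by (rule form_eq_zero) (simp only: dform_def coef_zero der_zero diff_self)
  then show "w \<in> iota ` AN N"
    using two_form_structure[OF ps(1)] ps by auto
next
  fix w assume "w \<in> iota ` AN N"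
  then obtain a where a: "a \<in> AN N" "w = iota a" by blast
  have "(\<Sum>r<dimK N. iota (mmul (dimK N) a (mmul (dimK N) (munit r 0) (munit 0 r)))) \<in> J2 N"
    using assms a by (intro J2_sum J2_unit) auto
  also have "(\<Sum>r<dimK N. iota (mmul (dimK N) a (mmul (dimK N) (munit r 0) (munit 0 r))))
      = iota (\<Sum>r<dimK N. mmul (dimK N) a (mmul (dimK N) (munit r 0) (munit 0 r)))"
    by (rule sum_comp_morphism[of iota, unfolded o_def]) (simp_all add: iota_zero iota_add)
  also have "\<dots> = w"
    using a dimK_ge_3[OF assms] by (subst munit_resolution) (auto simp: AN_def)
  finally show "w \<in> J2 N" .
qed

text \<open>An ambient space for representatives: it contains \<open>SS N\<close> and all products
  of one-forms, and membership in \<open>J2 N\<close> can be tested in it by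
  \<open>coef\<close>.\<close>

definition two_forms :: "nat \<Rightarrow> cmat set" where
  "two_forms N = {iota a + form c | a c. a \<in> AN N \<and> (\<forall>k. c k \<in> AN N)}"

lemma two_forms_add: "v \<in> two_forms N \<Longrightarrow> w \<in> two_forms N \<Longrightarrow> v + w \<in> two_forms N"
  unfolding two_forms_def
proof clarify
  fix a b and c e :: "nat \<Rightarrow> cmat" assume "a \<in> AN N" "\<forall>k. c k \<in> AN N" "b \<in> AN N" "\<forall>k. e k \<in> AN N"
  then have "a + b \<in> AN N" "\<forall>k. c k + e k \<in> AN N" by (auto simp del: plus_fun_apply intro: AN_intros)
  moreover have "iota a + form c + (iota b + form e) = iota (a + b) + form (\<lambda>k. c k + e k)"
    by (simp add: iota_add form_add)
  ultimately show "\<exists>x y. iota a + form c + (iota b + form e) = iota x + form y \<and> x \<in> AN N \<and> (\<forall>k. y k \<in> AN N)"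
    by blast
qed

lemma two_forms_zero: "0 \<in> two_forms N"
proof -
  have "iota 0 + form (\<lambda>k. 0) = 0" by (simp only: iota_zero form_zero add_0)
  then show ?thesis unfolding two_forms_def using AN_intros(4)[of N] by fastforce
qed

lemma mult2_two_forms:
  assumes "\<And>k l. k \<in> {1,2,3} \<Longrightarrow> l \<in> {1,2,3} \<Longrightarrow> T k l \<in> AN N"
  shows "mult2 T \<in> two_forms N"
proof -
  \<comment> \<open>\<open>two_forms\<close> asks for coefficients in A_N at every index, while
    \<open>T\<close> is controlled only on {1, 2, 3}; \<open>form\<close> ignores the other indices,
    so 0 can fill them.\<close>
  define c where "c k = (if k \<in> {1,2,3} then - asym T k else 0)" for k
  have "mult2 T = iota (- (\<Sum>k\<in>{1,2,3}. T k k)) + form c"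
  proof -
    have "form c = form (\<lambda>k. - asym T k)" by (rule form_cong) (simp add: c_def)
    then show ?thesis by (simp add: mult2_def form_minus)
  qed
  moreover have "- (\<Sum>k\<in>{1,2,3}. T k k) \<in> AN N" using assms by (intro AN_intros)
  moreover have "c k \<in> AN N" for k
    using AN_intros(4) unfolding c_def asym_def by (auto intro!: AN_intros assms nxt_in simp del: insert_iff)
  ultimately show ?thesis unfolding two_forms_def by blast
qed

lemma SS_two_forms: "s \<in> SS N \<Longrightarrow> s \<in> two_forms N"
proof -
  have *: "sum_list (map (\<lambda>(a0, a1, a2). mmul (dimH N) (mmul (dimH N) (iota a0) (dA N a1)) (dA N a2)) ts) \<in> two_forms N"
    if "set ts \<subseteq> AN N \<times> AN N \<times> AN N" for ts
    using that
  proof (induction ts)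
    case Nil
    show ?case using two_forms_zero by (simp only: list.map sum_list.Nil)
  next
    case (Cons t ts)
    obtain a b c where t: "t = (a, b, c)" "a \<in> AN N" "b \<in> AN N" "c \<in> AN N" using Cons.prems by force
    have "mmul (dimH N) (mmul (dimH N) (iota a) (dA N b)) (dA N c) \<in> two_forms N"
      unfolding dimH_def dA_form iota_mmul_form form_mmul_form_mult2
      using t by (intro mult2_two_forms AN_intros)
    then show ?case using Cons unfolding t by (simp del: plus_fun_apply add: two_forms_add)
  qed
  assume "s \<in> SS N"
  then show ?thesis unfolding SS_def using * by blast
qed

text \<open>Thus \<open>coef 1\<close>, \<open>coef 2\<close>, \<open>coef 3\<close> are coordinates
  on two-forms modulo \<open>J2 N\<close>.\<close>

lemma two_forms_J2:
  assumes "1 \<le> N" "w \<in> two_forms N"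
  shows "w \<in> J2 N \<longleftrightarrow> (\<forall>m\<in>{1,2,3}. coef m w = 0)"
proof
  assume "w \<in> J2 N"
  then show "\<forall>m\<in>{1,2,3}. coef m w = 0" using coef_iota unfolding J2_iff[OF assms(1)] by blast
next
  assume 0: "\<forall>m\<in>{1,2,3}. coef m w = 0"
  obtain a c where w: "a \<in> AN N" "w = iota a + form c" using assms(2) unfolding two_forms_def by blast
  have "form c = form (\<lambda>k. 0)"
    using 0 w(2) by (intro form_cong) (metis add_0 coef_add coef_form coef_iota)
  then show "w \<in> J2 N" unfolding J2_iff[OF assms(1)] using w by (simp add: form_zero)
qed

subsection \<open>Balanced tensor products\<close>

text \<open>\<open>tsumM\<close> sums over the support and is 0 when that is infinite, so additivity
  is available only for finitely supported combinations. Kept apart from \<open>free\<close>, which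
  also records where the factors lie.\<close>

definition fin_supp :: "ftens \<Rightarrow> bool" where
  "fin_supp f \<longleftrightarrow> finite {p. f p \<noteq> 0}"

lemma fin_supp_add: "fin_supp f \<Longrightarrow> fin_supp g \<Longrightarrow> fin_supp (f + g)"
  unfolding fin_supp_def by (rule finite_subset[of _ "{p. f p \<noteq> 0} \<union> {p. g p \<noteq> 0}"]) auto

lemma fin_supp_diff: "fin_supp f \<Longrightarrow> fin_supp g \<Longrightarrow> fin_supp (f - g)"
  unfolding fin_supp_def by (rule finite_subset[of _ "{p. f p \<noteq> 0} \<union> {p. g p \<noteq> 0}"]) auto

lemma fin_supp_fsc: "fin_supp f \<Longrightarrow> fin_supp (fsc c f)"
  unfolding fin_supp_def fsc_def by (rule finite_subset[of _ "{p. f p \<noteq> 0}"]) auto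

lemma fin_supp_tg: "fin_supp (tg x y)"
  unfolding fin_supp_def tg_def by (rule finite_subset[of _ "{(x, y)}"]) auto

lemma fin_supp_zero: "fin_supp 0"
  unfolding fin_supp_def by simp

lemma fin_supp_sum: "(\<And>x. x \<in> S \<Longrightarrow> fin_supp (f x)) \<Longrightarrow> fin_supp (\<Sum>x\<in>S. f x)"
  by (induction S rule: infinite_finite_induct)
    (simp_all add: fin_supp_zero fin_supp_add del: zero_fun_apply plus_fun_apply)

lemma free_fin_supp: "t \<in> free M1 M2 \<Longrightarrow> fin_supp t"
  by (simp add: free_def fin_supp_def)

lemma free_support: "t \<in> free M1 M2 \<Longrightarrow> t p \<noteq> 0 \<Longrightarrow> fst p \<in> M1 \<and> snd p \<in> M2"
  unfolding free_def by auto

lemma freeI: "fin_supp t \<Longrightarrow> (\<And>x y. t (x, y) \<noteq> 0 \<Longrightarrow> x \<in> M1 \<and> y \<in> M2) \<Longrightarrow> t \<in> free M1 M2"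
  unfolding free_def fin_supp_def by auto

lemma free_tg: "x \<in> M1 \<Longrightarrow> y \<in> M2 \<Longrightarrow> tg x y \<in> free M1 M2"
  by (rule freeI[OF fin_supp_tg]) (auto simp: tg_def split: if_splits)

lemma free_add: "t \<in> free M1 M2 \<Longrightarrow> u \<in> free M1 M2 \<Longrightarrow> t + u \<in> free M1 M2"
proof (rule freeI)
  fix x y assume tu: "t \<in> free M1 M2" "u \<in> free M1 M2" and "(t + u) (x, y) \<noteq> 0"
  then have "t (x, y) \<noteq> 0 \<or> u (x, y) \<noteq> 0" by auto
  then show "x \<in> M1 \<and> y \<in> M2"
    using free_support[OF tu(1), of "(x, y)"] free_support[OF tu(2), of "(x, y)"] by auto
qed (intro fin_supp_add free_fin_supp)

lemma free_diff: "t \<in> free M1 M2 \<Longrightarrow> u \<in> free M1 M2 \<Longrightarrow> t - u \<in> free M1 M2"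
proof (rule freeI)
  fix x y assume tu: "t \<in> free M1 M2" "u \<in> free M1 M2" and "(t - u) (x, y) \<noteq> 0"
  then have "t (x, y) \<noteq> 0 \<or> u (x, y) \<noteq> 0" by auto
  then show "x \<in> M1 \<and> y \<in> M2"
    using free_support[OF tu(1), of "(x, y)"] free_support[OF tu(2), of "(x, y)"] by auto
qed (intro fin_supp_diff free_fin_supp)

lemma free_fsc: "t \<in> free M1 M2 \<Longrightarrow> fsc c t \<in> free M1 M2"
  by (rule freeI, intro fin_supp_fsc free_fin_supp, assumption)
    (auto simp: fsc_def dest: free_support[of _ _ _ "(_, _)"])

lemma free_zero: "0 \<in> free M1 M2"
  by (rule freeI[OF fin_supp_zero]) auto

lemma free_sum: "(\<And>x. x \<in> S \<Longrightarrow> f x \<in> free M1 M2) \<Longrightarrow> (\<Sum>x\<in>S. f x) \<in> free M1 M2"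
  by (induction S rule: infinite_finite_induct)
    (simp_all add: free_zero free_add del: zero_fun_apply plus_fun_apply)

lemma tsumM_superset:
  assumes "finite B" "{p. f p \<noteq> 0} \<subseteq> B"
  shows "tsumM f h = (\<Sum>p\<in>B. smul (f p) (h (fst p) (snd p)))"
  unfolding tsumM_def using assms by (intro sum.mono_neutral_left) auto

lemma tsumM_add:
  assumes "fin_supp f" "fin_supp g"
  shows "tsumM (f + g) h = tsumM f h + tsumM g h"
proof -
  let ?B = "{p. f p \<noteq> 0} \<union> {p. g p \<noteq> 0}"
  have B: "finite ?B" using assms by (simp add: fin_supp_def)
  have "tsumM (f + g) h = (\<Sum>p\<in>?B. smul ((f + g) p) (h (fst p) (snd p)))"
    using B by (rule tsumM_superset) auto
  moreover have "tsumM f h = (\<Sum>p\<in>?B. smul (f p) (h (fst p) (snd p)))"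
    using B by (rule tsumM_superset) auto
  moreover have "tsumM g h = (\<Sum>p\<in>?B. smul (g p) (h (fst p) (snd p)))"
    using B by (rule tsumM_superset) auto
  ultimately show ?thesis by (simp only: plus_fun_apply smul_add_coeff sum.distrib)
qed

lemma tsumM_fsc: "tsumM (fsc c f) h = smul c (tsumM f h)"
proof (cases "c = 0")
  case True
  then show ?thesis by (simp add: tsumM_def fsc_def)
next
  case False
  then show ?thesis by (simp add: tsumM_def fsc_def smul_sum smul_smul)
qed

lemma tsumM_diff:
  assumes "fin_supp f" "fin_supp g"
  shows "tsumM (f - g) h = tsumM f h - tsumM g h"
proof -
  have "f - g = f + fsc (-1) g" by (simp add: fsc_def fun_eq_iff)
  then show ?thesis
    using assms by (simp only: tsumM_add fin_supp_fsc tsumM_fsc smul_minus_one) simp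
qed

lemma tsumM_tg: "tsumM (tg x y) h = h x y"
proof -
  have "tsumM (tg x y) h = (\<Sum>p\<in>{(x, y)}. smul (tg x y p) (h (fst p) (snd p)))"
    by (rule tsumM_superset) (auto simp: tg_def)
  then show ?thesis by (simp add: tg_def)
qed

lemma tsumM_zero: "tsumM 0 h = 0"
  by (simp add: tsumM_def)

lemma tsumM_sum: "(\<And>x. x \<in> S \<Longrightarrow> fin_supp (f x)) \<Longrightarrow> tsumM (\<Sum>x\<in>S. f x) h = (\<Sum>x\<in>S. tsumM (f x) h)"
proof (induction S rule: infinite_finite_induct)
  case (insert x F)
  then have "tsumM (f x + sum f F) h = tsumM (f x) h + tsumM (sum f F) h"
    by (intro tsumM_add fin_supp_sum) auto
  then show ?case using insert by (simp del: plus_fun_apply)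
qed (simp_all only: sum.infinite sum.empty tsumM_zero simp_thms)

lemma tsumM_cong:
  "(\<And>x y. f (x, y) \<noteq> 0 \<Longrightarrow> h x y = h' x y) \<Longrightarrow> tsumM f h = tsumM f h'"
  unfolding tsumM_def by (intro sum.cong refl arg_cong[of _ _ "smul _"]) auto

lemma tsumM_linear:
  assumes "L 0 = 0" "\<And>v w. L (v + w) = L v + L w" "\<And>c v. L (smul c v) = smul c (L v)"
  shows "tsumM f (\<lambda>x y. L (h x y)) = L (tsumM f h)"
proof -
  have "(\<Sum>p\<in>{p. f p \<noteq> 0}. L (smul (f p) (h (fst p) (snd p)))) = L (\<Sum>p\<in>{p. f p \<noteq> 0}. smul (f p) (h (fst p) (snd p)))"
    by (rule sum_comp_morphism[of L, unfolded o_def, OF assms(1,2)])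
  then show ?thesis by (simp add: tsumM_def assms(3))
qed

lemma tsumM_mmul: "tsumM f (\<lambda>x y. mmul n A (h x y)) = mmul n A (tsumM f h)"
  by (rule tsumM_linear) (simp_all only: mmul_zero_right mmul_distribs)

lemma tsumM_smul: "tsumM f (\<lambda>x y. smul c (h x y)) = smul c (tsumM f h)"
  by (rule tsumM_linear) (simp_all only: smul_zero smul_add smul_smul mult.commute)

lemma tsumM_sum_right: "tsumM f (\<lambda>x y. \<Sum>i\<in>I. h i x y) = (\<Sum>i\<in>I. tsumM f (h i))"
  unfolding tsumM_def smul_sum by (rule sum.swap)

lemma tsumT_expansion:
  assumes "t \<in> free M1 M2"
  shows "t = (\<Sum>p\<in>{p. t p \<noteq> 0}. fsc (t p) (tg (fst p) (snd p)))"
proof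
  fix q
  have "finite {p. t p \<noteq> 0}" using assms by (simp add: free_def)
  then have "(\<Sum>p\<in>{p. t p \<noteq> 0}. if p = q then t p else 0) = t q" by (simp add: sum.delta)
  moreover have "(\<Sum>p\<in>S. fsc (t p) (tg (fst p) (snd p))) q = (\<Sum>p\<in>S. if p = q then t p else 0)" for S
    by (induction S rule: infinite_finite_induct) (auto simp: fsc_def tg_def)
  ultimately show "t q = (\<Sum>p\<in>{p. t p \<noteq> 0}. fsc (t p) (tg (fst p) (snd p))) q" by simp
qed

section \<open>Spans of relations and equality modulo them\<close>

lemma cspan_zero: "0 \<in> cspan S"
  unfolding cspan_def by (rule CollectI, rule exI[of _ "[]"]) simp

lemma cspan_add: "f \<in> cspan S \<Longrightarrow> g \<in> cspan S \<Longrightarrow> f + g \<in> cspan S"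
  unfolding cspan_def
proof clarify
  fix cs ds :: "(complex \<times> ftens) list" assume "set (map snd cs) \<subseteq> S" "set (map snd ds) \<subseteq> S"
  then show "\<exists>es. (\<Sum>(c, v)\<leftarrow>cs. fsc c v) + (\<Sum>(c, v)\<leftarrow>ds. fsc c v) = (\<Sum>(c, v)\<leftarrow>es. fsc c v) \<and> set (map snd es) \<subseteq> S"
    by (intro exI[of _ "cs @ ds"]) auto
qed

lemma cspan_base: "f \<in> S \<Longrightarrow> f \<in> cspan S"
  unfolding cspan_def by (rule CollectI, rule exI[of _ "[(1, f)]"]) (simp add: fsc_def)

lemma cspan_induct [consumes 1, case_names zero step]:
  assumes "f \<in> cspan S" "P 0" "\<And>c v f. v \<in> S \<Longrightarrow> f \<in> cspan S \<Longrightarrow> P f \<Longrightarrow> P (fsc c v + f)"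
  shows "P f"
proof -
  have "set (map snd cs) \<subseteq> S \<Longrightarrow> P (\<Sum>(c, v)\<leftarrow>cs. fsc c v)" for cs
  proof (induction cs)
    case (Cons cv cs)
    obtain c v where cv: "cv = (c, v)" by force
    have "(\<Sum>(c, v)\<leftarrow>cs. fsc c v) \<in> cspan S" unfolding cspan_def using Cons.prems by fastforce
    then have "P (fsc c v + (\<Sum>(c, v)\<leftarrow>cs. fsc c v))" using Cons cv by (intro assms(3)) auto
    then show ?case using cv by (simp del: plus_fun_apply)
  qed (use assms(2) in \<open>simp only: list.map sum_list.Nil\<close>)
  then show ?thesis using assms(1) unfolding cspan_def by blast
qed

lemma fsc_add: "fsc c (f + g) = fsc c f + fsc c g"
  by (simp add: fsc_def fun_eq_iff algebra_simps)

lemma fsc_diff: "fsc c (f - g) = fsc c f - fsc c g"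
  by (simp add: fsc_def fun_eq_iff algebra_simps)

lemma fsc_fsc: "fsc c (fsc e f) = fsc (c * e) f"
  by (simp add: fsc_def fun_eq_iff)

lemma fsc_zero: "fsc c 0 = 0" "fsc 0 f = 0"
  by (simp_all add: fsc_def fun_eq_iff)

lemma fsc_minus_one: "fsc (-1) f = - f"
  by (simp add: fsc_def fun_eq_iff)

lemma cspan_fsc: "f \<in> cspan S \<Longrightarrow> fsc c f \<in> cspan S"
proof (induction rule: cspan_induct)
  case zero
  then show ?case by (simp only: fsc_zero cspan_zero)
next
  case (step e v f)
  have "fsc (c * e) v \<in> cspan S"
    unfolding cspan_def using step(1) by (intro CollectI exI[of _ "[(c * e, v)]"]) simp
  then show ?case using step by (simp only: fsc_add fsc_fsc cspan_add)
qed

text \<open>There are no axioms on the sets and actions: the locale serves both E \<otimes> E over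
  A_N and Z(E) \<otimes> A_N over Z(A_N), and each lemma lists the closure properties that it
  uses.\<close>

locale tensor =
  fixes M1 M2 R :: "cmat set" and ract lact :: "cmat \<Rightarrow> cmat \<Rightarrow> cmat"
begin

abbreviation tensor_eq :: "ftens \<Rightarrow> ftens \<Rightarrow> bool" (infix "\<approx>" 50) where
  "f \<approx> g \<equiv> teq M1 M2 R ract lact f g"

lemma teq_refl: "f \<approx> f"
  by (simp only: teq_def diff_self cspan_zero)

lemma teq_sym: "f \<approx> g \<Longrightarrow> g \<approx> f"
  unfolding teq_def using cspan_fsc[of "f - g" _ "-1"] by (simp add: fsc_minus_one)

lemma teq_trans [trans]: "f \<approx> g \<Longrightarrow> g \<approx> h \<Longrightarrow> f \<approx> h"
  unfolding teq_def using cspan_add[of "f - g" _ "g - h"] by simp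

lemma teq_add: "f \<approx> g \<Longrightarrow> f' \<approx> g' \<Longrightarrow> f + f' \<approx> g + g'"
  unfolding teq_def using cspan_add[of "f - g" _ "f' - g'"] by (simp add: algebra_simps)

lemma teq_fsc: "f \<approx> g \<Longrightarrow> fsc c f \<approx> fsc c g"
  unfolding teq_def using cspan_fsc[of "f - g" _ c] by (simp add: fsc_diff)

lemma teq_sum: "(\<And>x. x \<in> S \<Longrightarrow> f x \<approx> g x) \<Longrightarrow> (\<Sum>x\<in>S. f x) \<approx> (\<Sum>x\<in>S. g x)"
  by (induction S rule: infinite_finite_induct)
    (simp_all add: teq_refl teq_add del: zero_fun_apply plus_fun_apply)

lemma teq_add_left: "x \<in> M1 \<Longrightarrow> x' \<in> M1 \<Longrightarrow> y \<in> M2 \<Longrightarrow> tg (x + x') y \<approx> tg x y + tg x' y"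
  unfolding teq_def diff_diff_eq[symmetric] by (rule cspan_base) (unfold trel_def, blast)

lemma teq_add_right: "x \<in> M1 \<Longrightarrow> y \<in> M2 \<Longrightarrow> y' \<in> M2 \<Longrightarrow> tg x (y + y') \<approx> tg x y + tg x y'"
  unfolding teq_def diff_diff_eq[symmetric] by (rule cspan_base) (unfold trel_def, blast)

lemma teq_smul_left: "x \<in> M1 \<Longrightarrow> y \<in> M2 \<Longrightarrow> tg (smul c x) y \<approx> fsc c (tg x y)"
  unfolding teq_def by (rule cspan_base) (unfold trel_def, blast)

lemma teq_smul_right: "x \<in> M1 \<Longrightarrow> y \<in> M2 \<Longrightarrow> tg x (smul c y) \<approx> fsc c (tg x y)"
  unfolding teq_def by (rule cspan_base) (unfold trel_def, blast)

lemma teq_balanced: "x \<in> M1 \<Longrightarrow> r \<in> R \<Longrightarrow> y \<in> M2 \<Longrightarrow> tg (ract x r) y \<approx> tg x (lact r y)"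
  unfolding teq_def by (rule cspan_base) (unfold trel_def, blast)

lemma teq_zero_left:
  assumes "x \<in> M1" "y \<in> M2"
  shows "tg 0 y \<approx> 0"
  using teq_smul_left[OF assms, of 0] by (simp only: smul_zero fsc_zero)

lemma teq_zero_right:
  assumes "x \<in> M1" "y \<in> M2"
  shows "tg x 0 \<approx> 0"
  using teq_smul_right[OF assms, of 0] by (simp only: smul_zero fsc_zero)

lemma teq_sum_left:
  assumes "finite S" "y \<in> M2" "0 \<in> M1" "\<And>v w. v \<in> M1 \<Longrightarrow> w \<in> M1 \<Longrightarrow> v + w \<in> M1"
    "\<And>i. i \<in> S \<Longrightarrow> f i \<in> M1"
  shows "(\<Sum>i\<in>S. f i) \<in> M1 \<and> tg (\<Sum>i\<in>S. f i) y \<approx> (\<Sum>i\<in>S. tg (f i) y)"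
  using assms(1,5)
proof (induction S)
  case empty
  show ?case using assms teq_zero_left[of 0 y] by (simp only: sum.empty)
next
  case (insert i S)
  then have IH: "sum f S \<in> M1" "tg (sum f S) y \<approx> (\<Sum>i\<in>S. tg (f i) y)" "f i \<in> M1" by auto
  have "tg (f i + sum f S) y \<approx> tg (f i) y + tg (sum f S) y"
    using IH assms(2) by (intro teq_add_left)
  also have "\<dots> \<approx> tg (f i) y + (\<Sum>i\<in>S. tg (f i) y)"
    by (intro teq_add teq_refl IH)
  finally show ?case using insert IH assms(4) by (simp del: plus_fun_apply)
qed

lemma teq_sum_right:
  assumes "finite S" "x \<in> M1" "0 \<in> M2" "\<And>v w. v \<in> M2 \<Longrightarrow> w \<in> M2 \<Longrightarrow> v + w \<in> M2"
    "\<And>c v. v \<in> M2 \<Longrightarrow> smul c v \<in> M2" "\<And>i. i \<in> S \<Longrightarrow> f i \<in> M2"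
  shows "(\<Sum>i\<in>S. smul (c i) (f i)) \<in> M2 \<and> tg x (\<Sum>i\<in>S. smul (c i) (f i)) \<approx> (\<Sum>i\<in>S. fsc (c i) (tg x (f i)))"
  using assms(1,6)
proof (induction S)
  case empty
  show ?case using assms teq_zero_right[of x 0] by (simp only: sum.empty)
next
  case (insert i S)
  let ?s = "\<Sum>i\<in>S. smul (c i) (f i)"
  from insert have IH: "?s \<in> M2" "tg x ?s \<approx> (\<Sum>i\<in>S. fsc (c i) (tg x (f i)))" "f i \<in> M2" by auto
  have "tg x (smul (c i) (f i) + ?s) \<approx> tg x (smul (c i) (f i)) + tg x ?s"
    using IH assms(2,5) by (intro teq_add_right) auto
  also have "\<dots> \<approx> fsc (c i) (tg x (f i)) + (\<Sum>i\<in>S. fsc (c i) (tg x (f i)))"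
    using assms IH by (intro teq_add teq_smul_right) auto
  finally show ?case using insert IH assms(4,5) by (simp del: plus_fun_apply)
qed

text \<open>Moving the coordinates of the left factor across the tensor sign shows that only the
  coordinates with respect to the frame \<open>e\<close> matter.\<close>

lemma teq_zero_frame:
  assumes K: "finite K" "\<And>k. k \<in> K \<Longrightarrow> e k \<in> M1" "\<And>k x. k \<in> K \<Longrightarrow> x \<in> M1 \<Longrightarrow> r k x \<in> R"
    and frame: "\<And>x. x \<in> M1 \<Longrightarrow> x = (\<Sum>k\<in>K. ract (e k) (r k x))"
    and M1: "0 \<in> M1" "\<And>v w. v \<in> M1 \<Longrightarrow> w \<in> M1 \<Longrightarrow> v + w \<in> M1"
       "\<And>k z. k \<in> K \<Longrightarrow> z \<in> R \<Longrightarrow> ract (e k) z \<in> M1"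
    and M2: "0 \<in> M2" "\<And>v w. v \<in> M2 \<Longrightarrow> w \<in> M2 \<Longrightarrow> v + w \<in> M2"
       "\<And>c v. v \<in> M2 \<Longrightarrow> smul c v \<in> M2" "\<And>z v. z \<in> R \<Longrightarrow> v \<in> M2 \<Longrightarrow> lact z v \<in> M2"
    and t: "t \<in> free M1 M2" "\<And>k. k \<in> K \<Longrightarrow> tsumM t (\<lambda>x y. lact (r k x) y) = 0"
  shows "t \<approx> 0"
proof -
  let ?P = "{p. t p \<noteq> 0}"
  have P: "finite ?P" "\<And>p. p \<in> ?P \<Longrightarrow> fst p \<in> M1" "\<And>p. p \<in> ?P \<Longrightarrow> snd p \<in> M2"
    using t(1) by (auto simp: free_def)
  have 1: "(\<Sum>p\<in>?P. fsc (t p) (tg (fst p) (snd p))) \<approx> (\<Sum>p\<in>?P. fsc (t p) (\<Sum>k\<in>K. tg (e k) (lact (r k (fst p)) (snd p))))"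
  proof (intro teq_sum teq_fsc)
    fix p assume p: "p \<in> ?P"
    have a: "tg (fst p) (snd p) = tg (\<Sum>k\<in>K. ract (e k) (r k (fst p))) (snd p)"
      by (rule arg_cong[OF frame[OF P(2)[OF p]]])
    have b: "tg (\<Sum>k\<in>K. ract (e k) (r k (fst p))) (snd p) \<approx> (\<Sum>k\<in>K. tg (ract (e k) (r k (fst p))) (snd p))"
      by (rule conjunct2[OF teq_sum_left[where f = "\<lambda>k. ract (e k) (r k (fst p))", OF K(1) P(3)[OF p] M1(1,2)]])
        (assumption | intro M1(3) K(3) P(2)[OF p])+
    have c: "(\<Sum>k\<in>K. tg (ract (e k) (r k (fst p))) (snd p)) \<approx> (\<Sum>k\<in>K. tg (e k) (lact (r k (fst p)) (snd p)))"
      using K P p by (intro teq_sum teq_balanced) auto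
    show "tg (fst p) (snd p) \<approx> (\<Sum>k\<in>K. tg (e k) (lact (r k (fst p)) (snd p)))"
      by (rule ssubst[of _ _ "\<lambda>u. u \<approx> _", OF a]) (rule teq_trans[OF b c])
  qed
  \<comment> \<open>Exchanging the sums collects, for each frame index, all right factors behind one
    \<open>e k\<close>; their sum is the contraction that is assumed to vanish.\<close>
  have 2: "(\<Sum>p\<in>?P. fsc (t p) (\<Sum>k\<in>K. tg (e k) (lact (r k (fst p)) (snd p))))
      = (\<Sum>k\<in>K. \<Sum>p\<in>?P. fsc (t p) (tg (e k) (lact (r k (fst p)) (snd p))))"
  proof -
    have "fsc c (\<Sum>k\<in>K. f k) = (\<Sum>k\<in>K. fsc c (f k))" for c f
      by (rule sum_comp_morphism[of "fsc c", unfolded o_def, symmetric]) (simp_all only: fsc_zero fsc_add)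
    then show ?thesis by (simp only:) (rule sum.swap)
  qed
  have 3: "(\<Sum>k\<in>K. \<Sum>p\<in>?P. fsc (t p) (tg (e k) (lact (r k (fst p)) (snd p)))) \<approx> (\<Sum>k\<in>K. tg (e k) 0)"
  proof (rule teq_sum)
    fix k assume k: "k \<in> K"
    have *: "tg (e k) (\<Sum>p\<in>?P. smul (t p) (lact (r k (fst p)) (snd p)))
        \<approx> (\<Sum>p\<in>?P. fsc (t p) (tg (e k) (lact (r k (fst p)) (snd p))))"
      by (rule conjunct2[OF teq_sum_right[where f = "\<lambda>p. lact (r k (fst p)) (snd p)", OF P(1) K(2)[OF k] M2(1,2,3)]])
        (assumption | intro M2(4) K(3)[OF k] P)+
    show "(\<Sum>p\<in>?P. fsc (t p) (tg (e k) (lact (r k (fst p)) (snd p)))) \<approx> tg (e k) 0"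
      using teq_sym[OF *] unfolding t(2)[OF k, unfolded tsumM_def] .
  qed
  have "(\<Sum>k\<in>K. tg (e k) 0) \<approx> (\<Sum>k\<in>K. 0)"
    using K M2(1) by (intro teq_sum teq_zero_right) auto
  with 1 3 have "(\<Sum>p\<in>?P. fsc (t p) (tg (fst p) (snd p))) \<approx> 0"
    unfolding 2 sum.neutral_const using teq_trans by blast
  then show ?thesis unfolding tsumT_expansion[OF t(1), symmetric] .
qed

text \<open>Universal property of the balanced product: a bilinear balanced \<open>h\<close> kills
  every generating relation, so its extension depends only on the class.\<close>

lemma teq_tsumM:
  assumes "f \<approx> g" "fin_supp f" "fin_supp g"
    and "\<And>x x' y. x \<in> M1 \<Longrightarrow> x' \<in> M1 \<Longrightarrow> y \<in> M2 \<Longrightarrow> h (x + x') y = h x y + h x' y"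
    and "\<And>x y y'. x \<in> M1 \<Longrightarrow> y \<in> M2 \<Longrightarrow> y' \<in> M2 \<Longrightarrow> h x (y + y') = h x y + h x y'"
    and "\<And>c x y. x \<in> M1 \<Longrightarrow> y \<in> M2 \<Longrightarrow> h (smul c x) y = smul c (h x y)"
    and "\<And>c x y. x \<in> M1 \<Longrightarrow> y \<in> M2 \<Longrightarrow> h x (smul c y) = smul c (h x y)"
    and "\<And>x r y. x \<in> M1 \<Longrightarrow> r \<in> R \<Longrightarrow> y \<in> M2 \<Longrightarrow> h (ract x r) y = h x (lact r y)"
  shows "tsumM f h = tsumM g h"
proof -
  have rel: "fin_supp v \<and> tsumM v h = 0" if "v \<in> trel M1 M2 R ract lact" for v
    using that unfolding trel_def
    by (elim UnE CollectE exE conjE;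
        simp only: tsumM_diff tsumM_fsc tsumM_tg fin_supp_diff fin_supp_fsc fin_supp_tg assms(4-8) simp_thms;
        simp)
  have "f - g \<in> cspan (trel M1 M2 R ract lact)" using assms(1) unfolding teq_def .
  then have "fin_supp (f - g) \<and> tsumM (f - g) h = 0"
  proof (induction rule: cspan_induct)
    case zero
    show ?case by (simp only: fin_supp_zero tsumM_zero simp_thms)
  next
    case (step c v f)
    have v: "fin_supp v" "tsumM v h = 0" using rel[OF step(1)] by auto
    have f: "fin_supp f" "tsumM f h = 0" using step(3) by blast+
    have "tsumM (fsc c v + f) h = smul c (tsumM v h) + tsumM f h"
      using v f by (simp only: tsumM_add fin_supp_fsc tsumM_fsc)
    then show ?case unfolding v f using v f by (simp only: fin_supp_add fin_supp_fsc smul_zero add_0_right simp_thms)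
  qed
  then show ?thesis using tsumM_diff[OF assms(2,3), of h] by simp
qed

end

subsection \<open>Coordinates on the tensor square of the one-forms\<close>

definition frame :: "nat \<Rightarrow> nat \<Rightarrow> cmat" where
  "frame N k = form (\<lambda>l. if l = k then idm (dimK N) else 0)"

text \<open>The coefficient of e_k \<otimes> e_l, where e_k is \<open>frame N k\<close>. The
  coefficient of the left factor is moved across the tensor sign and past the central e_l, so it
  ends up to the left of \<open>coef l y\<close>.\<close>

definition coord :: "nat \<Rightarrow> ftens \<Rightarrow> nat \<Rightarrow> nat \<Rightarrow> cmat" where
  "coord N t k l = tsumM t (\<lambda>x y. mmul (dimK N) (coef k x) (coef l y))"

definition of_coord :: "nat \<Rightarrow> (nat \<Rightarrow> nat \<Rightarrow> cmat) \<Rightarrow> ftens" where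
  "of_coord N T = (\<Sum>k\<in>{1,2,3}. tg (frame N k) (form (T k)))"

lemma coef_frame: "l \<in> {1,2,3} \<Longrightarrow> coef l (frame N k) = (if l = k then idm (dimK N) else 0)"
  by (simp only: frame_def coef_form)

lemma coef_dA: "k \<in> {1,2,3} \<Longrightarrow> coef k (dA N a) = der N k a"
  by (simp only: dA_form coef_form)

lemma tsumM_form: "tsumM t (\<lambda>x y. form (h x y)) = form (\<lambda>l. tsumM t (\<lambda>x y. h x y l))"
  by (simp only: tsumM_def form_sum form_smul)

lemma coord_add: "fin_supp t \<Longrightarrow> fin_supp u \<Longrightarrow> coord N (t + u) k l = coord N t k l + coord N u k l"
  by (simp only: coord_def tsumM_add)

lemma coord_diff: "fin_supp t \<Longrightarrow> fin_supp u \<Longrightarrow> coord N (t - u) k l = coord N t k l - coord N u k l"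
  by (simp only: coord_def tsumM_diff)

lemma coord_fsc: "coord N (fsc c t) k l = smul c (coord N t k l)"
  by (simp only: coord_def tsumM_fsc)

lemma coord_tg: "coord N (tg x y) k l = mmul (dimK N) (coef k x) (coef l y)"
  by (simp only: coord_def tsumM_tg)

lemma coord_zero: "coord N 0 k l = 0"
  by (simp only: coord_def tsumM_zero)

text \<open>The three cyclic pairs are, up to order, all pairs of distinct indices.\<close>

lemma asym_eq_zero_iff:
  "(\<forall>m\<in>{1,2,3}. asym T m = 0) \<longleftrightarrow> (\<forall>k\<in>{1,2,3}. \<forall>l\<in>{1,2,3}. T k l = T l k)"
  unfolding asym_def by (simp only: ball_simps nxt_simps right_minus_eq) metis

lemma sym_and_antisym: "A = B \<Longrightarrow> A = - B \<Longrightarrow> A = 0" for A B :: cmat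
  by (simp add: fun_eq_iff)

interpretation tE: tensor "Omega1 N" "Omega1 N" "AN N" "\<lambda>x a. mmul (dimH N) x (iota a)"
  "\<lambda>a y. mmul (dimH N) (iota a) y" for N .

interpretation tZ: tensor "ZE N" "AN N" "ZA N" "\<lambda>x z. mmul (dimH N) x (iota z)"
  "\<lambda>z a. mmul (dimK N) z a" for N .

text \<open>\<open>1 \<le> N\<close> provides the spin 1/2 summand, on which the freeness of the
  one-forms rests.\<close>

locale fuzzy_sphere =
  fixes N :: nat
  assumes N: "1 \<le> N"
begin

lemma frame_Omega1: "frame N k \<in> Omega1 N"
  unfolding frame_def using AN_intros(4,7)[of N] by (intro Omega1_formI N) simp

lemma Omega1_smul: "w \<in> Omega1 N \<Longrightarrow> smul c w \<in> Omega1 N"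
  by (metis Omega1_formD Omega1_formI[OF N] AN_intros(5) form_smul)

lemma Omega1_iota_left: "w \<in> Omega1 N \<Longrightarrow> a \<in> AN N \<Longrightarrow> mmul (dimH N) (iota a) w \<in> Omega1 N"
  by (metis Omega1_formD Omega1_formI[OF N] AN_intros(6) iota_mmul_form dimH_def)

lemma Omega1_iota_right: "w \<in> Omega1 N \<Longrightarrow> a \<in> AN N \<Longrightarrow> mmul (dimH N) w (iota a) \<in> Omega1 N"
  by (metis Omega1_formD Omega1_formI[OF N] AN_intros(6) form_mmul_iota dimH_def)

lemma dA_Omega1: "a \<in> AN N \<Longrightarrow> dA N a \<in> Omega1 N"
  unfolding dA_form by (intro Omega1_formI N AN_intros)

lemma coef_iota_left:
  "w \<in> Omega1 N \<Longrightarrow> k \<in> {1,2,3} \<Longrightarrow> coef k (mmul (dimH N) (iota a) w) = mmul (dimK N) a (coef k w)"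
  by (metis Omega1_formD coef_form iota_mmul_form dimH_def)

lemma coef_iota_right:
  "w \<in> Omega1 N \<Longrightarrow> k \<in> {1,2,3} \<Longrightarrow> coef k (mmul (dimH N) w (iota a)) = mmul (dimK N) (coef k w) a"
  by (metis Omega1_formD coef_form form_mmul_iota dimH_def)

lemma frame_expansion:
  assumes "w \<in> Omega1 N"
  shows "w = (\<Sum>k\<in>{1,2,3}. mmul (dimH N) (frame N k) (iota (coef k w)))"
proof -
  have "(\<Sum>k\<in>{1,2,3}. mmul (dimH N) (frame N k) (iota (coef k w)))
     = form (\<lambda>l. \<Sum>k\<in>{1,2,3}. if l = k then coef k w else 0)"
    unfolding form_sum frame_def dimH_def form_mmul_iota
    using coef_AN[OF assms] unfolding AN_def by (intro sum.cong refl form_cong) (auto simp: idm_mmul)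
  also have "\<dots> = form (\<lambda>l. coef l w)"
    by (rule form_cong) auto
  finally show ?thesis using form_coef[OF assms] by simp
qed

lemma frame_central:
  assumes "a \<in> AN N"
  shows "mmul (dimH N) (iota a) (frame N k) = mmul (dimH N) (frame N k) (iota a)"
  unfolding frame_def dimH_def form_mmul_iota iota_mmul_form
  using assms unfolding AN_def by (intro form_cong) (auto simp: idm_mmul mmul_idm)

lemma EE_tg: "x \<in> Omega1 N \<Longrightarrow> y \<in> Omega1 N \<Longrightarrow> tg x y \<in> EE N"
  unfolding EE_def by (rule free_tg)

lemma EE_fin: "t \<in> EE N \<Longrightarrow> fin_supp t"
  unfolding EE_def by (rule free_fin_supp)

lemma EE_support: "t \<in> EE N \<Longrightarrow> t (x, y) \<noteq> 0 \<Longrightarrow> x \<in> Omega1 N \<and> y \<in> Omega1 N"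
  unfolding EE_def using free_support[of t _ _ "(x, y)"] by simp

lemma EE_closed: "t \<in> EE N \<Longrightarrow> u \<in> EE N \<Longrightarrow> t + u \<in> EE N" "t \<in> EE N \<Longrightarrow> u \<in> EE N \<Longrightarrow> t - u \<in> EE N"
  "t \<in> EE N \<Longrightarrow> fsc c t \<in> EE N" "0 \<in> EE N"
  unfolding EE_def by (rule free_add free_diff free_fsc free_zero; assumption?)+

lemma coord_AN:
  assumes "t \<in> EE N" "k \<in> {1,2,3}" "l \<in> {1,2,3}"
  shows "coord N t k l \<in> AN N"
  unfolding coord_def tsumM_def
  using assms(1) unfolding EE_def by (intro AN_intros coef_AN assms) (auto dest: free_support)

text \<open>Coordinates are bilinear and balanced, so they respect the relations. Conversely, if all
  coordinates of \<open>t - u\<close> vanish, so does each contraction of its left factors, and the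
  frame argument applies. Together with \<open>coord_of_coord\<close> this makes E \<otimes> E a
  free module with nine coordinates.\<close>

lemma teqE_iff:
  assumes "t \<in> EE N" "u \<in> EE N"
  shows "teqE N t u \<longleftrightarrow> (\<forall>k\<in>{1,2,3}. \<forall>l\<in>{1,2,3}. coord N t k l = coord N u k l)"
proof
  assume "teqE N t u"
  then show "\<forall>k\<in>{1,2,3}. \<forall>l\<in>{1,2,3}. coord N t k l = coord N u k l"
    unfolding coord_def teqE_def
    by (intro ballI tE.teq_tsumM[OF _ EE_fin[OF assms(1)] EE_fin[OF assms(2)]])
      (simp_all only: coef_add coef_smul mmul_distribs mmul_assoc,
       simp only: coef_iota_left coef_iota_right mmul_assoc)
next
  assume eq: "\<forall>k\<in>{1,2,3}. \<forall>l\<in>{1,2,3}. coord N t k l = coord N u k l"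
  have d: "t - u \<in> EE N" using assms by (intro EE_closed)
  have "tsumM (t - u) (\<lambda>x y. mmul (dimH N) (iota (coef k x)) y) = 0" if k: "k \<in> {1,2,3}" for k
  proof -
    have "tsumM (t - u) (\<lambda>x y. mmul (dimH N) (iota (coef k x)) y)
       = tsumM (t - u) (\<lambda>x y. form (\<lambda>l. mmul (dimK N) (coef k x) (coef l y)))"
    proof (rule tsumM_cong)
      fix x y assume "(t - u) (x, y) \<noteq> 0"
      then have "y \<in> Omega1 N" using EE_support[OF d] by blast
      then show "mmul (dimH N) (iota (coef k x)) y = form (\<lambda>l. mmul (dimK N) (coef k x) (coef l y))"
        using form_coef[of y N] iota_mmul_form[of "dimK N" "coef k x" "\<lambda>l. coef l y"] by (simp only: dimH_def)
    qed
    also have "\<dots> = form (\<lambda>l. coord N (t - u) k l)"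
      unfolding tsumM_form coord_def ..
    also have "\<dots> = 0"
      using eq k assms by (intro form_eq_zero) (simp only: coord_diff EE_fin diff_self)
    finally show ?thesis .
  qed
  then have "teq (Omega1 N) (Omega1 N) (AN N) (\<lambda>x a. mmul (dimH N) x (iota a)) (\<lambda>a y. mmul (dimH N) (iota a) y) (t - u) 0"
    using d unfolding EE_def
    by (intro tE.teq_zero_frame[where K = "{1,2,3}" and e = "frame N" and r = coef])
      (assumption | rule frame_Omega1 coef_AN frame_expansion Omega1_zero Omega1_add Omega1_smul
         Omega1_iota_left Omega1_iota_right finite.intros)+
  then show "teqE N t u" unfolding teqE_def teq_def by simp
qed

lemma multE_coord:
  assumes "t \<in> EE N"
  shows "multE N t = mult2 (coord N t)"
proof -
  have "multE N t = tsumM t (\<lambda>x y. mult2 (\<lambda>k l. mmul (dimK N) (coef k x) (coef l y)))"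
    unfolding multE_def
  proof (rule tsumM_cong)
    fix x y assume "t (x, y) \<noteq> 0"
    then have "x \<in> Omega1 N" "y \<in> Omega1 N" using EE_support[OF assms] by blast+
    then show "mmul (dimH N) x y = mult2 (\<lambda>k l. mmul (dimK N) (coef k x) (coef l y))"
      using form_coef form_mmul_form_mult2[of "dimK N" "\<lambda>k. coef k x" "\<lambda>l. coef l y"] by (simp only: dimH_def)
  qed
  then show ?thesis unfolding coord_def tsumM_def mult2_sum mult2_smul .
qed

lemma of_coord_EE:
  assumes "\<And>k l. k \<in> {1,2,3} \<Longrightarrow> l \<in> {1,2,3} \<Longrightarrow> T k l \<in> AN N"
  shows "of_coord N T \<in> EE N"
  unfolding of_coord_def EE_def using assms by (intro free_sum free_tg frame_Omega1 Omega1_formI N)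

lemma coord_of_coord:
  assumes "\<And>k l. k \<in> {1,2,3} \<Longrightarrow> l \<in> {1,2,3} \<Longrightarrow> T k l \<in> AN N" "k \<in> {1,2,3}" "l \<in> {1,2,3}"
  shows "coord N (of_coord N T) k l = T k l"
proof -
  have "coord N (of_coord N T) k l = (\<Sum>i\<in>{1,2,3}. coord N (tg (frame N i) (form (T i))) k l)"
    unfolding coord_def of_coord_def by (rule tsumM_sum) (rule fin_supp_tg)
  also have "\<dots> = (\<Sum>i\<in>{1,2,3}. if i = k then T k l else 0)"
    using assms(1)[OF assms(2,3)] unfolding AN_def
    by (intro sum.cong refl) (simp add: coord_tg coef_frame[OF assms(2)] coef_form[OF assms(3)] idm_mmul)
  finally show ?thesis using assms(2) by auto
qed

lemma rmulT_EE: "t \<in> EE N \<Longrightarrow> a \<in> AN N \<Longrightarrow> rmulT N t a \<in> EE N"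
  unfolding EE_def rmulT_def tsumT_def
  by (intro free_sum free_fsc free_tg Omega1_iota_right) (auto dest: free_support)

lemma coord_rmulT:
  assumes "t \<in> EE N" "l \<in> {1,2,3}"
  shows "coord N (rmulT N t a) k l = mmul (dimK N) (coord N t k l) a"
proof -
  have "coord N (rmulT N t a) k l = tsumM t (\<lambda>x y. mmul (dimK N) (coef k x) (coef l (mmul (dimH N) y (iota a))))"
    unfolding coord_def rmulT_def tsumT_def
    by (subst tsumM_sum) (simp_all only: fin_supp_fsc fin_supp_tg tsumM_fsc tsumM_tg, simp only: tsumM_def)
  also have "\<dots> = tsumM t (\<lambda>x y. mmul (dimK N) (mmul (dimK N) (coef k x) (coef l y)) a)"
    using EE_support[OF assms(1)] assms(2) by (intro tsumM_cong) (simp only: coef_iota_right mmul_assoc)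
  also have "\<dots> = mmul (dimK N) (coord N t k l) a"
    unfolding coord_def by (rule tsumM_linear) (simp_all only: mmul_zero_left mmul_distribs)
  finally show ?thesis .
qed

section \<open>The kernel of the wedge product and its complement\<close>

lemma multE_J2_iff:
  assumes "t \<in> EE N"
  shows "multE N t \<in> J2 N \<longleftrightarrow> (\<forall>k\<in>{1,2,3}. \<forall>l\<in>{1,2,3}. coord N t k l = coord N t l k)"
proof -
  have "mult2 (coord N t) \<in> two_forms N" using assms by (intro mult2_two_forms coord_AN)
  then have "multE N t \<in> J2 N \<longleftrightarrow> (\<forall>m\<in>{1,2,3}. asym (coord N t) m = 0)"
    by (simp only: multE_coord[OF assms] two_forms_J2[OF N] coef_mult2 neg_equal_0_iff_equal cong: ball_cong)
  then show ?thesis unfolding asym_eq_zero_iff .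
qed

lemma kerw_iff: "t \<in> kerw N \<longleftrightarrow> t \<in> EE N \<and> (\<forall>k\<in>{1,2,3}. \<forall>l\<in>{1,2,3}. coord N t k l = coord N t l k)"
  unfolding kerw_def using multE_J2_iff by blast

text \<open>Cut out by coordinates rather than spanned by generators: coordinates are invariant
  under \<open>teqE\<close>, so the set is saturated, as \<open>good_F\<close> asks.\<close>

definition antiT :: "ftens set" where
  "antiT = {t \<in> EE N. \<forall>k\<in>{1,2,3}. \<forall>l\<in>{1,2,3}. coord N t k l = - coord N t l k}"

lemma antiT_EE: "t \<in> antiT \<Longrightarrow> t \<in> EE N"
  by (simp add: antiT_def)

lemma antiT_coord: "t \<in> antiT \<Longrightarrow> k \<in> {1,2,3} \<Longrightarrow> l \<in> {1,2,3} \<Longrightarrow> coord N t k l = - coord N t l k"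
  unfolding antiT_def by blast

lemma antiT_I: "t \<in> EE N \<Longrightarrow> (\<And>k l. k \<in> {1,2,3} \<Longrightarrow> l \<in> {1,2,3} \<Longrightarrow> coord N t k l = - coord N t l k) \<Longrightarrow> t \<in> antiT"
  unfolding antiT_def by blast

lemma decomposition:
  assumes "t \<in> EE N"
  obtains s f where "s \<in> kerw N" "f \<in> antiT" "teqE N t (s + f)"
proof -
  let ?S = "\<lambda>k l. smul (1/2) (coord N t k l + coord N t l k)"
  let ?A = "\<lambda>k l. smul (1/2) (coord N t k l - coord N t l k)"
  have mem: "?S k l \<in> AN N" "?A k l \<in> AN N" if "k \<in> {1,2,3}" "l \<in> {1,2,3}" for k l
    by (intro AN_intros coord_AN assms that)+
  have EE: "of_coord N ?S \<in> EE N" "of_coord N ?A \<in> EE N"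
    by (intro of_coord_EE mem; assumption)+
  have C: "coord N (of_coord N ?S) k l = ?S k l" "coord N (of_coord N ?A) k l = ?A k l"
    if "k \<in> {1,2,3}" "l \<in> {1,2,3}" for k l
    by (intro coord_of_coord mem that; assumption)+
  have "coord N (of_coord N ?S) k l = coord N (of_coord N ?S) l k" if "k \<in> {1,2,3}" "l \<in> {1,2,3}" for k l
    unfolding C(1)[OF that] C(1)[OF that(2,1)] by (simp only: add.commute)
  then have "of_coord N ?S \<in> kerw N"
    unfolding kerw_iff using EE(1) by blast
  moreover have "of_coord N ?A \<in> antiT"
    using EE(2) by (rule antiT_I) (simp only: C, simp add: smul_def fun_eq_iff field_simps)
  moreover have "teqE N t (of_coord N ?S + of_coord N ?A)"
    unfolding teqE_iff[OF assms EE_closed(1)[OF EE]]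
  proof (intro ballI)
    fix k l :: nat assume "k \<in> {1,2,3}" "l \<in> {1,2,3}"
    then have "coord N (of_coord N ?S + of_coord N ?A) k l = ?S k l + ?A k l"
      by (simp only: coord_add EE[THEN EE_fin] C)
    also have "\<dots> = coord N t k l" by (simp add: smul_def fun_eq_iff field_simps)
    finally show "coord N t k l = coord N (of_coord N ?S + of_coord N ?A) k l" by simp
  qed
  ultimately show ?thesis using that by blast
qed

lemma good_F_antiT: "good_F N antiT"
proof -
  have sat: "u \<in> antiT" if "t \<in> antiT" "u \<in> EE N" "teqE N t u" for t u
  proof (rule antiT_I[OF that(2)])
    have "\<forall>k\<in>{1,2,3}. \<forall>l\<in>{1,2,3}. coord N t k l = coord N u k l"
      using that teqE_iff[of t u] antiT_EE by blast
    then show "coord N u k l = - coord N u l k" if "k \<in> {1,2,3}" "l \<in> {1,2,3}" for k l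
      using that antiT_coord[OF \<open>t \<in> antiT\<close> that] by metis
  qed
  have zero: "0 \<in> antiT"
    by (rule antiT_I[OF EE_closed(4)]) (simp only: coord_zero minus_zero)
  have add: "t + u \<in> antiT" if "t \<in> antiT" "u \<in> antiT" for t u
  proof (rule antiT_I)
    fix k l :: nat assume kl: "k \<in> {1,2,3}" "l \<in> {1,2,3}"
    show "coord N (t + u) k l = - coord N (t + u) l k"
      using antiT_coord[OF that(1) kl] antiT_coord[OF that(2) kl]
      by (simp only: coord_add that[THEN antiT_EE, THEN EE_fin] minus_add_distrib)
  qed (intro EE_closed that[THEN antiT_EE])
  have scale: "fsc c t \<in> antiT" if "t \<in> antiT" for c t
  proof (rule antiT_I)
    fix k l :: nat assume kl: "k \<in> {1,2,3}" "l \<in> {1,2,3}"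
    have "smul c (- A) = - smul c A" for A by (simp add: smul_def fun_eq_iff)
    then show "coord N (fsc c t) k l = - coord N (fsc c t) l k"
      using antiT_coord[OF that kl] by (simp only: coord_fsc)
  qed (intro EE_closed that[THEN antiT_EE])
  have right: "rmulT N t a \<in> antiT" if "t \<in> antiT" "a \<in> AN N" for t a
  proof (rule antiT_I)
    fix k l :: nat assume kl: "k \<in> {1,2,3}" "l \<in> {1,2,3}"
    show "coord N (rmulT N t a) k l = - coord N (rmulT N t a) l k"
      using antiT_coord[OF that(1) kl] kl
      by (simp only: coord_rmulT that(1)[THEN antiT_EE] mmul_minus_left)
  qed (intro rmulT_EE that antiT_EE)
  have inter: "teqE N t 0" if "t \<in> antiT" "multE N t \<in> J2 N" for t
  proof -
    have "coord N t k l = coord N 0 k l" if "k \<in> {1,2,3}" "l \<in> {1,2,3}" for k l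
      using that \<open>multE N t \<in> J2 N\<close> antiT_coord[OF \<open>t \<in> antiT\<close> that] \<open>t \<in> antiT\<close>[THEN antiT_EE]
      unfolding coord_zero multE_J2_iff[OF \<open>t \<in> antiT\<close>[THEN antiT_EE]]
      by (intro sym_and_antisym[of _ "coord N t l k"]) blast+
    then show ?thesis using teqE_iff[OF antiT_EE[OF that(1)] EE_closed(4)] by blast
  qed
  have module: "multE N (rmulT N f a) = mmul (dimH N) (multE N f) (iota a)" if f: "f \<in> antiT" and a: "a \<in> AN N" for f a
  proof -
    have "multE N (rmulT N f a) = mult2 (\<lambda>k l. mmul (dimK N) (coord N f k l) a)"
      unfolding multE_coord[OF rmulT_EE[OF antiT_EE[OF f] a]]
      by (intro mult2_cong) (simp only: coord_rmulT antiT_EE[OF f])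
    also have "\<dots> = mmul (dimH N) (mult2 (coord N f)) (iota a)"
    proof -
      have "form (asym (\<lambda>k l. mmul (dimK N) (coord N f k l) a)) = form (\<lambda>m. mmul (dimK N) (asym (coord N f) m) a)"
        by (rule form_cong) (simp only: asym_def mmul_distribs)
      then show ?thesis
        by (simp only: mult2_def dimH_def mmul_diff_left iota_mmul_iota form_mmul_iota mmul_minus_left mmul_sum_left)
    qed
    finally show ?thesis by (simp only: multE_coord antiT_EE[OF f])
  qed
  have surj: "\<exists>f\<in>antiT. multE N f - s \<in> J2 N" if sSS: "s \<in> SS N" for s
  proof -
    obtain a c where s: "s = iota a + form c" "a \<in> AN N" "\<And>k. c k \<in> AN N"
      using SS_two_forms[OF sSS] unfolding two_forms_def by blast
    \<comment> \<open>An antisymmetric array with prescribed Pauli part: its two halves add up in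
      \<open>asym\<close> to \<open>- c m\<close>, which offsets the sign in
      \<open>coef_mult2\<close>. The scalar part of \<open>s\<close> is left alone, since it lies in
      \<open>J2 N\<close>.\<close>
    define T where "T k l = (if l = nxt k then smul (-1/2) (c (nxt l))
       else if k = nxt l then smul (1/2) (c (nxt k)) else 0)" for k l
    have T: "T k l \<in> AN N" for k l
      unfolding T_def using s(3) AN_intros(4)[of N] AN_intros(5)[of _ N] by simp
    note EE = of_coord_EE[of T, OF T]
    have anti: "T k l = - T l k" if "k \<in> {1,2,3}" "l \<in> {1,2,3}" for k l
      using that unfolding T_def by (elim insertE emptyE; hypsubst; simp only: nxt_simps; simp add: smul_def fun_eq_iff)
    have "of_coord N T \<in> antiT"
      using EE by (rule antiT_I) (simp only: coord_of_coord[of T, OF T], rule anti)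
    moreover have "multE N (of_coord N T) - s \<in> J2 N"
    proof -
      have "iota (- a) + form (\<lambda>k. - c k) \<in> two_forms N"
        unfolding two_forms_def using s AN_intros(3) by blast
      moreover have "mult2 T \<in> two_forms N" by (intro mult2_two_forms T)
      moreover have "mult2 T - s = mult2 T + (iota (- a) + form (\<lambda>k. - c k))"
        by (simp add: s iota_minus form_minus)
      ultimately have 1: "mult2 T - s \<in> two_forms N" using two_forms_add by metis
      have 2: "coef m (mult2 T - s) = 0" if "m \<in> {1,2,3}" for m
      proof -
        have "asym T m = - c m"
          using that unfolding T_def asym_def
          by (elim insertE emptyE; hypsubst; simp only: nxt_simps; simp add: smul_def fun_eq_iff)
        then show ?thesis using that by (simp add: coef_diff coef_mult2 s coef_add coef_iota coef_form)
      qed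
      have "multE N (of_coord N T) = mult2 T"
        unfolding multE_coord[OF EE] by (rule mult2_cong) (rule coord_of_coord[of T, OF T])
      then show ?thesis using 1 2 two_forms_J2[OF N] by metis
    qed
    ultimately show ?thesis by blast
  qed
  show ?thesis
    unfolding good_F_def
    apply (intro conjI ballI allI impI)
    subgoal using antiT_EE by blast
    subgoal by (rule sat)
    subgoal by (rule zero)
    subgoal by (rule add)
    subgoal by (rule scale)
    subgoal by (rule right)
    subgoal using decomposition by metis
    subgoal using inter unfolding kerw_def by blast
    subgoal by (rule module)
    subgoal by (rule inter)
    subgoal by (rule surj)
    done
qed

text \<open>Transposition of coordinates is 1 on symmetric and - 1 on antisymmetric arrays, exactly
  as \<sigma> is on the two summands.\<close>

lemma is_sigma_iff:
  assumes "t \<in> EE N" "u \<in> EE N"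
  shows "is_sigma N antiT t u \<longleftrightarrow> (\<forall>k\<in>{1,2,3}. \<forall>l\<in>{1,2,3}. coord N u k l = coord N t l k)"
proof -
  have key: "coord N (s - f) k l = coord N (s + f) l k"
    if "s \<in> kerw N" "f \<in> antiT" "k \<in> {1,2,3}" "l \<in> {1,2,3}" for s f k l
  proof -
    have sf: "fin_supp s" "fin_supp f" using that kerw_iff EE_fin antiT_EE by blast+
    have "coord N s k l = coord N s l k" using that kerw_iff by blast
    moreover have "coord N f k l = - coord N f l k" using that antiT_coord by blast
    ultimately show ?thesis by (simp only: coord_add[OF sf] coord_diff[OF sf] diff_minus_eq_add)
  qed
  show ?thesis
  proof
    assume "is_sigma N antiT t u"
    then obtain s f where sf: "s \<in> kerw N" "f \<in> antiT" "teqE N t (s + f)" "teqE N u (s - f)"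
      unfolding is_sigma_def by blast
    then have "s \<in> EE N" "f \<in> EE N" using kerw_iff antiT_EE by blast+
    then show "\<forall>k\<in>{1,2,3}. \<forall>l\<in>{1,2,3}. coord N u k l = coord N t l k"
      using sf teqE_iff[OF assms(1) EE_closed(1)] teqE_iff[OF assms(2) EE_closed(2)] key[OF sf(1,2)] by simp
  next
    assume C: "\<forall>k\<in>{1,2,3}. \<forall>l\<in>{1,2,3}. coord N u k l = coord N t l k"
    obtain s f where sf: "s \<in> kerw N" "f \<in> antiT" "teqE N t (s + f)"
      using decomposition[OF assms(1)] .
    then have "s \<in> EE N" "f \<in> EE N" using kerw_iff antiT_EE by blast+
    then have "teqE N u (s - f)"
      using C sf teqE_iff[OF assms(1) EE_closed(1)] teqE_iff[OF assms(2) EE_closed(2)] key[OF sf(1,2)] by simp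
    then show "is_sigma N antiT t u" using sf unfolding is_sigma_def by blast
  qed
qed

text \<open>\<open>sigmaF\<close> picks an arbitrary representative, so only its coordinates are
  determined. The transposed array, realised by \<open>of_coord\<close>, shows that there is
  something to choose.\<close>

lemma
  assumes "t \<in> EE N"
  shows sigmaF_EE: "sigmaF N antiT t \<in> EE N"
    and coord_sigmaF: "k \<in> {1,2,3} \<Longrightarrow> l \<in> {1,2,3} \<Longrightarrow> coord N (sigmaF N antiT t) k l = coord N t l k"
proof -
  let ?u = "of_coord N (\<lambda>k l. coord N t l k)"
  have T: "coord N t l k \<in> AN N" if "k \<in> {1,2,3}" "l \<in> {1,2,3}" for k l
    using coord_AN[OF assms that(2,1)] .
  have u: "?u \<in> EE N" by (intro of_coord_EE T)
  then have "is_sigma N antiT t ?u"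
    unfolding is_sigma_iff[OF assms u] using coord_of_coord[of "\<lambda>k l. coord N t l k", OF T] by blast
  then have *: "sigmaF N antiT t \<in> EE N \<and> is_sigma N antiT t (sigmaF N antiT t)"
    unfolding sigmaF_def using u by (intro someI[of "\<lambda>u. u \<in> EE N \<and> is_sigma N antiT t u"]) blast
  then show "sigmaF N antiT t \<in> EE N" by blast
  show "coord N (sigmaF N antiT t) k l = coord N t l k" if "k \<in> {1,2,3}" "l \<in> {1,2,3}"
    using * that is_sigma_iff[OF assms] by blast
qed

section \<open>Central one-forms and the flip on them\<close>

lemma dimK_pos: "0 < dimK N"
  using dimK_ge_3[OF N] by simp

lemma ZA_AN: "z \<in> ZA N \<Longrightarrow> z \<in> AN N"
  by (simp add: ZA_def)

lemma ZE_Omega1: "w \<in> ZE N \<Longrightarrow> w \<in> Omega1 N"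
  by (simp add: ZE_def)

lemma frame_ZE: "frame N k \<in> ZE N"
  unfolding ZE_def using frame_Omega1 frame_central by blast

lemma coef_ZE_ZA:
  assumes "w \<in> ZE N" "k \<in> {1,2,3}"
  shows "coef k w \<in> ZA N"
proof -
  have w: "w \<in> Omega1 N" using assms(1) ZE_Omega1 by blast
  have "mmul (dimK N) (coef k w) a = mmul (dimK N) a (coef k w)" if "a \<in> AN N" for a
  proof -
    have "coef k (mmul (dimH N) (iota a) w) = coef k (mmul (dimH N) w (iota a))"
      using assms(1) that unfolding ZE_def by simp
    then show ?thesis by (simp only: coef_iota_left[OF w assms(2)] coef_iota_right[OF w assms(2)])
  qed
  then show ?thesis unfolding ZA_def using coef_AN[OF w assms(2)] by blast
qed

text \<open>The centre of a full matrix algebra consists of scalars, so a central one-form is a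
  complex combination of the frame; entry (0, 0) reads off each scalar.\<close>

lemma coef_ZE: "w \<in> ZE N \<Longrightarrow> k \<in> {1,2,3} \<Longrightarrow> coef k w = smul (coef k w 0 0) (idm (dimK N))"
  using coef_ZE_ZA[of w k] dimK_pos unfolding ZA_def AN_def
  by (intro scalar_matrix_if_central) blast+

text \<open>Transposing coordinates produces \<open>coef l w\<close> times \<open>coef k y\<close>,
  the wrong order for \<open>tg y w\<close>; centrality of the coefficients allows the
  exchange.\<close>

lemma sigmaF_flip:
  assumes "w \<in> ZE N" "y \<in> ZE N"
  shows "teqE N (sigmaF N antiT (tg w y)) (tg y w)"
proof -
  have wy: "w \<in> Omega1 N" "y \<in> Omega1 N" using assms ZE_Omega1 by blast+
  note EE = EE_tg[OF wy] EE_tg[OF wy(2,1)]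
  show ?thesis
    unfolding teqE_iff[OF sigmaF_EE[OF EE(1)] EE(2)]
  proof (intro ballI)
    fix k l :: nat assume kl: "k \<in> {1,2,3}" "l \<in> {1,2,3}"
    then have "mmul (dimK N) (coef l w) (coef k y) = mmul (dimK N) (coef k y) (coef l w)"
      using coef_ZE_ZA[OF assms(1)] coef_AN[OF wy(2)] unfolding ZA_def by blast
    then show "coord N (sigmaF N antiT (tg w y)) k l = coord N (tg y w) k l"
      by (simp only: coord_sigmaF[OF EE(1) kl] coord_tg)
  qed
qed

lemma part1_holds: "part1 N"
proof -
  have 1: "tsumM t (\<lambda>x a. mmul (dimH N) x (iota a)) \<in> Omega1 N" if "t \<in> free (ZE N) (AN N)" for t
    unfolding tsumM_def using free_support[OF that] ZE_Omega1
    by (intro Omega1_sum Omega1_smul Omega1_iota_right) auto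
  have 2: "\<exists>t\<in>free (ZE N) (AN N). tsumM t (\<lambda>x a. mmul (dimH N) x (iota a)) = w" if w: "w \<in> Omega1 N" for w
  proof
    let ?t = "\<Sum>k\<in>{1,2,3}. tg (frame N k) (coef k w)"
    show "?t \<in> free (ZE N) (AN N)" using w by (intro free_sum free_tg frame_ZE coef_AN)
    show "tsumM ?t (\<lambda>x a. mmul (dimH N) x (iota a)) = w"
      by (subst tsumM_sum, rule fin_supp_tg) (simp only: tsumM_tg frame_expansion[OF w, symmetric])
  qed
  \<comment> \<open>Injectivity: the contraction with \<open>coef k\<close> is the k-th coefficient
    of the product, which is zero. The frame argument can run over Z(A_N) because central forms have
    central coefficients.\<close>
  have 3: "teq (ZE N) (AN N) (ZA N) (\<lambda>x z. mmul (dimH N) x (iota z)) (\<lambda>z a. mmul (dimK N) z a) t 0"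
    if t: "t \<in> free (ZE N) (AN N)" and 0: "tsumM t (\<lambda>x a. mmul (dimH N) x (iota a)) = 0" for t
  proof (rule tZ.teq_zero_frame[where K = "{1,2,3}" and e = "frame N" and r = coef])
    show "tsumM t (\<lambda>x y. mmul (dimK N) (coef k x) y) = 0" if "k \<in> {1,2,3}" for k
    proof -
      have "tsumM t (\<lambda>x y. mmul (dimK N) (coef k x) y) = tsumM t (\<lambda>x y. coef k (mmul (dimH N) x (iota y)))"
      proof (rule tsumM_cong)
        fix x y assume "t (x, y) \<noteq> 0"
        then have "x \<in> Omega1 N" using free_support[OF t, of "(x, y)"] ZE_Omega1 by simp
        then show "mmul (dimK N) (coef k x) y = coef k (mmul (dimH N) x (iota y))"
          using that by (simp only: coef_iota_right)
      qed
      also have "\<dots> = coef k (tsumM t (\<lambda>x y. mmul (dimH N) x (iota y)))"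
        by (rule tsumM_linear) (simp_all only: coef_zero coef_add coef_smul)
      finally show ?thesis by (simp only: 0 coef_zero)
    qed
    show "x = (\<Sum>k\<in>{1,2,3}. mmul (dimH N) (frame N k) (iota (coef k x)))" if "x \<in> ZE N" for x
      using frame_expansion ZE_Omega1 that by blast
    show "0 \<in> ZE N" unfolding ZE_def using Omega1_zero by simp
    show "v + w \<in> ZE N" if "v \<in> ZE N" "w \<in> ZE N" for v w
      using that unfolding ZE_def by (simp add: Omega1_add mmul_distribs del: plus_fun_apply)
    show "mmul (dimH N) (frame N k) (iota z) \<in> ZE N" if "k \<in> {1,2,3}" "z \<in> ZA N" for k z
    proof -
      have "mmul (dimH N) (iota a) (mmul (dimH N) (frame N k) (iota z)) = mmul (dimH N) (mmul (dimH N) (frame N k) (iota z)) (iota a)"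
        if a: "a \<in> AN N" for a
      proof -
        have "iota (mmul (dimK N) a z) = iota (mmul (dimK N) z a)"
          using \<open>z \<in> ZA N\<close> a unfolding ZA_def by auto
        then have "mmul (dimH N) (iota a) (iota z) = mmul (dimH N) (iota z) (iota a)"
          unfolding dimH_def iota_mmul_iota .
        then show ?thesis
          using frame_central[OF a, of k] mmul_assoc by metis
      qed
      then show ?thesis
        unfolding ZE_def using Omega1_iota_right[OF frame_Omega1 ZA_AN[OF that(2)]] by blast
    qed
  qed (assumption | rule t frame_ZE coef_ZE_ZA AN_intros ZA_AN finite.intros)+
  show ?thesis unfolding part1_def Let_def using 1 2 3 by blast
qed

end

subsection \<open>The Koszul formula for a constant metric\<close>

lemma contract:
  fixes G h :: "nat \<Rightarrow> nat \<Rightarrow> complex"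
  assumes "\<And>k. k \<in> {1,2,3} \<Longrightarrow> (\<Sum>m\<in>{1,2,3}. h k m * G m b) = (if k = b then 1 else 0)" "b \<in> {1,2,3}"
  shows "(\<Sum>m\<in>{1,2,3}. G m b * (\<Sum>k\<in>{1,2,3}. h k m * f k)) = f b"
proof -
  have "(\<Sum>m\<in>{1,2,3}. G m b * (\<Sum>k\<in>{1,2,3}. h k m * f k))
     = (\<Sum>k\<in>{1,2,3}. (\<Sum>m\<in>{1,2,3}. h k m * G m b) * f k)"
    by (simp add: algebra_simps)
  also have "\<dots> = (\<Sum>k\<in>{1,2,3}. if k = b then f k else 0)"
    by (intro sum.cong refl) (simp only: assms(1), simp)
  also have "\<dots> = f b" using assms(2) by auto
  finally show ?thesis .
qed

text \<open>The double sum of h_kj G_jm h_lm is h_kl when summed over \<open>m\<close> first and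
  h_lk when summed over \<open>j\<close> first. This is also what makes the left inverse
  \<open>h\<close> two-sided in \<open>inv_h\<close>.\<close>

lemma inverse_symmetric:
  fixes G h :: "nat \<Rightarrow> nat \<Rightarrow> complex"
  assumes G: "\<And>k l. k \<in> {1,2,3} \<Longrightarrow> l \<in> {1,2,3} \<Longrightarrow> G k l = G l k"
    and h: "\<And>k l. k \<in> {1,2,3} \<Longrightarrow> l \<in> {1,2,3} \<Longrightarrow> (\<Sum>m\<in>{1,2,3}. h k m * G m l) = (if k = l then 1 else 0)"
    and kl: "k \<in> {1,2,3}" "l \<in> {1,2,3}"
  shows "h k l = h l k"
proof -
  have "h k l = (\<Sum>j\<in>{1,2,3}. h k j * (if l = j then 1 else 0))"
    using kl by auto
  also have "\<dots> = (\<Sum>j\<in>{1,2,3}. h k j * (\<Sum>m\<in>{1,2,3}. h l m * G j m))"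
  proof (intro sum.cong refl arg_cong[of _ _ "(*) _"])
    fix j :: nat assume j: "j \<in> {1,2,3}"
    show "(if l = j then 1 else 0) = (\<Sum>m\<in>{1,2,3}. h l m * G j m)"
      unfolding h[OF kl(2) j, symmetric] by (intro sum.cong refl arg_cong[of _ _ "(*) _"] G j)
  qed
  also have "\<dots> = (\<Sum>m\<in>{1,2,3}. h l m * (\<Sum>j\<in>{1,2,3}. h k j * G j m))"
    by (simp add: algebra_simps)
  also have "\<dots> = (\<Sum>m\<in>{1,2,3}. h l m * (if k = m then 1 else 0))"
    using kl by (intro sum.cong refl arg_cong[of _ _ "(*) _"] h)
  also have "\<dots> = h l k" using kl by auto
  finally show ?thesis .
qed

text \<open>The Levi-Civita symbol on {1, 2, 3}, here as the structure constants of su(2); it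
  prescribes the antisymmetric part of the connection coefficients on the frame.\<close>

definition eps :: "nat \<Rightarrow> nat \<Rightarrow> nat \<Rightarrow> complex" where
  "eps k l a = (if l = nxt k \<and> a = nxt l then 1 else if k = nxt l \<and> a = nxt k then -1 else 0)"

locale const_metric =
  fixes G h :: "nat \<Rightarrow> nat \<Rightarrow> complex"
  assumes G_sym: "k \<in> {1,2,3} \<Longrightarrow> l \<in> {1,2,3} \<Longrightarrow> G k l = G l k"
    and h_inv: "k \<in> {1,2,3} \<Longrightarrow> l \<in> {1,2,3} \<Longrightarrow> (\<Sum>m\<in>{1,2,3}. h k m * G m l) = (if k = l then 1 else 0)"
begin

lemma h_sym: "k \<in> {1,2,3} \<Longrightarrow> l \<in> {1,2,3} \<Longrightarrow> h k l = h l k"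
  by (rule inverse_symmetric[OF G_sym h_inv])

lemma inv_h:
  assumes "k \<in> {1,2,3}" "l \<in> {1,2,3}"
  shows "(\<Sum>m\<in>{1,2,3}. G k m * h m l) = (if k = l then 1 else 0)"
proof -
  have "(\<Sum>m\<in>{1,2,3}. G k m * h m l) = (\<Sum>m\<in>{1,2,3}. h l m * G m k)"
    using assms by (intro sum.cong refl) (metis G_sym h_sym mult.commute)
  then show ?thesis using h_inv[OF assms(2,1)] by auto
qed

lemma lower_raise: "b \<in> {1,2,3} \<Longrightarrow> (\<Sum>m\<in>{1,2,3}. G m b * (\<Sum>k\<in>{1,2,3}. h k m * f k)) = f b"
  by (rule contract) (rule h_inv)

lemma raise_lower: "b \<in> {1,2,3} \<Longrightarrow> (\<Sum>m\<in>{1,2,3}. h m b * (\<Sum>k\<in>{1,2,3}. G k m * f k)) = f b"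
  by (rule contract) (rule inv_h)

text \<open>\<open>\<Gamma> a k l\<close> is meant as the coefficient of e_k \<otimes> e_l in
  \<nabla> e_a. After lowering the last two indices, compatibility is antisymmetry in the first two,
  and vanishing torsion prescribes the change under exchange of the last two.\<close>

lemma christoffel_exists:
  obtains \<Gamma> :: "nat \<Rightarrow> nat \<Rightarrow> nat \<Rightarrow> complex" where
    "\<And>a b l. a \<in> {1,2,3} \<Longrightarrow> b \<in> {1,2,3} \<Longrightarrow> l \<in> {1,2,3} \<Longrightarrow>
       (\<Sum>m\<in>{1,2,3}. G m b * \<Gamma> a m l) + (\<Sum>m\<in>{1,2,3}. G m a * \<Gamma> b m l) = 0"
    "\<And>a k l. a \<in> {1,2,3} \<Longrightarrow> k \<in> {1,2,3} \<Longrightarrow> l \<in> {1,2,3} \<Longrightarrow> \<Gamma> a k l - \<Gamma> a l k = eps k l a"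
proof
  \<comment> \<open>The symbol \<open>eps\<close> with its first two indices lowered by
    \<open>G\<close>, antisymmetric in \<open>b\<close> and \<open>c\<close>.\<close>
  define T where "T a b c = (\<Sum>i\<in>{1,2,3}. G i b * (\<Sum>j\<in>{1,2,3}. G j c * eps i j a))" for a b c
  have T_anti: "T a c b = - T a b c" for a b c
  proof -
    have "T a c b = (\<Sum>j\<in>{1,2,3}. G j b * (\<Sum>i\<in>{1,2,3}. G i c * eps i j a))"
      unfolding T_def by (simp add: algebra_simps)
    also have "\<dots> = (\<Sum>j\<in>{1,2,3}. G j b * (\<Sum>i\<in>{1,2,3}. G i c * - eps j i a))"
      by (intro sum.cong refl arg_cong[of _ _ "(*) _"]) (auto simp: eps_def nxt_def)
    also have "\<dots> = - T a b c" unfolding T_def by (simp add: algebra_simps)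
    finally show ?thesis .
  qed
  \<comment> \<open>Koszul combination: by \<open>T_anti\<close> alone, exchanging \<open>a\<close>
    and \<open>b\<close> reverses its sign, and its difference under exchange of \<open>b\<close>
    and \<open>c\<close> is \<open>T a b c\<close>.\<close>
  define L where "L a b c = (T a b c - T c a b + T b c a) / 2" for a b c
  have L_anti: "L a b c + L b a c = 0" for a b c
    unfolding L_def using T_anti[of a b c] T_anti[of c a b] T_anti[of b a c] by (simp add: field_simps)
  have L_tor: "L a b c - L a c b = T a b c" for a b c
    unfolding L_def using T_anti[of a b c] T_anti[of c a b] T_anti[of b a c] by (simp add: field_simps)
  define \<Gamma> where "\<Gamma> a k l = (\<Sum>b\<in>{1,2,3}. h b k * (\<Sum>c\<in>{1,2,3}. h c l * L a b c))" for a k l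
  have low: "(\<Sum>m\<in>{1,2,3}. G m b * \<Gamma> a m l) = (\<Sum>c\<in>{1,2,3}. h c l * L a b c)" if "b \<in> {1,2,3}" for a b l
    unfolding \<Gamma>_def by (rule lower_raise[OF that])
  show "(\<Sum>m\<in>{1,2,3}. G m b * \<Gamma> a m l) + (\<Sum>m\<in>{1,2,3}. G m a * \<Gamma> b m l) = 0"
    if "a \<in> {1,2,3}" "b \<in> {1,2,3}" for a b l
    unfolding low[OF that(1)] low[OF that(2)]
    by (simp only: sum.distrib[symmetric] distrib_left[symmetric] L_anti, simp)
  show "\<Gamma> a k l - \<Gamma> a l k = eps k l a" if "k \<in> {1,2,3}" "l \<in> {1,2,3}" for a k l
  proof -
    have inner: "(\<Sum>c\<in>{1,2,3}. h c l * T a b c) = (\<Sum>i\<in>{1,2,3}. G i b * (\<Sum>c\<in>{1,2,3}. h c l * (\<Sum>j\<in>{1,2,3}. G j c * eps i j a)))" for b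
      unfolding T_def by (simp add: algebra_simps)
    have "\<Gamma> a l k = (\<Sum>b\<in>{1,2,3}. h b k * (\<Sum>c\<in>{1,2,3}. h c l * L a c b))"
      unfolding \<Gamma>_def by (simp add: algebra_simps)
    then have "\<Gamma> a k l - \<Gamma> a l k = (\<Sum>b\<in>{1,2,3}. h b k * (\<Sum>c\<in>{1,2,3}. h c l * T a b c))"
      unfolding \<Gamma>_def L_tor[symmetric] by (simp only: sum_subtractf right_diff_distrib)
    also have "(\<Sum>b\<in>{1,2,3}. h b k * (\<Sum>c\<in>{1,2,3}. h c l * T a b c)) = eps k l a"
      unfolding inner raise_lower[OF that(2)] by (rule raise_lower[OF that(1)])
    finally show ?thesis .
  qed
qed

text \<open>The homogeneous system. An array antisymmetric in the first pair and symmetric in the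
  last pair of indices vanishes, because six alternating exchanges return each entry with the
  opposite sign. Both lowered indices are then raised again.\<close>

lemma christoffel_unique:
  fixes \<Gamma> :: "nat \<Rightarrow> nat \<Rightarrow> nat \<Rightarrow> complex"
  assumes compat: "\<And>a b l. a \<in> {1,2,3} \<Longrightarrow> b \<in> {1,2,3} \<Longrightarrow> l \<in> {1,2,3} \<Longrightarrow>
       (\<Sum>m\<in>{1,2,3}. G m b * \<Gamma> a m l) + (\<Sum>m\<in>{1,2,3}. G m a * \<Gamma> b m l) = 0"
    and torsion: "\<And>a k l. a \<in> {1,2,3} \<Longrightarrow> k \<in> {1,2,3} \<Longrightarrow> l \<in> {1,2,3} \<Longrightarrow> \<Gamma> a k l = \<Gamma> a l k"
    and akl: "a \<in> {1,2,3}" "k \<in> {1,2,3}" "l \<in> {1,2,3}"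
  shows "\<Gamma> a k l = 0"
proof -
  define L where "L a b c = (\<Sum>m\<in>{1,2,3}. G m b * (\<Sum>l\<in>{1,2,3}. G l c * \<Gamma> a m l))" for a b c
  have L_sym: "L a b c = L a c b" if "a \<in> {1,2,3}" for a b c
  proof -
    have "L a b c = (\<Sum>m\<in>{1,2,3}. G m b * (\<Sum>l\<in>{1,2,3}. G l c * \<Gamma> a l m))"
      unfolding L_def using that by (intro sum.cong refl arg_cong[of _ _ "(*) _"] torsion)
    also have "\<dots> = L a c b" unfolding L_def by (simp add: algebra_simps)
    finally show ?thesis .
  qed
  have L_anti: "L a b c = - L b a c" if "a \<in> {1,2,3}" "b \<in> {1,2,3}" for a b c
  proof -
    have "L a b c + L b a c = (\<Sum>l\<in>{1,2,3}. G l c * ((\<Sum>m\<in>{1,2,3}. G m b * \<Gamma> a m l) + (\<Sum>m\<in>{1,2,3}. G m a * \<Gamma> b m l)))"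
      unfolding L_def by (simp add: algebra_simps)
    also have "\<dots> = (\<Sum>l\<in>{1,2,3}. G l c * 0)"
      using that by (intro sum.cong refl arg_cong[of _ _ "(*) _"] compat)
    finally show ?thesis by (simp add: eq_neg_iff_add_eq_0)
  qed
  have L: "L a b c = 0" if "b \<in> {1,2,3}" "c \<in> {1,2,3}" for b c
  proof -
    have "L a b c = - L a b c"
      using L_sym L_anti akl(1) that by (metis (no_types) minus_minus)
    then show ?thesis by simp
  qed
  have "(\<Sum>b\<in>{1,2,3}. h b k * L a b c) = (\<Sum>l\<in>{1,2,3}. G l c * \<Gamma> a k l)" for c
    unfolding L_def by (rule raise_lower[OF akl(2)])
  moreover have "(\<Sum>b\<in>{1,2,3}. h b k * L a b c) = 0" if "c \<in> {1,2,3}" for c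
    using L that by (intro sum.neutral) auto
  ultimately have "(\<Sum>l\<in>{1,2,3}. G l c * \<Gamma> a k l) = 0" if "c \<in> {1,2,3}" for c
    using that by metis
  then have "(\<Sum>c\<in>{1,2,3}. h c l * (\<Sum>l\<in>{1,2,3}. G l c * \<Gamma> a k l)) = 0"
    by (intro sum.neutral) simp
  then show ?thesis unfolding raise_lower[OF akl(3)] .
qed

end

subsection \<open>Connections in coordinates\<close>

context fuzzy_sphere
begin

lemma connection_coord_add:
  assumes "is_connection N nb" "v \<in> Omega1 N" "w \<in> Omega1 N" "k \<in> {1,2,3}" "l \<in> {1,2,3}"
  shows "coord N (nb (v + w)) k l = coord N (nb v) k l + coord N (nb w) k l"
proof -
  have nb: "nb v \<in> EE N" "nb w \<in> EE N" "nb (v + w) \<in> EE N" "teqE N (nb (v + w)) (nb v + nb w)"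
    using assms Omega1_add unfolding is_connection_def by blast+
  then have "coord N (nb (v + w)) k l = coord N (nb v + nb w) k l"
    using teqE_iff[OF nb(3) EE_closed(1)[OF nb(1,2)]] assms by blast
  then show ?thesis using nb by (simp only: coord_add EE_fin)
qed

lemma connection_coord_module:
  assumes "is_connection N nb" "w \<in> Omega1 N" "a \<in> AN N" "k \<in> {1,2,3}" "l \<in> {1,2,3}"
  shows "coord N (nb (mmul (dimH N) w (iota a))) k l
    = mmul (dimK N) (coord N (nb w) k l) a + mmul (dimK N) (coef k w) (der N l a)"
proof -
  let ?w = "mmul (dimH N) w (iota a)"
  have wa: "?w \<in> Omega1 N" using Omega1_iota_right assms by blast
  have nb: "nb w \<in> EE N" "nb ?w \<in> EE N" "teqE N (nb ?w) (rmulT N (nb w) a + tg w (dA N a))"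
    using assms wa unfolding is_connection_def by blast+
  have EE: "rmulT N (nb w) a \<in> EE N" "tg w (dA N a) \<in> EE N"
    using nb assms rmulT_EE EE_tg dA_Omega1 by blast+
  then have "coord N (nb ?w) k l = coord N (rmulT N (nb w) a + tg w (dA N a)) k l"
    using teqE_iff[OF nb(2) EE_closed(1)[OF EE]] nb assms by blast
  then show ?thesis
    using nb EE assms by (simp only: coord_add EE_fin coord_rmulT coord_tg coef_dA)
qed

lemma sum_three: "(\<Sum>k\<in>{1,2,3::nat}. f k) = f 1 + (f 2 + f 3)" for f :: "nat \<Rightarrow> 'a::comm_monoid_add"
  by simp

text \<open>By the Leibniz rule on products of frame elements with A_N, a connection is determined
  by its values on the frame. The tensor e_k \<otimes> df puts the direction of the derivative into
  the second index.\<close>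

lemma connection_coord:
  assumes "is_connection N nb" "w \<in> Omega1 N" "k \<in> {1,2,3}" "l \<in> {1,2,3}"
  shows "coord N (nb w) k l = (\<Sum>a\<in>{1,2,3}. mmul (dimK N) (coord N (nb (frame N a)) k l) (coef a w)) + der N l (coef k w)"
proof -
  let ?e = "\<lambda>a. mmul (dimH N) (frame N a) (iota (coef a w))"
  have e: "?e a \<in> Omega1 N" if "a \<in> {1,2,3}" for a
    using Omega1_iota_right[OF frame_Omega1 coef_AN[OF assms(2) that]] .
  have c: "coord N (nb (?e a)) k l = mmul (dimK N) (coord N (nb (frame N a)) k l) (coef a w)
       + (if a = k then der N l (coef k w) else 0)" if "a \<in> {1,2,3}" for a
  proof (cases "a = k")
    case True
    have "der N l (coef a w) \<in> mats (dimK N)"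
      using der_AN[OF coef_AN[OF assms(2) that]] unfolding AN_def .
    then show ?thesis
      unfolding connection_coord_module[OF assms(1) frame_Omega1 coef_AN[OF assms(2) that] assms(3,4)] coef_frame[OF assms(3)]
      using True by (simp only: idm_mmul simp_thms if_True)
  next
    case False
    then show ?thesis
      unfolding connection_coord_module[OF assms(1) frame_Omega1 coef_AN[OF assms(2) that] assms(3,4)] coef_frame[OF assms(3)]
      by (simp only: mmul_zero_left if_False not_sym[OF False] add_0_right)
  qed
  have "coord N (nb w) k l = coord N (nb (\<Sum>a\<in>{1,2,3}. ?e a)) k l"
    using frame_expansion[OF assms(2)] by simp
  also have "\<dots> = (\<Sum>a\<in>{1,2,3}. coord N (nb (?e a)) k l)"
    unfolding sum_three
    by (subst connection_coord_add[OF assms(1) _ _ assms(3,4)], (intro e Omega1_add; simp)+)+ simp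
  also have "\<dots> = (\<Sum>a\<in>{1,2,3}. mmul (dimK N) (coord N (nb (frame N a)) k l) (coef a w)) + (\<Sum>a\<in>{1,2,3}. if a = k then der N l (coef k w) else 0)"
    unfolding sum.distrib[symmetric] by (intro sum.cong refl c)
  also have "(\<Sum>a\<in>{1,2,3}. if a = k then der N l (coef k w) else 0) = der N l (coef k w)"
    using assms(3) by auto
  finally show ?thesis .
qed

text \<open>Torsion is defined through all presentations of a form. By
  \<open>two_form_structure\<close> the presentation affects only the scalar part, which lies in
  \<open>J2 N\<close>, so three equations for each form remain.\<close>

lemma torsionless_iff:
  assumes nb: "\<And>w. w \<in> Omega1 N \<Longrightarrow> nb w \<in> EE N"
  shows "torsionless N nb \<longleftrightarrow> (\<forall>w\<in>Omega1 N. \<forall>m\<in>{1,2,3}. asym (coord N (nb w)) m = - dform N w m)"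
proof -
  have "multE N (nb (one_form N ps)) + two_form N ps \<in> J2 N \<longleftrightarrow>
     (\<forall>m\<in>{1,2,3}. asym (coord N (nb (one_form N ps))) m = - dform N (one_form N ps) m)"
    if ps: "set ps \<subseteq> AN N \<times> AN N" for ps
  proof -
    let ?w = "one_form N ps"
    have w: "?w \<in> Omega1 N" unfolding Omega1_altdef using ps by blast
    obtain a where a: "a \<in> AN N" "two_form N ps = iota a - form (dform N ?w)"
      using two_form_structure[OF ps] by blast
    have 1: "mult2 (coord N (nb ?w)) \<in> two_forms N"
      using nb[OF w] by (intro mult2_two_forms coord_AN)
    define c where "c k = (if k \<in> {1,2,3} then - dform N ?w k else 0)" for k
    have "- dform N ?w k \<in> AN N" if "k \<in> {1,2,3}" for k
      unfolding dform_def by (intro AN_intros coef_AN[OF w] nxt_in that)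
    then have "c k \<in> AN N" for k
      using AN_intros(4)[of N] unfolding c_def by (simp only: split: if_split) blast
    moreover have "form c = form (\<lambda>k. - dform N ?w k)" by (rule form_cong) (simp only: c_def if_True)
    then have "two_form N ps = iota a + form c"
      unfolding a form_minus by simp
    ultimately have 2: "two_form N ps \<in> two_forms N"
      unfolding two_forms_def using a(1) by blast
    have "multE N (nb ?w) + two_form N ps \<in> J2 N \<longleftrightarrow>
        (\<forall>m\<in>{1,2,3}. coef m (mult2 (coord N (nb ?w)) + two_form N ps) = 0)"
      unfolding multE_coord[OF nb[OF w]] by (rule two_forms_J2[OF N two_forms_add[OF 1 2]])
    also have "\<dots> \<longleftrightarrow> (\<forall>m\<in>{1,2,3}. asym (coord N (nb ?w)) m = - dform N ?w m)"
      by (intro ball_cong refl)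
        (simp only: a coef_add coef_diff coef_iota coef_form coef_mult2,
         simp only: diff_0 neg_equal_0_iff_equal minus_add_distrib[symmetric] eq_neg_iff_add_eq_0)
    finally show ?thesis .
  qed
  then show ?thesis
    unfolding torsionless_def one_form_def[symmetric] two_form_def[symmetric] Omega1_altdef by blast
qed

text \<open>The frame has constant coefficients, so only the Maurer-Cartan term survives.\<close>

lemma dform_frame:
  assumes "a \<in> {1,2,3}" "m \<in> {1,2,3}"
  shows "dform N (frame N a) m = - (if m = a then idm (dimK N) else 0)"
proof -
  have "der N i (coef j (frame N a)) = 0" if "j \<in> {1,2,3}" for i j
    unfolding coef_frame[OF that] by (simp only: der_idm der_zero split: if_split) simp
  then have "dform N (frame N a) m = 0 - 0 - coef m (frame N a)"
    unfolding dform_def using nxt_in assms by metis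
  then show ?thesis by (simp only: coef_frame[OF assms(2)]) simp
qed

end

subsection \<open>Metrics and the Levi-Civita connection\<close>

text \<open>Pulls the scalar coordinates \<open>u\<close> and \<open>v\<close> of two central forms
  out of a compatibility sum, so that the equations for pairs of frame elements can be used
  inside.\<close>

lemma bilinear_regroup:
  fixes u v :: "nat \<Rightarrow> complex"
  shows "(\<Sum>k\<in>K. \<Sum>m\<in>K. v k * S m k * (\<Sum>a\<in>K. A a m * u a))
    = (\<Sum>a\<in>K. \<Sum>b\<in>K. u a * v b * (\<Sum>m\<in>K. S m b * A a m))"
proof -
  have "(\<Sum>k\<in>K. \<Sum>m\<in>K. \<Sum>a\<in>K. v k * S m k * (A a m * u a)) = (\<Sum>k\<in>K. \<Sum>a\<in>K. \<Sum>m\<in>K. u a * v k * (S m k * A a m))"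
    by (rule sum.cong[OF refl], subst sum.swap) (simp only: mult_ac)
  also have "\<dots> = (\<Sum>a\<in>K. \<Sum>k\<in>K. \<Sum>m\<in>K. u a * v k * (S m k * A a m))"
    by (rule sum.swap)
  finally show ?thesis by (simp only: sum_distrib_left)
qed

locale fuzzy_metric = fuzzy_sphere +
  fixes g :: "cmat \<Rightarrow> cmat \<Rightarrow> cmat"
  assumes metric: "is_metric N antiT g"
begin

lemma g_AN: "x \<in> Omega1 N \<Longrightarrow> y \<in> Omega1 N \<Longrightarrow> g x y \<in> AN N"
  using conjunct1[OF metric[unfolded is_metric_def]] by blast

lemma g_add_left: "x \<in> Omega1 N \<Longrightarrow> x' \<in> Omega1 N \<Longrightarrow> y \<in> Omega1 N \<Longrightarrow> g (x + x') y = g x y + g x' y"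
  using metric unfolding is_metric_def by blast

lemma g_add_right: "x \<in> Omega1 N \<Longrightarrow> y \<in> Omega1 N \<Longrightarrow> y' \<in> Omega1 N \<Longrightarrow> g x (y + y') = g x y + g x y'"
  using metric unfolding is_metric_def by blast

lemma g_smul: "x \<in> Omega1 N \<Longrightarrow> y \<in> Omega1 N \<Longrightarrow> g (smul c x) y = smul c (g x y)"
  "x \<in> Omega1 N \<Longrightarrow> y \<in> Omega1 N \<Longrightarrow> g x (smul c y) = smul c (g x y)"
  using metric unfolding is_metric_def by blast+

lemma g_balanced: "x \<in> Omega1 N \<Longrightarrow> y \<in> Omega1 N \<Longrightarrow> a \<in> AN N \<Longrightarrow>
    g (mmul (dimH N) x (iota a)) y = g x (mmul (dimH N) (iota a) y)"
  using metric unfolding is_metric_def by blast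

lemma g_left: "x \<in> Omega1 N \<Longrightarrow> y \<in> Omega1 N \<Longrightarrow> a \<in> AN N \<Longrightarrow>
    g (mmul (dimH N) (iota a) x) y = mmul (dimK N) a (g x y)"
  using metric unfolding is_metric_def by blast

lemma g_right: "x \<in> Omega1 N \<Longrightarrow> y \<in> Omega1 N \<Longrightarrow> a \<in> AN N \<Longrightarrow>
    g x (mmul (dimH N) y (iota a)) = mmul (dimK N) (g x y) a"
  using metric unfolding is_metric_def by blast

lemma g_sigma: "t \<in> EE N \<Longrightarrow> gT g (sigmaF N antiT t) = gT g t"
  using metric unfolding is_metric_def by blast

lemma g_represents: "rhom N phi \<Longrightarrow> \<exists>e\<in>Omega1 N. \<forall>y\<in>Omega1 N. phi y = g e y"
  using metric unfolding is_metric_def by blast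

section \<open>The Gram matrix of a metric\<close>

definition gram :: "nat \<Rightarrow> nat \<Rightarrow> complex" where
  "gram k l = g (frame N k) (frame N l) 0 0"

text \<open>The value commutes with every \<open>a\<close>: bring \<open>a\<close> in from the left,
  past the central e_k, across the tensor sign, past the central e_l, and out on the right.\<close>

lemma g_frame: "g (frame N k) (frame N l) = smul (gram k l) (idm (dimK N))"
  unfolding gram_def
proof (rule scalar_matrix_if_central[OF _ dimK_pos])
  show "g (frame N k) (frame N l) \<in> mats (dimK N)"
    using g_AN[OF frame_Omega1 frame_Omega1] unfolding AN_def .
  fix a assume "a \<in> mats (dimK N)"
  then have a: "a \<in> AN N" unfolding AN_def .
  note e = frame_Omega1
  show "mmul (dimK N) (g (frame N k) (frame N l)) a = mmul (dimK N) a (g (frame N k) (frame N l))"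
    unfolding g_right[OF e e a, symmetric] g_left[OF e e a, symmetric]
    by (simp only: frame_central[OF a, symmetric] g_balanced[OF e e a, symmetric])
qed

lemma Omega1_additive_sum:
  assumes "\<And>x. x \<in> {1,2,3} \<Longrightarrow> f x \<in> Omega1 N"
    "\<And>v w. v \<in> Omega1 N \<Longrightarrow> w \<in> Omega1 N \<Longrightarrow> L (v + w) = (L v + L w :: cmat)"
  shows "L (\<Sum>x\<in>{1,2,3::nat}. f x) = (\<Sum>x\<in>{1,2,3}. L (f x))"
proof -
  have "L (f 1 + (f 2 + f 3)) = L (f 1) + (L (f 2) + L (f 3))"
    using assms Omega1_add by (simp del: plus_fun_apply)
  then show ?thesis unfolding sum_three .
qed

lemma g_frame_right:
  assumes "x \<in> Omega1 N"
  shows "g x (frame N l) = (\<Sum>k\<in>{1,2,3}. smul (gram k l) (coef k x))"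
proof -
  note e = frame_Omega1
  let ?x = "\<lambda>k. mmul (dimH N) (frame N k) (iota (coef k x))"
  have "g x (frame N l) = g (\<Sum>k\<in>{1,2,3}. ?x k) (frame N l)"
    by (rule arg_cong[OF frame_expansion[OF assms]])
  also have "\<dots> = (\<Sum>k\<in>{1,2,3}. g (?x k) (frame N l))"
    by (rule Omega1_additive_sum[of ?x "\<lambda>v. g v (frame N l)"])
      (intro Omega1_iota_right e coef_AN[OF assms], assumption, intro g_add_left e)
  also have "\<dots> = (\<Sum>k\<in>{1,2,3}. smul (gram k l) (coef k x))"
  proof (intro sum.cong refl)
    fix k :: nat assume k: "k \<in> {1,2,3}"
    have "g (?x k) (frame N l) = mmul (dimK N) (coef k x) (smul (gram k l) (idm (dimK N)))"
      unfolding frame_central[OF coef_AN[OF assms k], symmetric] g_left[OF e e coef_AN[OF assms k]] g_frame ..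
    then show "g (?x k) (frame N l) = smul (gram k l) (coef k x)"
      using coef_AN[OF assms k] unfolding AN_def by (simp only: mmul_smul_right mmul_idm)
  qed
  finally show ?thesis .
qed

lemma g_expand_right:
  assumes "x \<in> Omega1 N" "y \<in> Omega1 N"
  shows "g x y = (\<Sum>k\<in>{1,2,3}. mmul (dimK N) (g x (frame N k)) (coef k y))"
proof -
  note e = frame_Omega1
  let ?y = "\<lambda>k. mmul (dimH N) (frame N k) (iota (coef k y))"
  have "g x y = g x (\<Sum>k\<in>{1,2,3}. ?y k)"
    by (rule arg_cong[OF frame_expansion[OF assms(2)]])
  also have "\<dots> = (\<Sum>k\<in>{1,2,3}. g x (?y k))"
    by (rule Omega1_additive_sum[of ?y "g x"])
      (intro Omega1_iota_right e coef_AN[OF assms(2)], assumption, intro g_add_right assms)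
  also have "\<dots> = (\<Sum>k\<in>{1,2,3}. mmul (dimK N) (g x (frame N k)) (coef k y))"
    by (intro sum.cong refl g_right assms e coef_AN)
  finally show ?thesis .
qed

text \<open>Invariance of \<open>g\<close> under the flip, tested on two frame elements. As
  \<open>sigmaF\<close> is known only up to \<open>teqE\<close>, \<open>g\<close> must first be seen
  to respect the relations.\<close>

lemma gram_sym:
  assumes "k \<in> {1,2,3}" "l \<in> {1,2,3}"
  shows "gram k l = gram l k"
proof -
  note e = frame_Omega1
  let ?t = "tg (frame N k) (frame N l)"
  have t: "?t \<in> EE N" "tg (frame N l) (frame N k) \<in> EE N" by (intro EE_tg e)+
  have "teqE N (sigmaF N antiT ?t) (tg (frame N l) (frame N k))"
    by (intro sigmaF_flip frame_ZE)
  then have "gT g (sigmaF N antiT ?t) = gT g (tg (frame N l) (frame N k))"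
    unfolding gT_def teqE_def
    by (rule tE.teq_tsumM[OF _ EE_fin[OF sigmaF_EE[OF t(1)]] EE_fin[OF t(2)]])
      (assumption | rule g_add_left g_add_right g_smul g_balanced)+
  then have "g (frame N k) (frame N l) = g (frame N l) (frame N k)"
    using g_sigma[OF t(1)] unfolding gT_def tsumM_tg by metis
  then show ?thesis unfolding gram_def by simp
qed

text \<open>Representing the coordinate functionals by \<open>g\<close> inverts the Gram matrix.\<close>

lemma gram_inverse_exists:
  obtains h where "const_metric gram h"
proof -
  have "\<exists>e\<in>Omega1 N. \<forall>y\<in>Omega1 N. coef k y = g e y" if k: "k \<in> {1,2,3}" for k
    by (rule g_represents, unfold rhom_def, intro conjI ballI allI)
      (assumption | rule k coef_add coef_smul coef_iota_right coef_AN)+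
  then obtain e where e: "\<And>k. k \<in> {1,2,3} \<Longrightarrow> e k \<in> Omega1 N \<and> (\<forall>y\<in>Omega1 N. coef k y = g (e k) y)"
    by metis
  have "const_metric gram (\<lambda>k m. coef m (e k) 0 0)"
  proof
    fix k l :: nat assume kl: "k \<in> {1,2,3}" "l \<in> {1,2,3}"
    show "gram k l = gram l k" by (rule gram_sym[OF kl])
    have "coef k (frame N l) = (\<Sum>m\<in>{1,2,3}. smul (gram m l) (coef m (e k)))"
      using e[OF kl(1)] frame_Omega1[of l] g_frame_right[of "e k" l] by simp
    then have "coef k (frame N l) 0 0 = (\<Sum>m\<in>{1,2,3}. coef m (e k) 0 0 * gram m l)"
      by (simp only: sum_fun2_apply) (simp add: smul_def mult.commute)
    then show "(\<Sum>m\<in>{1,2,3}. coef m (e k) 0 0 * gram m l) = (if k = l then 1 else 0)"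
      using dimK_pos unfolding coef_frame[OF kl(1)] by (cases "k = l") (simp_all add: idm_def)
  qed
  then show ?thesis by (rule that)
qed

section \<open>The compatibility condition in coordinates\<close>

lemma gid_coord:
  assumes "x \<in> Omega1 N" "t \<in> EE N"
  shows "gid N g x t = form (\<lambda>l. \<Sum>k\<in>{1,2,3}. mmul (dimK N) (g x (frame N k)) (coord N t k l))"
proof -
  have "gid N g x t = tsumM t (\<lambda>y z. form (\<lambda>l. \<Sum>k\<in>{1,2,3}. mmul (dimK N) (g x (frame N k)) (mmul (dimK N) (coef k y) (coef l z))))"
    unfolding gid_def
  proof (rule tsumM_cong)
    fix y z assume "t (y, z) \<noteq> 0"
    then have yz: "y \<in> Omega1 N" "z \<in> Omega1 N" using EE_support[OF assms(2)] by blast+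
    have "mmul (dimH N) (iota (g x y)) z = mmul (dimH N) (iota (g x y)) (form (\<lambda>l. coef l z))"
      unfolding form_coef[OF yz(2)] ..
    also have "\<dots> = form (\<lambda>l. mmul (dimK N) (g x y) (coef l z))"
      unfolding dimH_def iota_mmul_form ..
    finally show "mmul (dimH N) (iota (g x y)) z =
       form (\<lambda>l. \<Sum>k\<in>{1,2,3}. mmul (dimK N) (g x (frame N k)) (mmul (dimK N) (coef k y) (coef l z)))"
      by (simp only: g_expand_right[OF assms(1) yz(1)] mmul_sum_left mmul_assoc)
  qed
  also have "\<dots> = form (\<lambda>l. \<Sum>k\<in>{1,2,3}. tsumM t (\<lambda>y z. mmul (dimK N) (g x (frame N k)) (mmul (dimK N) (coef k y) (coef l z))))"
    unfolding tsumM_form tsumM_sum_right ..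
  also have "\<dots> = form (\<lambda>l. \<Sum>k\<in>{1,2,3}. mmul (dimK N) (g x (frame N k)) (coord N t k l))"
    unfolding coord_def tsumM_mmul ..
  finally show ?thesis .
qed

definition cval :: "nat \<Rightarrow> cmat \<Rightarrow> complex" where
  "cval k w = coef k w 0 0"

lemma coef_cval: "w \<in> ZE N \<Longrightarrow> k \<in> {1,2,3} \<Longrightarrow> coef k w = smul (cval k w) (idm (dimK N))"
  unfolding cval_def by (rule coef_ZE)

lemma cval_frame: "k \<in> {1,2,3} \<Longrightarrow> cval k (frame N a) = (if k = a then 1 else 0)"
  using dimK_pos unfolding cval_def by (simp add: coef_frame idm_def)

text \<open>The flip transposes coordinates, so \<open>g\<close> contracts \<open>x1\<close> with
  \<open>y\<close> and leaves the second index of \<open>t\<close> free. The coefficients of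
  \<open>y\<close> are scalars and come out in front.\<close>

lemma sigma_term:
  assumes "t \<in> EE N" "y \<in> ZE N"
  shows "tsumM t (\<lambda>x1 x2. gid N g x1 (sigmaF N antiT (tg x2 y)))
    = form (\<lambda>l. \<Sum>k\<in>{1,2,3}. \<Sum>m\<in>{1,2,3}. smul (cval k y * gram m k) (coord N t m l))"
proof -
  have y: "y \<in> Omega1 N" by (rule ZE_Omega1[OF assms(2)])
  have "tsumM t (\<lambda>x1 x2. gid N g x1 (sigmaF N antiT (tg x2 y)))
    = tsumM t (\<lambda>x1 x2. form (\<lambda>l. \<Sum>k\<in>{1,2,3}. \<Sum>m\<in>{1,2,3}. smul (cval k y * gram m k) (mmul (dimK N) (coef m x1) (coef l x2))))"
  proof (rule tsumM_cong)
    fix x1 x2 assume "t (x1, x2) \<noteq> 0"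
    then have x: "x1 \<in> Omega1 N" "x2 \<in> Omega1 N" using EE_support[OF assms(1)] by blast+
    note EE = EE_tg[OF x(2) y]
    have "gid N g x1 (sigmaF N antiT (tg x2 y))
       = form (\<lambda>l. \<Sum>k\<in>{1,2,3}. mmul (dimK N) (g x1 (frame N k)) (coord N (sigmaF N antiT (tg x2 y)) k l))"
      by (rule gid_coord[OF x(1) sigmaF_EE[OF EE]])
    also have "\<dots> = form (\<lambda>l. \<Sum>k\<in>{1,2,3}. \<Sum>m\<in>{1,2,3}. smul (cval k y * gram m k) (mmul (dimK N) (coef m x1) (coef l x2)))"
    proof (intro form_cong sum.cong refl)
      fix l k :: nat assume lk: "l \<in> {1,2,3}" "k \<in> {1,2,3}"
      have "coef l x2 \<in> mats (dimK N)" using coef_AN[OF x(2) lk(1)] unfolding AN_def .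
      then have "coord N (sigmaF N antiT (tg x2 y)) k l = smul (cval k y) (coef l x2)"
        by (simp only: coord_sigmaF[OF EE lk(2,1)] coord_tg coef_cval[OF assms(2) lk(2)] mmul_smul_right mmul_idm)
      then show "mmul (dimK N) (g x1 (frame N k)) (coord N (sigmaF N antiT (tg x2 y)) k l)
         = (\<Sum>m\<in>{1,2,3}. smul (cval k y * gram m k) (mmul (dimK N) (coef m x1) (coef l x2)))"
        by (simp only: g_frame_right[OF x(1)] mmul_sum_left mmul_smul_left mmul_smul_right smul_sum smul_smul)
    qed
    finally show "gid N g x1 (sigmaF N antiT (tg x2 y))
       = form (\<lambda>l. \<Sum>k\<in>{1,2,3}. \<Sum>m\<in>{1,2,3}. smul (cval k y * gram m k) (mmul (dimK N) (coef m x1) (coef l x2)))" .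
  qed
  also have "\<dots> = form (\<lambda>l. \<Sum>k\<in>{1,2,3}. \<Sum>m\<in>{1,2,3}. smul (cval k y * gram m k) (coord N t m l))"
    unfolding tsumM_form tsumM_sum_right tsumM_smul coord_def ..
  finally show ?thesis .
qed

lemma g_central_frame:
  assumes "w \<in> ZE N"
  shows "g w (frame N k) = smul (\<Sum>m\<in>{1,2,3}. cval m w * gram m k) (idm (dimK N))"
  unfolding g_frame_right[OF ZE_Omega1[OF assms]] smul_sum_coeff
  by (intro sum.cong refl) (simp only: coef_cval[OF assms] smul_smul mult.commute)

lemma direct_term:
  assumes "t \<in> EE N" "w \<in> ZE N"
  shows "gid N g w t = form (\<lambda>l. \<Sum>k\<in>{1,2,3}. \<Sum>m\<in>{1,2,3}. smul (cval m w * gram m k) (coord N t k l))"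
proof -
  have w: "w \<in> Omega1 N" by (rule ZE_Omega1[OF assms(2)])
  show ?thesis
    unfolding gid_coord[OF w assms(1)]
  proof (intro form_cong sum.cong refl)
    fix l k :: nat assume lk: "l \<in> {1,2,3}" "k \<in> {1,2,3}"
    have "coord N t k l \<in> mats (dimK N)" using coord_AN[OF assms(1) lk(2,1)] unfolding AN_def .
    then show "mmul (dimK N) (g w (frame N k)) (coord N t k l) = (\<Sum>m\<in>{1,2,3}. smul (cval m w * gram m k) (coord N t k l))"
      by (simp only: g_central_frame[OF assms(2)] mmul_smul_left idm_mmul smul_sum_coeff[symmetric])
  qed
qed

text \<open>The metric of two central forms is a scalar matrix, so the right-hand side of
  compatibility is zero and the condition becomes purely algebraic.\<close>

lemma g_central_constant:
  assumes "w \<in> ZE N" "y \<in> ZE N"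
  shows "dA N (g w y) = 0"
proof -
  have w: "w \<in> Omega1 N" and y: "y \<in> Omega1 N" using assms ZE_Omega1 by blast+
  have "g w y = smul (\<Sum>k\<in>{1,2,3}. (\<Sum>m\<in>{1,2,3}. cval m w * gram m k) * cval k y) (idm (dimK N))"
    unfolding g_expand_right[OF w y] g_central_frame[OF assms(1)] smul_sum_coeff
    by (intro sum.cong refl)
      (simp only: coef_cval[OF assms(2)] smul_sum_coeff[symmetric] mmul_smul_left mmul_smul_right idm_mmul idm_mats smul_smul mult.commute)
  then show ?thesis
    unfolding dA_form by (intro form_eq_zero) (simp only: der_smul der_idm smul_zero)
qed

lemma compatible_iff:
  assumes "\<And>w. w \<in> Omega1 N \<Longrightarrow> nb w \<in> EE N"
  shows "compatible N antiT g nb \<longleftrightarrow> (\<forall>w\<in>ZE N. \<forall>y\<in>ZE N. \<forall>l\<in>{1,2,3}.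
     (\<Sum>k\<in>{1,2,3}. \<Sum>m\<in>{1,2,3}. smul (cval k y * gram m k) (coord N (nb w) m l))
     + (\<Sum>k\<in>{1,2,3}. \<Sum>m\<in>{1,2,3}. smul (cval m w * gram m k) (coord N (nb y) k l)) = 0)"
  unfolding compatible_def
proof (intro ball_cong refl)
  fix w y assume w: "w \<in> ZE N" and y: "y \<in> ZE N"
  have nb: "nb w \<in> EE N" "nb y \<in> EE N" using assms ZE_Omega1 w y by blast+
  have form_zero_iff: "form c = 0 \<longleftrightarrow> (\<forall>l\<in>{1,2,3}. c l = 0)" for c
    using form_eq_iff[of c "\<lambda>k. 0"] form_zero by simp
  show "(tsumM (nb w) (\<lambda>x1 x2. gid N g x1 (sigmaF N antiT (tg x2 y))) + gid N g w (nb y) = dA N (g w y)) \<longleftrightarrow>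
    (\<forall>l\<in>{1,2,3}. (\<Sum>k\<in>{1,2,3}. \<Sum>m\<in>{1,2,3}. smul (cval k y * gram m k) (coord N (nb w) m l))
     + (\<Sum>k\<in>{1,2,3}. \<Sum>m\<in>{1,2,3}. smul (cval m w * gram m k) (coord N (nb y) k l)) = 0)"
    unfolding sigma_term[OF nb(1) y] direct_term[OF nb(2) w] g_central_constant[OF w y] form_add[symmetric]
    by (rule form_zero_iff)
qed

section \<open>Existence and uniqueness of the Levi-Civita connection\<close>

lemma LC_exists: "\<exists>nb. LC_conn N antiT g nb"
proof -
  obtain h where "const_metric gram h" by (rule gram_inverse_exists)
  then interpret const_metric gram h .
  obtain \<Gamma> where compat: "\<And>a b l. a \<in> {1,2,3} \<Longrightarrow> b \<in> {1,2,3} \<Longrightarrow> l \<in> {1,2,3} \<Longrightarrow>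
       (\<Sum>m\<in>{1,2,3}. gram m b * \<Gamma> a m l) + (\<Sum>m\<in>{1,2,3}. gram m a * \<Gamma> b m l) = 0"
    and torsion: "\<And>a k l. a \<in> {1,2,3} \<Longrightarrow> k \<in> {1,2,3} \<Longrightarrow> l \<in> {1,2,3} \<Longrightarrow> \<Gamma> a k l - \<Gamma> a l k = eps k l a"
    by (rule christoffel_exists) blast
  \<comment> \<open>The shape dictated by \<open>connection_coord\<close>, with constants as the
    coefficients on the frame.\<close>
  define T where "T w k l = (\<Sum>a\<in>{1,2,3}. smul (\<Gamma> a k l) (coef a w)) + der N l (coef k w)" for w k l
  define nb where "nb w = of_coord N (T w)" for w
  have T: "T w k l \<in> AN N" if "w \<in> Omega1 N" "k \<in> {1,2,3}" "l \<in> {1,2,3}" for w k l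
    unfolding T_def by (intro AN_intros coef_AN that)
  have nb: "nb w \<in> EE N" if "w \<in> Omega1 N" for w
    unfolding nb_def by (intro of_coord_EE T that)
  have C: "coord N (nb w) k l = T w k l" if "w \<in> Omega1 N" "k \<in> {1,2,3}" "l \<in> {1,2,3}" for w k l
    unfolding nb_def by (intro coord_of_coord T that)
  have "is_connection N nb"
    unfolding is_connection_def
  proof (intro conjI ballI allI)
    fix w assume w: "w \<in> Omega1 N"
    show "nb w \<in> EE N" by (rule nb[OF w])
    fix v assume v: "v \<in> Omega1 N"
    have vw: "w + v \<in> Omega1 N" by (rule Omega1_add[OF w v])
    show "teqE N (nb (w + v)) (nb w + nb v)"
      unfolding teqE_iff[OF nb[OF vw] EE_closed(1)[OF nb[OF w] nb[OF v]]]
    proof (intro ballI)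
      fix k l :: nat assume kl: "k \<in> {1,2,3}" "l \<in> {1,2,3}"
      show "coord N (nb (w + v)) k l = coord N (nb w + nb v) k l"
        unfolding coord_add[OF EE_fin[OF nb[OF w]] EE_fin[OF nb[OF v]]] C[OF vw kl] C[OF w kl] C[OF v kl] T_def
        by (simp only: coef_add smul_add der_add sum.distrib ac_simps)
    qed
  next
    fix c w assume w: "w \<in> Omega1 N"
    have cw: "smul c w \<in> Omega1 N" by (rule Omega1_smul[OF w])
    show "teqE N (nb (smul c w)) (fsc c (nb w))"
      unfolding teqE_iff[OF nb[OF cw] EE_closed(3)[OF nb[OF w]]]
    proof (intro ballI)
      fix k l :: nat assume kl: "k \<in> {1,2,3}" "l \<in> {1,2,3}"
      show "coord N (nb (smul c w)) k l = coord N (fsc c (nb w)) k l"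
        unfolding coord_fsc C[OF cw kl] C[OF w kl] T_def
        by (simp only: coef_smul smul_add der_smul smul_sum smul_smul mult.commute)
    qed
  next
    fix w a assume w: "w \<in> Omega1 N" and a: "a \<in> AN N"
    have wa: "mmul (dimH N) w (iota a) \<in> Omega1 N" by (rule Omega1_iota_right[OF w a])
    note EE = rmulT_EE[OF nb[OF w] a] EE_tg[OF w dA_Omega1[OF a]]
    show "teqE N (nb (mmul (dimH N) w (iota a))) (rmulT N (nb w) a + tg w (dA N a))"
      unfolding teqE_iff[OF nb[OF wa] EE_closed(1)[OF EE]]
    proof (intro ballI)
      fix k l :: nat assume kl: "k \<in> {1,2,3}" "l \<in> {1,2,3}"
      have "(\<Sum>b\<in>{1,2,3}. smul (\<Gamma> b k l) (coef b (mmul (dimH N) w (iota a)))) =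
         mmul (dimK N) (\<Sum>b\<in>{1,2,3}. smul (\<Gamma> b k l) (coef b w)) a"
        unfolding mmul_sum_left by (intro sum.cong refl) (simp only: coef_iota_right[OF w] mmul_smul_left)
      then show "coord N (nb (mmul (dimH N) w (iota a))) k l = coord N (rmulT N (nb w) a + tg w (dA N a)) k l"
        unfolding coord_add[OF EE[THEN EE_fin]] C[OF wa kl] coord_rmulT[OF nb[OF w] kl(2)] C[OF w kl] coord_tg
          coef_dA[OF kl(2)] T_def coef_iota_right[OF w kl(1)]
        by (simp only: der_mmul mmul_add_left add.assoc)
    qed
  qed
  moreover have "torsionless N nb"
  proof (subst torsionless_iff, rule nb, assumption, intro ballI)
    fix w m assume w: "w \<in> Omega1 N" and m: "m \<in> {1,2,3::nat}"
    let ?k = "nxt m" and ?l = "nxt (nxt m)"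
    have kl: "?k \<in> {1,2,3}" "?l \<in> {1,2,3}" using m nxt_in by blast+
    \<comment> \<open>Only \<open>a = m\<close> completes \<open>?k\<close>, \<open>?l\<close> to an
      even permutation.\<close>
    have eps: "eps ?k ?l a = (if a = m then 1 else 0)" for a
      using m by (elim insertE emptyE; hypsubst; simp only: nxt_simps eps_def; simp add: nxt_def)
    have "(\<Sum>a\<in>{1,2,3}. smul (\<Gamma> a ?k ?l) (coef a w)) - (\<Sum>a\<in>{1,2,3}. smul (\<Gamma> a ?l ?k) (coef a w))
       = (\<Sum>a\<in>{1,2,3}. smul (eps ?k ?l a) (coef a w))"
      unfolding sum_subtractf[symmetric] torsion[OF _ kl, symmetric]
      by (intro sum.cong refl) (simp add: torsion[OF _ kl, symmetric], simp add: smul_def fun_eq_iff algebra_simps)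
    also have "\<dots> = (\<Sum>a\<in>{1,2,3}. if a = m then coef a w else 0)"
      unfolding eps by (intro sum.cong refl) simp
    also have "\<dots> = coef m w" using m by auto
    finally have *: "(\<Sum>a\<in>{1,2,3}. smul (\<Gamma> a ?k ?l) (coef a w)) = coef m w + (\<Sum>a\<in>{1,2,3}. smul (\<Gamma> a ?l ?k) (coef a w))"
      by (simp only: diff_eq_eq)
    show "asym (coord N (nb w)) m = - dform N w m"
      unfolding asym_def C[OF w kl] C[OF w kl(2,1)] T_def * dform_def
      by (simp del: plus_fun_apply minus_apply uminus_apply add: algebra_simps)
  qed
  moreover have "compatible N antiT g nb"
  proof (subst compatible_iff, rule nb, assumption, intro ballI)
    fix w y l assume w: "w \<in> ZE N" and y: "y \<in> ZE N" and l: "l \<in> {1,2,3::nat}"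
    let ?I = "idm (dimK N)"
    \<comment> \<open>Central forms have constant coefficients, so the derivative term drops and
      every coordinate of \<open>nb v\<close> is a scalar matrix.\<close>
    have Z: "coord N (nb v) m l = smul (\<Sum>a\<in>{1,2,3}. \<Gamma> a m l * cval a v) ?I" if v: "v \<in> ZE N" "m \<in> {1,2,3}" for v m
    proof -
      have "(\<Sum>a\<in>{1,2,3}. smul (\<Gamma> a m l) (coef a v)) = (\<Sum>a\<in>{1,2,3}. smul (\<Gamma> a m l * cval a v) ?I)"
        by (intro sum.cong refl) (simp only: coef_cval[OF v(1)] smul_smul)
      moreover have "der N l (coef m v) = 0"
        by (simp only: coef_cval[OF v] der_smul der_idm smul_zero)
      ultimately show ?thesis
        by (simp only: C[OF ZE_Omega1[OF v(1)] v(2) l] T_def smul_sum_coeff add_0_right)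
    qed
    have "(\<Sum>k\<in>{1,2,3}. \<Sum>m\<in>{1,2,3}. smul (cval k y * gram m k) (coord N (nb w) m l))
     + (\<Sum>k\<in>{1,2,3}. \<Sum>m\<in>{1,2,3}. smul (cval m w * gram m k) (coord N (nb y) k l))
     = (\<Sum>k\<in>{1,2,3}. \<Sum>m\<in>{1,2,3}. smul (cval k y * gram m k * (\<Sum>a\<in>{1,2,3}. \<Gamma> a m l * cval a w)) ?I)
     + (\<Sum>k\<in>{1,2,3}. \<Sum>m\<in>{1,2,3}. smul (cval m w * gram m k * (\<Sum>a\<in>{1,2,3}. \<Gamma> a k l * cval a y)) ?I)"
      by (intro arg_cong2[of _ _ _ _ "(+)"] sum.cong refl) (simp_all only: Z w y smul_smul)
    also have "\<dots> = smul ((\<Sum>k\<in>{1,2,3}. \<Sum>m\<in>{1,2,3}. cval k y * gram m k * (\<Sum>a\<in>{1,2,3}. \<Gamma> a m l * cval a w))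
     + (\<Sum>k\<in>{1,2,3}. \<Sum>m\<in>{1,2,3}. cval m w * gram m k * (\<Sum>a\<in>{1,2,3}. \<Gamma> a k l * cval a y))) ?I"
      by (simp only: smul_sum_coeff smul_add_coeff)
    also have "(\<Sum>k\<in>{1,2,3}. \<Sum>m\<in>{1,2,3}. cval k y * gram m k * (\<Sum>a\<in>{1,2,3}. \<Gamma> a m l * cval a w))
     + (\<Sum>k\<in>{1,2,3}. \<Sum>m\<in>{1,2,3}. cval m w * gram m k * (\<Sum>a\<in>{1,2,3}. \<Gamma> a k l * cval a y)) = 0"
    proof -
      have "(\<Sum>k\<in>{1,2,3}. \<Sum>m\<in>{1,2,3}. cval k y * gram m k * (\<Sum>a\<in>{1,2,3}. \<Gamma> a m l * cval a w))
        = (\<Sum>a\<in>{1,2,3}. \<Sum>b\<in>{1,2,3}. cval a w * cval b y * (\<Sum>m\<in>{1,2,3}. gram m b * \<Gamma> a m l))"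
        by (rule bilinear_regroup)
      \<comment> \<open>Here the indices of the Gram matrix must be exchanged before regrouping,
        which uses its symmetry.\<close>
      moreover have "(\<Sum>k\<in>{1,2,3}. \<Sum>m\<in>{1,2,3}. cval m w * gram m k * (\<Sum>a\<in>{1,2,3}. \<Gamma> a k l * cval a y))
         = (\<Sum>a\<in>{1,2,3}. \<Sum>b\<in>{1,2,3}. cval a w * cval b y * (\<Sum>m\<in>{1,2,3}. gram m a * \<Gamma> b m l))"
      proof -
        have "(\<Sum>k\<in>{1,2,3}. \<Sum>m\<in>{1,2,3}. cval m w * gram m k * (\<Sum>a\<in>{1,2,3}. \<Gamma> a k l * cval a y))
          = (\<Sum>m\<in>{1,2,3}. \<Sum>k\<in>{1,2,3}. cval m w * gram k m * (\<Sum>a\<in>{1,2,3}. \<Gamma> a k l * cval a y))"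
        proof (subst sum.swap, rule sum.cong[OF refl], rule sum.cong[OF refl])
          fix m k :: nat assume mk: "m \<in> {1,2,3}" "k \<in> {1,2,3}"
          show "cval m w * gram m k * (\<Sum>a\<in>{1,2,3}. \<Gamma> a k l * cval a y)
            = cval m w * gram k m * (\<Sum>a\<in>{1,2,3}. \<Gamma> a k l * cval a y)"
            unfolding gram_sym[OF mk] ..
        qed
        also have "\<dots> = (\<Sum>b\<in>{1,2,3}. \<Sum>a\<in>{1,2,3}. cval b y * cval a w * (\<Sum>m\<in>{1,2,3}. gram m a * \<Gamma> b m l))"
          by (rule bilinear_regroup)
        also have "\<dots> = (\<Sum>a\<in>{1,2,3}. \<Sum>b\<in>{1,2,3}. cval a w * cval b y * (\<Sum>m\<in>{1,2,3}. gram m a * \<Gamma> b m l))"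
          by (subst sum.swap) (simp only: mult.commute)
        finally show ?thesis .
      qed
      ultimately have "(\<Sum>k\<in>{1,2,3}. \<Sum>m\<in>{1,2,3}. cval k y * gram m k * (\<Sum>a\<in>{1,2,3}. \<Gamma> a m l * cval a w))
        + (\<Sum>k\<in>{1,2,3}. \<Sum>m\<in>{1,2,3}. cval m w * gram m k * (\<Sum>a\<in>{1,2,3}. \<Gamma> a k l * cval a y))
        = (\<Sum>a\<in>{1,2,3}. \<Sum>b\<in>{1,2,3}. cval a w * cval b y *
             ((\<Sum>m\<in>{1,2,3}. gram m b * \<Gamma> a m l) + (\<Sum>m\<in>{1,2,3}. gram m a * \<Gamma> b m l)))"
        by (simp only: sum.distrib distrib_left)
      also have "\<dots> = (\<Sum>a\<in>{1,2,3}. \<Sum>b\<in>{1,2,3}. cval a w * cval b y * 0)"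
        using l by (intro sum.cong refl arg_cong[of _ _ "(*) _"] compat)
      finally show ?thesis by simp
    qed
    finally show "(\<Sum>k\<in>{1,2,3}. \<Sum>m\<in>{1,2,3}. smul (cval k y * gram m k) (coord N (nb w) m l))
     + (\<Sum>k\<in>{1,2,3}. \<Sum>m\<in>{1,2,3}. smul (cval m w * gram m k) (coord N (nb y) k l)) = 0"
      by (simp only: smul_zero)
  qed
  ultimately show ?thesis unfolding LC_conn_def by blast
qed

lemma LC_frame_torsion:
  assumes "LC_conn N antiT g nb" "a \<in> {1,2,3}" "m \<in> {1,2,3}"
  shows "asym (coord N (nb (frame N a))) m = (if m = a then idm (dimK N) else 0)"
proof -
  have nb: "nb w \<in> EE N" if "w \<in> Omega1 N" for w
    using assms(1) that unfolding LC_conn_def is_connection_def by blast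
  have "asym (coord N (nb (frame N a))) m = - dform N (frame N a) m"
    using assms torsionless_iff[of nb, OF nb] frame_Omega1 unfolding LC_conn_def by blast
  then show ?thesis by (simp only: dform_frame[OF assms(2,3)] minus_minus)
qed

text \<open>The coordinates of \<open>nb\<close> on the frame are matrices, not known to be scalar.
  As the Gram matrix is scalar, the condition holds separately in each entry \<open>i\<close>,
  \<open>j\<close>.\<close>

lemma LC_frame_compatible:
  assumes "LC_conn N antiT g nb" "a \<in> {1,2,3}" "b \<in> {1,2,3}" "l \<in> {1,2,3}"
  shows "(\<Sum>m\<in>{1,2,3}. gram m b * coord N (nb (frame N a)) m l i j)
    + (\<Sum>m\<in>{1,2,3}. gram m a * coord N (nb (frame N b)) m l i j) = 0"
proof -
  have nb: "nb w \<in> EE N" if "w \<in> Omega1 N" for w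
    using assms(1) that unfolding LC_conn_def is_connection_def by blast
  have 1: "(\<Sum>k\<in>{1,2,3}. \<Sum>m\<in>{1,2,3}. smul (cval k (frame N b) * gram m k) (coord N (nb (frame N a)) m l))
     + (\<Sum>k\<in>{1,2,3}. \<Sum>m\<in>{1,2,3}. smul (cval m (frame N a) * gram m k) (coord N (nb (frame N b)) k l)) = 0"
    using assms compatible_iff[of nb, OF nb] frame_ZE unfolding LC_conn_def by blast
  have "(\<Sum>k\<in>{1,2,3}. \<Sum>m\<in>{1,2,3}. smul (cval k (frame N b) * gram m k) (coord N (nb (frame N a)) m l))
     = (\<Sum>k\<in>{1,2,3}. if k = b then (\<Sum>m\<in>{1,2,3}. smul (gram m b) (coord N (nb (frame N a)) m l)) else 0)"
    by (intro sum.cong refl) (simp add: cval_frame)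
  also have "\<dots> = (\<Sum>m\<in>{1,2,3}. smul (gram m b) (coord N (nb (frame N a)) m l))"
    by (subst sum.delta) (use assms(3) in auto)
  finally have 2: "(\<Sum>k\<in>{1,2,3}. \<Sum>m\<in>{1,2,3}. smul (cval k (frame N b) * gram m k) (coord N (nb (frame N a)) m l))
     = (\<Sum>m\<in>{1,2,3}. smul (gram m b) (coord N (nb (frame N a)) m l))" .
  have 3: "(\<Sum>k\<in>{1,2,3}. \<Sum>m\<in>{1,2,3}. smul (cval m (frame N a) * gram m k) (coord N (nb (frame N b)) k l))
     = (\<Sum>k\<in>{1,2,3}. smul (gram k a) (coord N (nb (frame N b)) k l))"
  proof (intro sum.cong refl)
    fix k :: nat assume k: "k \<in> {1,2,3}"
    have "(\<Sum>m\<in>{1,2,3}. smul (cval m (frame N a) * gram m k) (coord N (nb (frame N b)) k l))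
       = (\<Sum>m\<in>{1,2,3}. if m = a then smul (gram a k) (coord N (nb (frame N b)) k l) else 0)"
      by (intro sum.cong refl) (simp add: cval_frame)
    also have "\<dots> = smul (gram a k) (coord N (nb (frame N b)) k l)"
      by (subst sum.delta) (use assms(2) in auto)
    finally show "(\<Sum>m\<in>{1,2,3}. smul (cval m (frame N a) * gram m k) (coord N (nb (frame N b)) k l))
       = smul (gram k a) (coord N (nb (frame N b)) k l)"
      using gram_sym[OF assms(2) k] by simp
  qed
  from fun_cong[OF fun_cong[OF 1[unfolded 2 3]], of i j] show ?thesis
    by (simp only: plus_fun_apply zero_fun_apply sum_fun2_apply) (simp only: smul_def)
qed

text \<open>By \<open>connection_coord\<close> it suffices to compare on the frame. There each
  matrix entry of the difference solves the homogeneous system of \<open>christoffel_unique\<close>,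
  as the torsion of both connections is prescribed by the same values.\<close>

lemma LC_unique:
  assumes "LC_conn N antiT g nb" "LC_conn N antiT g nb'" "w \<in> Omega1 N"
  shows "teqE N (nb w) (nb' w)"
proof -
  obtain h where "const_metric gram h" by (rule gram_inverse_exists)
  then interpret const_metric gram h .
  have conn: "is_connection N nb" "is_connection N nb'" using assms unfolding LC_conn_def by blast+
  have EE: "nb w \<in> EE N" "nb' w \<in> EE N" using conn assms(3) unfolding is_connection_def by blast+
  have eq: "coord N (nb (frame N a)) k l = coord N (nb' (frame N a)) k l"
    if akl: "a \<in> {1,2,3}" "k \<in> {1,2,3}" "l \<in> {1,2,3}" for a k l
  proof (intro ext)
    fix i j
    define \<Delta> where "\<Delta> a k l = coord N (nb (frame N a)) k l i j - coord N (nb' (frame N a)) k l i j" for a k l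
    have "\<Delta> a k l = 0"
    proof (rule christoffel_unique[OF _ _ akl])
      fix a b l :: nat assume abl: "a \<in> {1,2,3}" "b \<in> {1,2,3}" "l \<in> {1,2,3}"
      show "(\<Sum>m\<in>{1,2,3}. gram m b * \<Delta> a m l) + (\<Sum>m\<in>{1,2,3}. gram m a * \<Delta> b m l) = 0"
        using LC_frame_compatible[OF assms(1) abl, of i j] LC_frame_compatible[OF assms(2) abl, of i j]
        unfolding \<Delta>_def right_diff_distrib sum_subtractf by (simp only: add_diff_add[symmetric] diff_self)
    next
      fix a k l :: nat assume akl: "a \<in> {1,2,3}" "k \<in> {1,2,3}" "l \<in> {1,2,3}"
      have "\<forall>m\<in>{1,2,3}. asym (\<lambda>k l. coord N (nb (frame N a)) k l - coord N (nb' (frame N a)) k l) m = 0"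
      proof
        fix m :: nat assume m: "m \<in> {1,2,3}"
        have "asym (\<lambda>k l. coord N (nb (frame N a)) k l - coord N (nb' (frame N a)) k l) m
          = asym (coord N (nb (frame N a))) m - asym (coord N (nb' (frame N a))) m"
          unfolding asym_def by (simp only: diff_diff_add diff_add_eq algebra_simps)
        then show "asym (\<lambda>k l. coord N (nb (frame N a)) k l - coord N (nb' (frame N a)) k l) m = 0"
          by (simp only: LC_frame_torsion[OF assms(1) akl(1) m] LC_frame_torsion[OF assms(2) akl(1) m] diff_self)
      qed
      then have "coord N (nb (frame N a)) k l - coord N (nb' (frame N a)) k l
         = coord N (nb (frame N a)) l k - coord N (nb' (frame N a)) l k"
        unfolding asym_eq_zero_iff using akl by blast
      from fun_cong[OF fun_cong[OF this], of i j] show "\<Delta> a k l = \<Delta> a l k"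
        unfolding \<Delta>_def by simp
    qed
    then show "coord N (nb (frame N a)) k l i j = coord N (nb' (frame N a)) k l i j"
      unfolding \<Delta>_def by simp
  qed
  show ?thesis
    unfolding teqE_iff[OF EE]
  proof (intro ballI)
    fix k l :: nat assume kl: "k \<in> {1,2,3}" "l \<in> {1,2,3}"
    show "coord N (nb w) k l = coord N (nb' w) k l"
      unfolding connection_coord[OF conn(1) assms(3) kl] connection_coord[OF conn(2) assms(3) kl]
      by (intro arg_cong2[of _ _ _ _ "(+)"] sum.cong refl) (simp only: eq kl)
  qed
qed

end

theorem theorem8p5:
  fixes N :: nat
  assumes "1 \<le> N"
  shows "part1 N \<and>
    (\<exists>F. good_F N F \<and>
         (\<forall>w \<in> ZE N. \<forall>y \<in> ZE N. teqE N (sigmaF N F (tg w y)) (tg y w)) \<and>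
         (\<forall>g. is_metric N F g \<longrightarrow>
              (\<exists>nb. LC_conn N F g nb) \<and>
              (\<forall>nb nb'. LC_conn N F g nb \<and> LC_conn N F g nb' \<longrightarrow>
                 (\<forall>w \<in> Omega1 N. teqE N (nb w) (nb' w)))))"
proof -
  interpret fuzzy_sphere N using assms by unfold_locales
  have LC: "(\<exists>nb. LC_conn N antiT g nb) \<and>
      (\<forall>nb nb'. LC_conn N antiT g nb \<and> LC_conn N antiT g nb' \<longrightarrow> (\<forall>w \<in> Omega1 N. teqE N (nb w) (nb' w)))"
    if "is_metric N antiT g" for g
  proof -
    interpret fuzzy_metric N g using that by unfold_locales
    show ?thesis using LC_exists LC_unique by blast
  qed
  then show ?thesis using part1_holds good_F_antiT sigmaF_flip by blast
qed

end
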